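(* Let $\sigma,\nu>0$. The integral representation of the unitary transform $[\mathcal{B}^{\sigma,\nu}_{\mathbb{T}}]^{-1}:\mathcal{F}^{2,\nu}(\mathbb{T})\to L^{2,\sigma}_{\mathbb{T}}(\mathbb{R})$, the inverse of the bicomplex Segal--Bargmann transform, is given by $$[\mathcal{B}^{\sigma,\nu}_{\mathbb{T}}]^{-1}(f)(x)=\left(\frac{\nu}{\pi}\right)^2\int_{\mathbb{T}}e^{-\nu|Z|^2-\frac{\nu}{4}(Z^* )^2+\sqrt{\sigma\nu}\,xZ^*}f(Z)\,d\lambda(Z).$$
   Context: Bicomplex numbers: $\mathbb{T}=\{Z=z_1+jz_2:\ z_1,z_2\in\mathbb{C}\}$ is the commutative algebra in which $i^2=j^2=-1$, $ij=ji$ and $\mathbb{C}=\mathbb{R}+i\mathbb{R}$. Put $e_\pm=\frac{1\pm ij}{2}$; then $e_\pm^2=e_\pm$, $e_+e_-=0$, $e_++e_-=1$. Every $Z=z_1+jz_2$ is uniquely $Z=\alpha e_++\beta e_-$ with $\alpha=z_1-iz_2$, $\beta=z_1+iz_2\in\mathbb{C}$; algebraic operations are componentwise in $(\alpha,\beta)$, and $e^Z=e^\alpha e_++e^\beta e_-$. Set $Z^*=\overline{\alpha}e_++\overline{\beta}e_-$ and $|Z|^2=|z_1|^2+|z_2|^2=\frac{|\alpha|^2+|\beta|^2}{2}$. $\lambda$ is Lebesgue measure on $\mathbb{T}\equiv\mathbb{R}^4$ (real coordinates of $z_1,z_2$). For a $\mathbb{T}$-valued inner product, writing $\langle f,f\rangle=a\,e_++b\,e_-$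 with $a,b\ge0$, the induced norm is $\|f\|^2=\frac{a+b}{2}$. $L^{2,\sigma}_{\mathbb{T}}(\mathbb{R})$ is the space of (classes of) functions $\varphi=\varphi^+e_++\varphi^-e_-:\mathbb{R}\to\mathbb{T}$ with $\varphi^\pm:\mathbb{R}\to\mathbb{C}$ square integrable for $e^{-\sigma x^2}dx$, with inner product $\langle\varphi,\psi\rangle=\left(\frac{\sigma}{\pi}\right)^{1/2}\int_{\mathbb{R}}\varphi(x)\psi(x)^*e^{-\sigma x^2}dx$ and its induced norm. $\mathcal{H}^{2,\nu}(\mathbb{T})$ is the space of Borel measurable $f:\mathbb{T}\to\mathbb{T}$ (modulo a.e. equality) of finite induced norm for $\langle f,g\rangle=\left(\frac{\nu}{\pi}\right)^2\int_{\mathbb{T}} f(Z)g(Z)^*e^{-\nu|Z|^2}d\lambda(Z)$. A function $f:\mathbb{T}\to\mathbb{T}$ is bicomplex holomorphic if for every $Z_0\in\mathbb{T}$ the limit of $\frac{f(Z_0+H)-f(Z_0)}{H}$ as $H\to0$, $H\notin\mathcal{NC}$, exists and is finite, where $\mathcal{NC}=\{\alpha e_++\beta e_-:\alpha\beta=0\}$. $\mathcal{F}^{2,\nu}(\mathbb{T})$ is the set of bicomplex holomorphic functions on $\mathbb{T}$ belonging to $\mathcal{H}^{2,\nu}(\mathbb{T})$, with the inner product and norm of $\mathcal{H}^{2,\nu}(\mathbb{T})$. The bicomplex Segal--Bargmann transform is $\mathcal{B}^{\sigma,\nu}_{\mathbb{T}}(\varphi)(Z)=\left(\frac{\sigma}{\pi}\right)^{1/2}\int_{\mathbb{R}}e^{-\sigma\left(x-\sqrt{\frac{\nu}{4\sigma}}Z\right)^2}\varphi(x)\,dx$;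 it is a unitary map of $L^{2,\sigma}_{\mathbb{T}}(\mathbb{R})$ onto $\mathcal{F}^{2,\nu}(\mathbb{T})$.
   Formalization: The integral over 𝕋 need not converge absolutely (e.g. f the transform of an interval's indicator); it is read as the limit in L²-norm of the integrals over balls |Z|≤R, and the formula is asserted literally for a.e. x at which the full integral converges absolutely. *)

theory Defs
  imports "HOL-Analysis.Analysis"
begin

section \<open>Bicomplex numbers\<close>

text \<open>The pair (z1, z2) stands for z1 + j z2.  The product type supplies the additive structure,
  the real scalars, the topology, the norm with (norm Z)^2 = |z1|^2 + |z2|^2, and \<^const>\<open>lborel\<close>,
  which is Lebesgue measure in the four real coordinates.  The norm is not submultiplicative for the
  bicomplex product, so the library's normed-algebra classes (and their exp) do not apply.\<close>

type_synonym bicomplex = "complex \<times> complex"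

definition bc_times :: "bicomplex \<Rightarrow> bicomplex \<Rightarrow> bicomplex" (infixl "*\<^sub>T" 70) where
  "Z *\<^sub>T W = (fst Z * fst W - snd Z * snd W, fst Z * snd W + snd Z * fst W)"

definition bc_of_complex :: "complex \<Rightarrow> bicomplex" where
  "bc_of_complex z = (z, 0)"

definition bc_of_real :: "real \<Rightarrow> bicomplex" where
  "bc_of_real x = bc_of_complex (of_real x)"

text \<open>The idempotents (1 + ij)/2 and (1 - ij)/2.\<close>

definition e_plus :: bicomplex where "e_plus = (1 / 2, \<i> / 2)"
definition e_minus :: bicomplex where "e_minus = (1 / 2, - \<i> / 2)"

definition idem_plus :: "bicomplex \<Rightarrow> complex" where
  "idem_plus Z = fst Z - \<i> * snd Z"

definition idem_minus :: "bicomplex \<Rightarrow> complex" where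
  "idem_minus Z = fst Z + \<i> * snd Z"

definition of_idem :: "complex \<Rightarrow> complex \<Rightarrow> bicomplex" where
  "of_idem \<alpha> \<beta> = bc_of_complex \<alpha> *\<^sub>T e_plus + bc_of_complex \<beta> *\<^sub>T e_minus"

lemma idem_of_idem [simp]:
  "idem_plus (of_idem \<alpha> \<beta>) = \<alpha>" "idem_minus (of_idem \<alpha> \<beta>) = \<beta>"
  by (simp_all add: of_idem_def bc_of_complex_def bc_times_def e_plus_def e_minus_def
      idem_plus_def idem_minus_def algebra_simps)

lemma of_idem_idem [simp]: "of_idem (idem_plus Z) (idem_minus Z) = Z"
  by (simp add: of_idem_def bc_of_complex_def bc_times_def e_plus_def e_minus_def
      idem_plus_def idem_minus_def prod_eq_iff field_simps)

lemma idem_times [simp]: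
  "idem_plus (Z *\<^sub>T W) = idem_plus Z * idem_plus W"
  "idem_minus (Z *\<^sub>T W) = idem_minus Z * idem_minus W"
  by (simp_all add: bc_times_def idem_plus_def idem_minus_def algebra_simps)

lemma norm_bicomplex_idem:
  "(norm (Z :: bicomplex))\<^sup>2 = ((cmod (idem_plus Z))\<^sup>2 + (cmod (idem_minus Z))\<^sup>2) / 2"
proof -
  have "(norm Z)\<^sup>2 = (cmod (fst Z))\<^sup>2 + (cmod (snd Z))\<^sup>2"
    by (simp add: norm_prod_def)
  then show ?thesis
    unfolding cmod_power2 idem_plus_def idem_minus_def
    by (simp add: power2_eq_square algebra_simps)
qed

definition bc_star :: "bicomplex \<Rightarrow> bicomplex" where
  "bc_star Z = of_idem (cnj (idem_plus Z)) (cnj (idem_minus Z))"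

definition bc_exp :: "bicomplex \<Rightarrow> bicomplex" where
  "bc_exp Z = of_idem (exp (idem_plus Z)) (exp (idem_minus Z))"

definition null_cone :: "bicomplex set" where
  "null_cone = {Z. idem_plus Z * idem_minus Z = 0}"

text \<open>The inverse is meaningful outside the null cone only.\<close>

definition bc_inverse :: "bicomplex \<Rightarrow> bicomplex" where
  "bc_inverse Z = of_idem (inverse (idem_plus Z)) (inverse (idem_minus Z))"

lemma bc_inverse_right: "Z \<notin> null_cone \<Longrightarrow> Z *\<^sub>T bc_inverse Z = bc_of_real 1"
proof -
  assume "Z \<notin> null_cone"
  then have "idem_plus (Z *\<^sub>T bc_inverse Z) = idem_plus (bc_of_real 1)"
    "idem_minus (Z *\<^sub>T bc_inverse Z) = idem_minus (bc_of_real 1)"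
    by (simp_all add: null_cone_def bc_inverse_def)
       (simp_all add: bc_of_real_def bc_of_complex_def idem_plus_def idem_minus_def)
  then show ?thesis
    by (metis of_idem_idem)
qed

definition bc_holomorphic :: "(bicomplex \<Rightarrow> bicomplex) \<Rightarrow> bool" where
  "bc_holomorphic f \<longleftrightarrow>
     (\<forall>Z\<^sub>0. \<exists>L. ((\<lambda>H. (f (Z\<^sub>0 + H) - f Z\<^sub>0) *\<^sub>T bc_inverse H) \<longlongrightarrow> L) (at 0 within - null_cone))"

text \<open>The norm induced by a bicomplex inner product whose value at (f, f) is w = a e_plus + b e_minus
  with real a, b \<ge> 0.\<close>

definition bc_induced_norm :: "bicomplex \<Rightarrow> real" where
  "bc_induced_norm w = sqrt ((Re (idem_plus w) + Re (idem_minus w)) / 2)"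


section \<open>The Hilbert spaces\<close>

text \<open>Elements of the L2-spaces are represented by Borel functions; identification modulo equality
  almost everywhere is left to the statements.\<close>

definition L2T :: "real \<Rightarrow> (real \<Rightarrow> bicomplex) set" where
  "L2T \<sigma> = {\<phi> \<in> borel_measurable borel.
     integrable lborel (\<lambda>x. (cmod (idem_plus (\<phi> x)))\<^sup>2 * exp (- \<sigma> * x\<^sup>2)) \<and>
     integrable lborel (\<lambda>x. (cmod (idem_minus (\<phi> x)))\<^sup>2 * exp (- \<sigma> * x\<^sup>2))}"

definition L2T_inner :: "real \<Rightarrow> (real \<Rightarrow> bicomplex) \<Rightarrow> (real \<Rightarrow> bicomplex) \<Rightarrow> bicomplex" where
  "L2T_inner \<sigma> \<phi> \<psi> =
     sqrt (\<sigma> / pi) *\<^sub>R (LINT x|lborel. exp (- \<sigma> * x\<^sup>2) *\<^sub>R (\<phi> x *\<^sub>T bc_star (\<psi> x)))"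

definition L2T_norm :: "real \<Rightarrow> (real \<Rightarrow> bicomplex) \<Rightarrow> real" where
  "L2T_norm \<sigma> \<phi> = bc_induced_norm (L2T_inner \<sigma> \<phi> \<phi>)"

definition H2T_inner :: "real \<Rightarrow> (bicomplex \<Rightarrow> bicomplex) \<Rightarrow> (bicomplex \<Rightarrow> bicomplex) \<Rightarrow> bicomplex" where
  "H2T_inner \<nu> f g =
     (\<nu> / pi)\<^sup>2 *\<^sub>R (LINT Z|lborel. exp (- \<nu> * (norm Z)\<^sup>2) *\<^sub>R (f Z *\<^sub>T bc_star (g Z)))"

text \<open>Both idempotent components of f(Z) f(Z)* are nonnegative, so the induced norm of f is finite
  exactly when the integral defining the inner product of f with itself converges absolutely.\<close>

definition H2T :: "real \<Rightarrow> (bicomplex \<Rightarrow> bicomplex) set" where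
  "H2T \<nu> = {f \<in> borel_measurable borel.
     integrable lborel (\<lambda>Z. exp (- \<nu> * (norm Z)\<^sup>2) *\<^sub>R (f Z *\<^sub>T bc_star (f Z)))}"

definition F2T :: "real \<Rightarrow> (bicomplex \<Rightarrow> bicomplex) set" where
  "F2T \<nu> = {f \<in> H2T \<nu>. bc_holomorphic f}"


section \<open>The bicomplex Segal--Bargmann transform\<close>

definition SB :: "real \<Rightarrow> real \<Rightarrow> (real \<Rightarrow> bicomplex) \<Rightarrow> bicomplex \<Rightarrow> bicomplex" where
  "SB \<sigma> \<nu> \<phi> Z = sqrt (\<sigma> / pi) *\<^sub>R (LINT x|lborel.
     (let W = bc_of_real x - sqrt (\<nu> / (4 * \<sigma>)) *\<^sub>R Z
      in bc_exp (- \<sigma> *\<^sub>R (W *\<^sub>T W)) *\<^sub>T \<phi> x))"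

text \<open>The transform depends only on the almost-everywhere class of its argument; the following picks
  a representative of the class that is mapped to f.\<close>

definition SB_inv :: "real \<Rightarrow> real \<Rightarrow> (bicomplex \<Rightarrow> bicomplex) \<Rightarrow> real \<Rightarrow> bicomplex" where
  "SB_inv \<sigma> \<nu> = inv_into (L2T \<sigma>) (SB \<sigma> \<nu>)"

text \<open>For general f in the Fock space this integrand is not Lebesgue integrable over the whole
  bicomplex space.  If, for instance, f is the transform of the indicator function of an interval,
  then along imaginary directions it decays only like the Fourier transform of a function with
  jumps.  As with Bargmann's classical inversion formula (and Plancherel's theorem), the integral
  over the whole space then denotes the limit in the L2-norm of the integrals over the balls of
  radius R, as R tends to infinity.\<close>

definition SB_inv_integrand ::
    "real \<Rightarrow> real \<Rightarrow> (bicomplex \<Rightarrow> bicomplex) \<Rightarrow> real \<Rightarrow> bicomplex \<Rightarrow> bicomplex" where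
  "SB_inv_integrand \<sigma> \<nu> f x Z =
     bc_exp (bc_of_real (- \<nu> * (norm Z)\<^sup>2) - (\<nu> / 4) *\<^sub>R (bc_star Z *\<^sub>T bc_star Z)
             + (sqrt (\<sigma> * \<nu>) * x) *\<^sub>R bc_star Z) *\<^sub>T f Z"

end

theory Submission
  imports Defs "HOL-Probability.Probability" "HOL-Complex_Analysis.Cauchy_Integral_Formula"
begin

text \<open>In the idempotent coordinates \<open>Z = \<alpha> e\<^sub>+ + \<beta> e\<^sub>-\<close> everything splits into two copies of the classical
  theory.  A bicomplex holomorphic function is \<open>F(\<alpha>) e\<^sub>+ + G(\<beta>) e\<^sub>-\<close> with entire \<open>F\<close> and \<open>G\<close>
  (\<open>bc_holomorphic_iff\<close>), and the transform acts on each component as the complex Bargmann transform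
  \<open>(B \<phi>)(z) = \<integral> k(z,x) \<phi>(x) d\<mu>(x)\<close>, where \<open>\<mu>\<close> is the normalised Gaussian on the line and
  \<open>k(z,x) = exp (sqrt (\<sigma> \<nu>) x z - \<nu> z\<^sup>2 / 4)\<close>.  The proposed inverse is the adjoint \<open>B*\<close>, formally
  \<open>(B* g)(x) = \<integral> cnj k(p(Z),x) g(Z) d\<gamma>(Z)\<close>, with \<open>\<gamma>\<close> the normalised Gaussian on the whole bicomplex space
  and \<open>p(Z)\<close> the chosen component of \<open>Z\<close>.  Keeping the integral over the whole space avoids a change of
  variables: the other component is simply a variable on which nothing depends, apart from the cutoff
  to balls.

  That \<open>B\<close> is unitary comes out of three facts.

  \<^item> The kernel functions satisfy \<open>\<langle>k(z,-), k(w,-)\<rangle> = exp (\<nu> z cnj w / 2)\<close> (\<open>kernel_gram\<close>), so on bounded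
    \<open>g\<close> of bounded support \<open>B B* g\<close> is the integral operator with this kernel.
  \<^item> This kernel reproduces entire functions \<open>F\<close> with \<open>F \<circ> p\<close> in \<open>L\<^sup>2(\<gamma>)\<close> (\<open>reproducing\<close>): by
    translation this is the mean value property \<open>\<integral> F(p(Z)) d\<gamma>(Z) = F(0)\<close>, which follows from the
    rotation invariance of \<open>\<gamma>\<close> and the mean value property on circles.
  \<^item> \<open>B\<close> is injective up to null sets (\<open>bargmann_injective\<close>), since \<open>B \<phi>\<close> on the imaginary axis is the
    Fourier transform of \<open>\<phi> d\<mu>\<close>.

  By the first two facts, \<open>B B*\<close> is an orthogonal projection, which makes \<open>B*\<close> a contraction and then \<open>B\<close> as
  well.  If \<open>f\<close> lies in the Fock space and \<open>f\<^sub>n\<close> is its restriction to the ball of radius \<open>n\<close>, the functions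
  \<open>B* f\<^sub>n\<close> therefore form a Cauchy sequence; its limit \<open>\<phi>\<close> satisfies \<open>B \<phi> = lim B B* f\<^sub>n = f\<close> by the
  reproducing property.  So \<open>B\<close> is onto, and passing to the limit in
  \<open>\<langle>B* f\<^sub>n, \<psi>\<rangle> = \<langle>f\<^sub>n, B \<psi>\<rangle>\<close> gives \<open>\<langle>\<phi>, \<psi>\<rangle> = \<langle>B \<phi>, B \<psi>\<rangle>\<close>; injectivity makes this an isometry.
  Finally \<open>\<parallel>\<phi> - B* (f 1\<^bsub>|Z|\<le>R\<^esub>)\<parallel> \<le> \<parallel>f - f 1\<^bsub>|Z|\<le>R\<^esub>\<parallel>\<close> (\<open>inversion_error\<close>), which tends to zero; this is
  the inversion formula in mean, and along a subsequence also almost everywhere, so that the two readings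
  of the integral agree wherever it converges absolutely.\<close>

section \<open>Square-integrable functions\<close>

definition L2 :: "'a measure \<Rightarrow> ('a \<Rightarrow> complex) set" where
  "L2 M = {f \<in> borel_measurable M. integrable M (\<lambda>x. (cmod (f x))\<^sup>2)}"

definition ip :: "'a measure \<Rightarrow> ('a \<Rightarrow> complex) \<Rightarrow> ('a \<Rightarrow> complex) \<Rightarrow> complex" where
  "ip M f g = (LINT x|M. f x * cnj (g x))"

definition sqnorm :: "'a measure \<Rightarrow> ('a \<Rightarrow> complex) \<Rightarrow> real" where
  "sqnorm M f = (LINT x|M. (cmod (f x))\<^sup>2)"

lemma L2_measurable [measurable_dest]: "f \<in> L2 M \<Longrightarrow> f \<in> borel_measurable M"
  by (simp add: L2_def)

lemma L2_integrable: "f \<in> L2 M \<Longrightarrow> integrable M (\<lambda>x. (cmod (f x))\<^sup>2)"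
  by (simp add: L2_def)

lemma L2_I_bound:
  assumes "f \<in> borel_measurable M" "integrable M h" "\<And>x. x \<in> space M \<Longrightarrow> (cmod (f x))\<^sup>2 \<le> h x"
  shows "f \<in> L2 M"
proof -
  have "integrable M (\<lambda>x. (cmod (f x))\<^sup>2)"
    by (rule Bochner_Integration.integrable_bound[OF assms(2)])
       (use assms in \<open>auto intro!: AE_I2 order_trans[OF assms(3)]\<close>)
  with assms(1) show ?thesis by (simp add: L2_def)
qed

lemma L2_cnj: "f \<in> L2 M \<Longrightarrow> (\<lambda>x. cnj (f x)) \<in> L2 M"
  unfolding L2_def by (auto simp: borel_measurable_complex_iff)

lemma L2_mult_integrable:
  assumes f: "f \<in> L2 M" and g: "g \<in> L2 M"
  shows "integrable M (\<lambda>x. f x * g x)"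
proof (rule Bochner_Integration.integrable_bound)
  show "integrable M (\<lambda>x. (cmod (f x))\<^sup>2 + (cmod (g x))\<^sup>2)"
    using f g by (simp add: L2_def)
  show "(\<lambda>x. f x * g x) \<in> borel_measurable M"
    using f g by measurable
  show "AE x in M. norm (f x * g x) \<le> norm ((cmod (f x))\<^sup>2 + (cmod (g x))\<^sup>2)"
  proof (rule AE_I2)
    fix x
    have "2 * (cmod (f x) * cmod (g x)) \<le> (cmod (f x))\<^sup>2 + (cmod (g x))\<^sup>2"
      using sum_squares_bound[of "cmod (f x)" "cmod (g x)"] by simp
    moreover have "0 \<le> cmod (f x) * cmod (g x)" by simp
    ultimately have "cmod (f x) * cmod (g x) \<le> (cmod (f x))\<^sup>2 + (cmod (g x))\<^sup>2"
      by linarith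
    then show "norm (f x * g x) \<le> norm ((cmod (f x))\<^sup>2 + (cmod (g x))\<^sup>2)"
      by (simp add: norm_mult)
  qed
qed

lemma ip_integrable: "f \<in> L2 M \<Longrightarrow> g \<in> L2 M \<Longrightarrow> integrable M (\<lambda>x. f x * cnj (g x))"
  using L2_mult_integrable[OF _ L2_cnj] .

lemma L2_diff:
  assumes f: "f \<in> L2 M" and g: "g \<in> L2 M"
  shows "(\<lambda>x. f x - g x) \<in> L2 M"
proof (rule L2_I_bound)
  show "integrable M (\<lambda>x. 2 * (cmod (f x))\<^sup>2 + 2 * (cmod (g x))\<^sup>2)"
    using f g by (simp add: L2_def)
  show "(\<lambda>x. f x - g x) \<in> borel_measurable M"
    using f g by measurable
  fix x
  have "(cmod (f x - g x))\<^sup>2 \<le> (cmod (f x) + cmod (g x))\<^sup>2"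
    by (intro power_mono norm_triangle_ineq4) auto
  also have "\<dots> \<le> 2 * (cmod (f x))\<^sup>2 + 2 * (cmod (g x))\<^sup>2"
    using sum_squares_bound[of "cmod (f x)" "cmod (g x)"] by (simp add: power2_sum)
  finally show "(cmod (f x - g x))\<^sup>2 \<le> 2 * (cmod (f x))\<^sup>2 + 2 * (cmod (g x))\<^sup>2" .
qed

lemma L2_imp_integrable:
  assumes "finite_measure M" "f \<in> L2 M"
  shows "integrable M f"
proof -
  interpret finite_measure M by fact
  have "(\<lambda>_. 1) \<in> L2 M" by (simp add: L2_def)
  from L2_mult_integrable[OF assms(2) this] show ?thesis by simp
qed

lemma sqnorm_nonneg [simp]: "0 \<le> sqnorm M f"
  by (simp add: sqnorm_def)

lemma ip_self: "ip M f f = of_real (sqnorm M f)"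
  unfolding ip_def sqnorm_def integral_complex_of_real[symmetric]
  by (simp only: complex_norm_square)

lemma cnj_ip: "cnj (ip M f g) = ip M g f"
  unfolding ip_def by (subst Bochner_Integration.integral_cnj[symmetric]) (simp add: mult.commute)

lemma ip_diff_left:
  assumes "f \<in> L2 M" "g \<in> L2 M" "h \<in> L2 M"
  shows "ip M (\<lambda>x. f x - g x) h = ip M f h - ip M g h"
  unfolding ip_def
  by (subst Bochner_Integration.integral_diff[symmetric])
     (auto intro!: ip_integrable assms Bochner_Integration.integral_cong simp: algebra_simps)

lemma sqnorm_diff:
  assumes f: "f \<in> L2 M" and g: "g \<in> L2 M"
  shows "sqnorm M (\<lambda>x. f x - g x) = sqnorm M f - 2 * Re (ip M f g) + sqnorm M g"
proof -
  have "sqnorm M (\<lambda>x. f x - g x) = (LINT x|M. (cmod (f x))\<^sup>2 - 2 * Re (f x * cnj (g x)) + (cmod (g x))\<^sup>2)"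
    unfolding sqnorm_def
    by (intro Bochner_Integration.integral_cong refl)
       (simp add: cmod_power2, simp add: power2_eq_square algebra_simps)
  also have "\<dots> = sqnorm M f - 2 * Re (ip M f g) + sqnorm M g"
    unfolding sqnorm_def ip_def integral_Re[OF ip_integrable[OF f g], symmetric]
    using L2_integrable[OF f] L2_integrable[OF g] integrable_Re[OF ip_integrable[OF f g]]
    by (simp del: times_complex.sel)
  finally show ?thesis .
qed

lemma cauchy_schwarz_integral:
  assumes f: "f \<in> L2 M" and g: "g \<in> L2 M"
  shows "cmod (ip M f g) \<le> sqrt (sqnorm M f) * sqrt (sqnorm M g)"
proof -
  have fg: "integrable M (\<lambda>x. cmod (f x) * cmod (g x))"
    using integrable_norm[OF ip_integrable[OF f g]] by (simp add: norm_mult)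
  have e1: "(\<integral>\<^sup>+x. ennreal (cmod (f x)) * ennreal (cmod (g x)) \<partial>M) =
      ennreal (LINT x|M. cmod (f x) * cmod (g x))"
    by (subst nn_integral_eq_integral[OF fg, symmetric]) (auto simp: ennreal_mult)
  have e2: "(\<integral>\<^sup>+x. (ennreal (cmod (h x)))\<^sup>2 \<partial>M) = ennreal (sqnorm M h)" if "h \<in> L2 M" for h
    unfolding sqnorm_def using L2_integrable[OF that]
    by (subst nn_integral_eq_integral[symmetric]) (auto simp: ennreal_power)
  have "(ennreal (LINT x|M. cmod (f x) * cmod (g x)))\<^sup>2 \<le> ennreal (sqnorm M f) * ennreal (sqnorm M g)"
    unfolding e1[symmetric] e2[OF f, symmetric] e2[OF g, symmetric]
    by (rule Cauchy_Schwarz_nn_integral) (use f g in measurable)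
  then have le: "(LINT x|M. cmod (f x) * cmod (g x))\<^sup>2 \<le> sqnorm M f * sqnorm M g"
    by (simp add: ennreal_power ennreal_mult[symmetric])
  have "cmod (ip M f g) \<le> (LINT x|M. cmod (f x * cnj (g x)))"
    unfolding ip_def by (rule integral_norm_bound)
  also have "\<dots> = (LINT x|M. cmod (f x) * cmod (g x))" by (simp add: norm_mult)
  also have "\<dots> \<le> sqrt (sqnorm M f * sqnorm M g)"
    using le by (rule real_le_rsqrt)
  finally show ?thesis by (simp add: real_sqrt_mult)
qed

lemma ip_tendsto:
  assumes "\<And>n. u n \<in> L2 M" "f \<in> L2 M" "g \<in> L2 M"
    and "(\<lambda>n. sqnorm M (\<lambda>x. f x - u n x)) \<longlonglongrightarrow> 0"
  shows "(\<lambda>n. ip M (u n) g) \<longlonglongrightarrow> ip M f g"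
proof (rule Lim_transform2[OF tendsto_const], rule Lim_null_comparison)
  show "\<forall>\<^sub>F n in sequentially. norm (ip M f g - ip M (u n) g)
      \<le> sqrt (sqnorm M (\<lambda>x. f x - u n x)) * sqrt (sqnorm M g)"
    using cauchy_schwarz_integral[OF L2_diff[OF assms(2) assms(1)] assms(3)] assms
    by (simp add: ip_diff_left)
  show "(\<lambda>n. sqrt (sqnorm M (\<lambda>x. f x - u n x)) * sqrt (sqnorm M g)) \<longlonglongrightarrow> 0"
    using tendsto_real_sqrt[OF assms(4)] by (auto intro: tendsto_mult_left_zero)
qed

text \<open>The Riesz--Fischer argument: along a subsequence with geometrically small steps the increments are
  summable in \<open>L\<^sup>1\<close>, because the measure is finite, hence the subsequence converges almost everywhere;
  Fatou's lemma turns the pointwise limit into a limit in mean.  A rate \<open>\<epsilon>\<close> for the Cauchy property is part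
  of the hypothesis because the sequences of truncated inversion integrals come with one.\<close>

lemma L2_complete:
  assumes "finite_measure M" and u: "\<And>n. u n \<in> L2 M"
    and cauchy: "\<And>m n. m \<le> n \<Longrightarrow> sqnorm M (\<lambda>x. u m x - u n x) \<le> \<epsilon> m"
    and eps: "\<epsilon> \<longlonglongrightarrow> 0"
  obtains f where "f \<in> L2 M" "(\<lambda>n. sqnorm M (\<lambda>x. f x - u n x)) \<longlonglongrightarrow> 0"
proof -
  interpret finite_measure M by fact
  note [measurable] = L2_measurable[OF u]
  have one: "(\<lambda>_. 1) \<in> L2 M" by (simp add: L2_def)
  have eps0: "0 \<le> \<epsilon> m" for m
    using cauchy[of m m] by (simp add: sqnorm_def)
  have "\<exists>m. \<forall>n\<ge>m. \<epsilon> n < (1/4)^k" for k :: nat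
    using order_tendstoD(2)[OF eps, of "(1/4)^k"] by (simp add: eventually_sequentially)
  then obtain N where N: "\<And>k n. N k \<le> n \<Longrightarrow> \<epsilon> n < (1/4)^k" by metis
  define r where "r k = k + (\<Sum>i\<le>k. N i)" for k
  have rN: "N k \<le> r k" for k
    unfolding r_def by (rule trans_le_add2) (rule member_le_sum, auto)
  have r_mono: "r k \<le> r (Suc k)" for k
    by (simp add: r_def)
  have r_ge: "k \<le> r k" for k
    by (simp add: r_def)
  define d where "d k x = u (r (Suc k)) x - u (r k) x" for k x
  have dL2: "d k \<in> L2 M" for k
    unfolding d_def by (intro L2_diff u)
  note [measurable] = L2_measurable[OF dL2]
  have sqnorm_d: "sqnorm M (d k) \<le> (1/4)^k" for k
  proof -
    have "sqnorm M (d k) = sqnorm M (\<lambda>x. u (r k) x - u (r (Suc k)) x)"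
      by (simp add: sqnorm_def d_def norm_minus_commute)
    also have "\<dots> \<le> (1/4)^k"
      using cauchy[OF r_mono] N[OF rN] by (meson less_imp_le order_trans)
    finally show ?thesis .
  qed
  define C where "C = sqrt (measure M (space M))"
  have d_L1: "(LINT x|M. cmod (d k x)) \<le> (1/2)^k * C" for k
  proof -
    have nd: "(\<lambda>x. complex_of_real (cmod (d k x))) \<in> L2 M"
      using dL2 unfolding L2_def by auto
    have "(LINT x|M. cmod (d k x)) = Re (ip M (\<lambda>x. of_real (cmod (d k x))) (\<lambda>_. 1))"
      by (simp add: ip_def)
    also have "\<dots> \<le> sqrt (sqnorm M (\<lambda>x. of_real (cmod (d k x)))) * sqrt (sqnorm M (\<lambda>_. 1))"
      using cauchy_schwarz_integral[OF nd one] complex_Re_le_cmod order_trans by blast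
    also have "\<dots> = sqrt (sqnorm M (d k)) * C"
      by (simp add: sqnorm_def C_def)
    also have "\<dots> \<le> sqrt ((1/4)^k) * C"
      by (intro mult_right_mono real_sqrt_le_mono sqnorm_d) (simp add: C_def)
    also have "sqrt ((1/4)^k) = (1/2::real)^k"
      by (simp add: real_sqrt_power real_sqrt_divide)
    finally show ?thesis .
  qed
  have "(\<integral>\<^sup>+x. (\<Sum>k. ennreal (cmod (d k x))) \<partial>M) = (\<Sum>k. \<integral>\<^sup>+x. ennreal (cmod (d k x)) \<partial>M)"
    by (intro nn_integral_suminf) measurable
  also have "\<dots> \<le> (\<Sum>k. ennreal ((1/2)^k * C))"
  proof (intro suminf_le allI)
    fix k
    have "(\<integral>\<^sup>+x. ennreal (cmod (d k x)) \<partial>M) = ennreal (LINT x|M. cmod (d k x))"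
      by (rule nn_integral_eq_integral)
         (auto intro: integrable_norm L2_imp_integrable dL2 finite_measure_axioms)
    also have "\<dots> \<le> ennreal ((1/2)^k * C)"
      by (intro ennreal_leI d_L1)
    finally show "(\<integral>\<^sup>+x. ennreal (cmod (d k x)) \<partial>M) \<le> ennreal ((1/2)^k * C)" .
  qed auto
  also have "\<dots> = ennreal (\<Sum>k. (1/2)^k * C)"
    by (intro suminf_ennreal2 summable_mult2) (auto simp: C_def)
  also have "\<dots> < \<infinity>" by simp
  finally have "AE x in M. (\<Sum>k. ennreal (cmod (d k x))) \<noteq> \<infinity>"
    by (intro nn_integral_PInf_AE) auto
  then have conv: "AE x in M. convergent (\<lambda>k. u (r k) x)"
  proof eventually_elim
    case (elim x)
    then have "summable (\<lambda>k. d k x)"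
      by (intro summable_norm_cancel[of "\<lambda>k. d k x"] summable_suminf_not_top) auto
    then have "convergent (\<lambda>n. \<Sum>k<n. d k x)"
      by (simp add: summable_iff_convergent)
    moreover have "(\<Sum>k<n. d k x) = u (r n) x - u (r 0) x" for n
      unfolding d_def by (rule sum_lessThan_telescope)
    ultimately have "convergent (\<lambda>n. (u (r n) x - u (r 0) x) + u (r 0) x)"
      by (intro convergent_add convergent_const) simp
    then show ?case by simp
  qed
  define f where "f x = lim (\<lambda>k. u (r k) x)" for x
  have fm [measurable]: "f \<in> borel_measurable M"
    unfolding f_def by measurable
  have close: "(\<integral>\<^sup>+x. ennreal ((cmod (f x - u m x))\<^sup>2) \<partial>M) \<le> ennreal (\<epsilon> m)" for m
  proof -
    have "(\<integral>\<^sup>+x. ennreal ((cmod (f x - u m x))\<^sup>2) \<partial>M) =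
        (\<integral>\<^sup>+x. liminf (\<lambda>k. ennreal ((cmod (u (r k) x - u m x))\<^sup>2)) \<partial>M)"
    proof (intro nn_integral_cong_AE, use conv in eventually_elim)
      case (elim x)
      then have "(\<lambda>k. u (r k) x) \<longlonglongrightarrow> f x"
        by (simp add: f_def convergent_LIMSEQ_iff)
      then have "(\<lambda>k. ennreal ((cmod (u (r k) x - u m x))\<^sup>2)) \<longlonglongrightarrow> ennreal ((cmod (f x - u m x))\<^sup>2)"
        by (intro tendsto_ennrealI tendsto_intros)
      then show ?case
        by (intro lim_imp_Liminf[symmetric]) auto
    qed
    also have "\<dots> \<le> liminf (\<lambda>k. \<integral>\<^sup>+x. ennreal ((cmod (u (r k) x - u m x))\<^sup>2) \<partial>M)"
      by (intro nn_integral_liminf) measurable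
    also have "\<dots> \<le> ennreal (\<epsilon> m)"
    proof (rule order_trans[OF Liminf_le_Limsup], simp, rule Limsup_bounded)
      show "\<forall>\<^sub>F k in sequentially.
          (\<integral>\<^sup>+x. ennreal ((cmod (u (r k) x - u m x))\<^sup>2) \<partial>M) \<le> ennreal (\<epsilon> m)"
        using eventually_ge_at_top[of m]
      proof eventually_elim
        case (elim k)
        have "(\<integral>\<^sup>+x. ennreal ((cmod (u (r k) x - u m x))\<^sup>2) \<partial>M) = ennreal (sqnorm M (\<lambda>x. u m x - u (r k) x))"
          unfolding sqnorm_def norm_minus_commute[of "u m _"]
          by (intro nn_integral_eq_integral L2_integrable L2_diff u) auto
        also have "\<dots> \<le> ennreal (\<epsilon> m)"
          using elim r_ge[of k] by (intro ennreal_leI cauchy) linarith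
        finally show ?case .
      qed
    qed
    finally show ?thesis .
  qed
  have fu: "(\<lambda>x. f x - u m x) \<in> L2 M" for m
  proof -
    have "integrable M (\<lambda>x. (cmod (f x - u m x))\<^sup>2)"
      by (rule integrableI_bounded) (use close[of m] in \<open>auto intro: le_less_trans\<close>)
    then show ?thesis by (simp add: L2_def)
  qed
  have "sqnorm M (\<lambda>x. f x - u m x) \<le> \<epsilon> m" for m
    using close[of m] eps0[of m] nn_integral_eq_integral[OF L2_integrable[OF fu[of m]]]
    by (simp add: sqnorm_def)
  then have "(\<lambda>n. sqnorm M (\<lambda>x. f x - u n x)) \<longlonglongrightarrow> 0"
    by (intro tendsto_sandwich[OF _ _ tendsto_const eps]) auto
  moreover have "f \<in> L2 M"
    using L2_diff[OF fu[of 0], of "\<lambda>x. - u 0 x"] u[of 0] by (auto simp: L2_def)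
  ultimately show ?thesis by (rule that[rotated])
qed

section \<open>Gaussian measures\<close>

text \<open>Both weights of the theorem are instances: \<open>gauss \<sigma>\<close> on the line carries the factor
  \<open>(\<sigma> / \<pi>)\<^bsup>1/2\<^esup>\<close>, and \<open>gauss \<nu>\<close> on the four-dimensional bicomplex space the factor \<open>(\<nu> / \<pi>)\<^sup>2\<close>.\<close>

definition gauss :: "real \<Rightarrow> 'a::euclidean_space measure" where
  "gauss c = density lborel (\<lambda>x. ennreal (sqrt (c / pi) ^ DIM('a) * exp (- c * (norm x)\<^sup>2)))"

lemma sets_gauss [simp, measurable_cong]: "sets (gauss c) = sets borel"
  by (simp add: gauss_def)

lemma space_gauss [simp]: "space (gauss c) = UNIV"
  by (simp add: gauss_def)

lemma nn_integral_gauss_density: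
  assumes c: "c > 0"
  shows "(\<integral>\<^sup>+x. ennreal (sqrt (c / pi) ^ DIM('a) * exp (- c * (norm x)\<^sup>2)) \<partial>(lborel :: 'a::euclidean_space measure)) = 1"
proof -
  define s where "s = 1 / sqrt (2 * c)"
  have s: "s > 0" "s\<^sup>2 = 1 / (2 * c)" using c by (auto simp: s_def power_divide)
  have nd: "normal_density 0 s t = sqrt (c / pi) * exp (- c * t\<^sup>2)" for t
    using c by (simp add: normal_density_def s(2) real_sqrt_divide field_simps)
  have "sqrt (c / pi) ^ DIM('a) * exp (- c * (norm x)\<^sup>2) = (\<Prod>b\<in>Basis. normal_density 0 s (x \<bullet> b))" for x :: 'a
  proof -
    have "(norm x)\<^sup>2 = (\<Sum>b\<in>Basis. (x \<bullet> b)\<^sup>2)"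
      unfolding power2_norm_eq_inner by (subst euclidean_inner) (simp add: power2_eq_square)
    then show ?thesis
      by (simp add: nd prod.distrib exp_sum[symmetric] sum_distrib_left)
  qed
  then have "(\<integral>\<^sup>+x. ennreal (sqrt (c / pi) ^ DIM('a) * exp (- c * (norm x)\<^sup>2)) \<partial>(lborel :: 'a measure))
      = (\<integral>\<^sup>+x. (\<Prod>b\<in>Basis. ennreal (normal_density 0 s (x \<bullet> b))) \<partial>(lborel :: 'a measure))"
    by (simp add: prod_ennreal)
  also have "\<dots> = (\<Prod>b\<in>(Basis::'a set). \<integral>\<^sup>+t. ennreal (normal_density 0 s t) \<partial>lborel)"
    by (rule nn_integral_lborel_prod) auto
  also have "(\<integral>\<^sup>+t. ennreal (normal_density 0 s t) \<partial>lborel) = 1"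
    using s by (subst nn_integral_eq_integral) auto
  finally show ?thesis by simp
qed

lemma prob_space_gauss:
  assumes "c > 0"
  shows "prob_space (gauss c :: 'a::euclidean_space measure)"
  using nn_integral_gauss_density[OF assms, where 'a = 'a]
  by (intro prob_spaceI) (simp add: gauss_def emeasure_density)

lemma integral_gauss:
  fixes f :: "'a::euclidean_space \<Rightarrow> 'b::{banach, second_countable_topology}"
  assumes "c > 0" and [measurable]: "f \<in> borel_measurable borel"
  shows "integral\<^sup>L (gauss c) f =
    sqrt (c / pi) ^ DIM('a) *\<^sub>R (LINT x|lborel. exp (- c * (norm x)\<^sup>2) *\<^sub>R f x)"
  unfolding gauss_def using assms(1)
  by (subst integral_density) (auto simp: scaleR_scaleR[symmetric] simp del: scaleR_scaleR)

lemma integrable_gauss_iff: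
  fixes f :: "'a::euclidean_space \<Rightarrow> 'b::{banach, second_countable_topology}"
  assumes c: "c > 0" and [measurable]: "f \<in> borel_measurable borel"
  shows "integrable (gauss c) f \<longleftrightarrow> integrable lborel (\<lambda>x. exp (- c * (norm x)\<^sup>2) *\<^sub>R f x)"
proof -
  have nz: "sqrt (c / pi) ^ DIM('a) \<noteq> 0" using c by simp
  have "integrable (gauss c) f \<longleftrightarrow>
      integrable lborel (\<lambda>x. (sqrt (c / pi) ^ DIM('a) * exp (- c * (norm x)\<^sup>2)) *\<^sub>R f x)"
    unfolding gauss_def using c by (intro integrable_density) auto
  also have "\<dots> \<longleftrightarrow> integrable lborel (\<lambda>x. sqrt (c / pi) ^ DIM('a) *\<^sub>R (exp (- c * (norm x)\<^sup>2) *\<^sub>R f x))"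
    by simp
  also have "\<dots> \<longleftrightarrow> integrable lborel (\<lambda>x. exp (- c * (norm x)\<^sup>2) *\<^sub>R f x)"
    (is "integrable lborel (\<lambda>x. ?K *\<^sub>R ?g x) \<longleftrightarrow> _")
  proof
    assume "integrable lborel (\<lambda>x. ?K *\<^sub>R ?g x)"
    then have "integrable lborel (\<lambda>x. inverse ?K *\<^sub>R (?K *\<^sub>R ?g x))"
      by (rule integrable_scaleR_right)
    then show "integrable lborel ?g"
      by (simp only: scaleR_scaleR mult.assoc[symmetric] left_inverse[OF nz] mult_1)
  qed (rule integrable_scaleR_right)
  finally show ?thesis .
qed

lemma integrable_gauss_exp_norm:
  assumes c: "c > 0"
  shows "integrable (gauss c) (\<lambda>x::'a::euclidean_space. exp (a * norm x))"
proof (subst integrable_gauss_iff[OF c], simp, rule Bochner_Integration.integrable_bound)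
  have "integrable (gauss (c / 2)) (\<lambda>x::'a. 1::real)"
    using prob_space_gauss[of "c / 2"] c by (auto intro: finite_measure.integrable_const prob_space.finite_measure)
  then show "integrable lborel (\<lambda>x::'a. exp (a\<^sup>2 / (2 * c)) * exp (- (c / 2) * (norm x)\<^sup>2))"
    using c by (subst (asm) integrable_gauss_iff) auto
  show "AE x::'a in lborel. norm (exp (- c * (norm x)\<^sup>2) *\<^sub>R exp (a * norm x))
      \<le> norm (exp (a\<^sup>2 / (2 * c)) * exp (- (c / 2) * (norm x)\<^sup>2))"
  proof (rule AE_I2)
    fix x :: 'a
    have "0 \<le> (a / c - norm x)\<^sup>2 * (c / 2)" using c by simp
    also have "\<dots> = a\<^sup>2 / (2 * c) - a * norm x + c / 2 * (norm x)\<^sup>2"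
      using c by (simp add: field_simps power2_eq_square)
    finally show "norm (exp (- c * (norm x)\<^sup>2) *\<^sub>R exp (a * norm x))
      \<le> norm (exp (a\<^sup>2 / (2 * c)) * exp (- (c / 2) * (norm x)\<^sup>2))"
      by (simp add: exp_add[symmetric])
  qed
qed simp

lemma L2_gaussI:
  assumes c: "c > 0" and f: "f \<in> borel_measurable borel"
    and le: "\<And>x::'a::euclidean_space. cmod (f x) \<le> K * exp (a * norm x)"
  shows "f \<in> L2 (gauss c)"
proof (rule L2_I_bound)
  show "integrable (gauss c) (\<lambda>x::'a. K\<^sup>2 * exp ((2 * a) * norm x))"
    by (intro integrable_mult_right integrable_gauss_exp_norm c)
  show "f \<in> borel_measurable (gauss c)" using f by simp
  fix x :: 'a
  have "(cmod (f x))\<^sup>2 \<le> (K * exp (a * norm x))\<^sup>2"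
    by (intro power_mono le) simp
  also have "\<dots> = K\<^sup>2 * exp ((2 * a) * norm x)"
    by (simp add: power_mult_distrib exp_double[symmetric] mult.assoc)
  finally show "(cmod (f x))\<^sup>2 \<le> K\<^sup>2 * exp ((2 * a) * norm x)" .
qed

text \<open>Completing the square in the real part of \<open>w\<close> leaves the characteristic function of the normal
  distribution.\<close>

lemma gauss_mgf:
  fixes w :: complex
  assumes c: "c > 0"
  shows "(LINT x|gauss c. exp (w * complex_of_real x)) = exp (w\<^sup>2 / (4 * of_real c))"
proof -
  define a b where "a = Re w" and "b = Im w"
  (* the substitution x = a / (2 c) + y / r centres the real Gaussian and gives it variance 1 *)
  define r where "r = sqrt (2 * c)"
  have r: "r > 0" "r\<^sup>2 = 2 * c" using c by (auto simp: r_def)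
  have w: "w = of_real a + \<i> * of_real b" by (simp add: a_def b_def complex_eq)
  let ?E = "exp ((complex_of_real a)\<^sup>2 / (4 * c) + \<i> * a * b / (2 * c))"
  have sq: "- c * (a / (2 * c) + 1 / r * y)\<^sup>2 = - (a\<^sup>2 / (4 * c)) - a / r * y - y\<^sup>2 / 2" for y
  proof -
    have "(a / (2 * c) + 1 / r * y)\<^sup>2 = a\<^sup>2 / (4 * c\<^sup>2) + a * y / (c * r) + y\<^sup>2 / r\<^sup>2"
      using c r(1) by (simp add: field_simps power2_eq_square power4_eq_xxxx)
    then show ?thesis
      unfolding r(2) using c r(1) by (auto simp: field_simps power2_eq_square)
  qed
  have "(LINT x|gauss c. exp (w * complex_of_real x)) =
      sqrt (c / pi) *\<^sub>R (LINT x|lborel. exp (- c * x\<^sup>2) *\<^sub>R exp (w * complex_of_real x))"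
    using c by (subst integral_gauss) auto
  also have "(LINT x|lborel. exp (- c * x\<^sup>2) *\<^sub>R exp (w * complex_of_real x)) =
      (1 / r) *\<^sub>R (LINT y|lborel. exp (- c * (a / (2 * c) + 1 / r * y)\<^sup>2) *\<^sub>R
          exp (w * complex_of_real (a / (2 * c) + 1 / r * y)))"
    using r by (subst lborel_integral_real_affine[where c = "1 / r" and t = "a / (2 * c)"]) auto
  also have "(LINT y|lborel. exp (- c * (a / (2 * c) + 1 / r * y)\<^sup>2) *\<^sub>R
          exp (w * complex_of_real (a / (2 * c) + 1 / r * y))) =
      (LINT y|lborel. sqrt (2 * pi) *\<^sub>R (?E * (std_normal_density y *\<^sub>R iexp (b / r * y))))"
  proof (intro Bochner_Integration.integral_cong refl)
    fix y :: real
    have "exp (- c * (a / (2 * c) + 1 / r * y)\<^sup>2) *\<^sub>R exp (w * complex_of_real (a / (2 * c) + 1 / r * y)) =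
      exp (complex_of_real (- (a\<^sup>2 / (4 * c)) - a / r * y - y\<^sup>2 / 2) + w * complex_of_real (a / (2 * c) + 1 / r * y))"
      unfolding sq scaleR_conv_of_real exp_of_real[symmetric] exp_add ..
    also have "complex_of_real (- (a\<^sup>2 / (4 * c)) - a / r * y - y\<^sup>2 / 2) + w * complex_of_real (a / (2 * c) + 1 / r * y) =
      ((complex_of_real a)\<^sup>2 / (4 * c) + \<i> * a * b / (2 * c)) + complex_of_real (- y\<^sup>2 / 2) + \<i> * of_real (b / r * y)"
      unfolding w using c r(1) by (simp add: field_simps power2_eq_square)
    also have "exp \<dots> = sqrt (2 * pi) *\<^sub>R (?E * (std_normal_density y *\<^sub>R iexp (b / r * y)))"
      unfolding exp_add std_normal_density_def
      by (simp add: scaleR_conv_of_real exp_of_real[symmetric] exp_add field_simps)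
    finally show "exp (- c * (a / (2 * c) + 1 / r * y)\<^sup>2) *\<^sub>R exp (w * complex_of_real (a / (2 * c) + 1 / r * y)) =
       sqrt (2 * pi) *\<^sub>R (?E * (std_normal_density y *\<^sub>R iexp (b / r * y)))" .
  qed
  also have "\<dots> = sqrt (2 * pi) *\<^sub>R (?E * char std_normal_distribution (b / r))"
    unfolding char_def integral_scaleR_right integral_mult_right_zero by (subst integral_density) auto
  also have "char std_normal_distribution (b / r) = exp (- (complex_of_real b)\<^sup>2 / (4 * c))"
    unfolding char_std_normal_distribution using c
    by (simp add: exp_of_real[symmetric] power_divide r(2))
  also have "?E * exp (- (complex_of_real b)\<^sup>2 / (4 * c)) = exp (w\<^sup>2 / (4 * of_real c))"
    unfolding exp_add[symmetric] w using c
    by (intro arg_cong[where f = exp]) (simp add: field_simps power2_eq_square)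
  also have "sqrt (c / pi) *\<^sub>R (1 / r) *\<^sub>R sqrt (2 * pi) *\<^sub>R exp (w\<^sup>2 / (4 * of_real c)) = exp (w\<^sup>2 / (4 * complex_of_real c))"
  proof -
    have "sqrt (c / pi) * (1 / r) * sqrt (2 * pi) = 1"
      using c by (simp add: r_def real_sqrt_divide real_sqrt_mult)
    then show ?thesis using c by simp
  qed
  finally show ?thesis .
qed

lemma fubini_dominated:
  fixes f :: "'a \<Rightarrow> 'b \<Rightarrow> complex" and u :: "'a \<Rightarrow> real" and v :: "'b \<Rightarrow> real"
  assumes "sigma_finite_measure M" "sigma_finite_measure N"
    and [measurable]: "case_prod f \<in> borel_measurable (M \<Otimes>\<^sub>M N)"
    and u: "integrable M u" and v: "integrable N v"
    and le: "\<And>x y. cmod (f x y) \<le> u x * v y"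
  shows "(LINT x|M. LINT y|N. f x y) = (LINT y|N. LINT x|M. f x y)"
proof -
  interpret M: sigma_finite_measure M by fact
  interpret N: sigma_finite_measure N by fact
  interpret pair_sigma_finite M N ..
  have uv: "integrable (M \<Otimes>\<^sub>M N) (\<lambda>(x, y). u x * v y)"
    by (intro Fubini_integrable) (use u v in \<open>auto simp: abs_mult intro!: integrable_mult_left\<close>)
  have "integrable (M \<Otimes>\<^sub>M N) (case_prod f)"
    by (rule Bochner_Integration.integrable_bound[OF uv])
       (use le in \<open>auto intro!: AE_I2 order_trans[OF le abs_ge_self]\<close>)
  then show ?thesis by (rule Fubini_integral[symmetric])
qed

section \<open>Rotation invariance and the mean value property\<close>

text \<open>On each fibre a shear is a translation.  The first shear is the second one conjugated by the exchange
  of the two factors.\<close>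

lemma lborel_distr_shear:
  fixes t :: real
  shows "distr lborel borel (\<lambda>(a, b). (a + t *\<^sub>R b, b)) = (lborel :: ('a::euclidean_space \<times> 'a) measure)" (is ?fst)
    and "distr lborel borel (\<lambda>(a, b). (a, b + t *\<^sub>R a)) = (lborel :: ('a::euclidean_space \<times> 'a) measure)" (is ?snd)
proof -
  let ?U = "\<lambda>(a :: 'a, b). (a + t *\<^sub>R b, b)" and ?L = "\<lambda>(a :: 'a, b). (a, b + t *\<^sub>R a)"
    and ?swap = "\<lambda>(a :: 'a, b :: 'a). (b, a)"
  have tr: "(\<integral>\<^sup>+a. h (a + y) \<partial>lborel) = (\<integral>\<^sup>+a. h a \<partial>lborel)"
    if [measurable]: "h \<in> borel_measurable borel" for h :: "'a \<Rightarrow> ennreal" and y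
    by (subst (2) lborel_distr_plus[of y, symmetric]) (simp add: nn_integral_distr add.commute)
  have [measurable]: "?U \<in> borel_measurable borel" "?L \<in> borel_measurable borel" "?swap \<in> borel_measurable borel"
    by (intro borel_measurable_continuous_onI; auto simp: case_prod_unfold intro!: continuous_intros)+
  show L: ?snd
  proof (rule measure_eqI)
    fix A :: "('a \<times> 'a) set" assume "A \<in> sets (distr lborel borel ?L)"
    then have A [measurable]: "A \<in> sets borel" by simp
    have ind: "indicator A \<in> borel_measurable (lborel \<Otimes>\<^sub>M (lborel :: 'a measure))"
      by (simp add: lborel_prod)
    have indL: "(\<lambda>x. indicator A (?L x) :: ennreal) \<in> borel_measurable (lborel \<Otimes>\<^sub>M (lborel :: 'a measure))"
      unfolding lborel_prod by measurable
    have "emeasure (distr lborel borel ?L) A = (\<integral>\<^sup>+x. indicator A (?L x) \<partial>lborel)"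
      by (simp add: nn_integral_distr flip: nn_integral_indicator)
    also have "\<dots> = (\<integral>\<^sup>+a. \<integral>\<^sup>+b. indicator A (a, b + t *\<^sub>R a) \<partial>lborel \<partial>lborel)"
      unfolding lborel_prod[symmetric] using lborel.nn_integral_fst[OF indL] by simp
    also have "\<dots> = (\<integral>\<^sup>+a. \<integral>\<^sup>+b. indicator A (a, b) \<partial>lborel \<partial>lborel)"
    proof (rule nn_integral_cong)
      fix a :: 'a
      have "(\<lambda>b. (a, b)) \<in> borel_measurable borel"
        by (intro borel_measurable_continuous_onI continuous_intros)
      then show "(\<integral>\<^sup>+b. indicator A (a, b + t *\<^sub>R a) \<partial>lborel) = (\<integral>\<^sup>+b. indicator A (a, b) \<partial>lborel)"
        by (intro tr[of "\<lambda>b. indicator A (a, b)"]) measurable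
    qed
    also have "\<dots> = (\<integral>\<^sup>+x. indicator A x \<partial>lborel)"
      unfolding lborel_prod[symmetric] using lborel.nn_integral_fst[OF ind] by simp
    finally show "emeasure (distr lborel borel ?L) A = emeasure lborel A"
      by simp
  qed simp
  have swap: "distr lborel borel ?swap = lborel"
  proof -
    have "distr lborel borel ?swap = distr lborel lborel ?swap"
      by (rule distr_cong) simp_all
    then show ?thesis
      using lborel_pair.distr_pair_swap[where 'a = 'a and 'b = 'a] by (simp add: lborel_prod)
  qed
  have "?U = ?swap \<circ> (?L \<circ> ?swap)" by auto
  then have "distr lborel borel ?U = distr (distr (distr lborel borel ?swap) borel ?L) borel ?swap"
    by (simp add: distr_distr)
  also have "\<dots> = lborel" by (simp only: swap L)
  finally show ?fst .
qed

text \<open>A real rotation in the pair of coordinates \<open>(z\<^sub>1, z\<^sub>2)\<close> multiplies the two idempotent components by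
  opposite phases.  It is used in place of multiplication by a phase because it is a product of shears.\<close>

definition bc_rotate :: "real \<Rightarrow> bicomplex \<Rightarrow> bicomplex" where
  "bc_rotate \<theta> Z = (cos \<theta> *\<^sub>R fst Z + sin \<theta> *\<^sub>R snd Z, - sin \<theta> *\<^sub>R fst Z + cos \<theta> *\<^sub>R snd Z)"

lemma idem_bc_rotate:
  "idem_plus (bc_rotate \<theta> Z) = cis \<theta> * idem_plus Z"
  "idem_minus (bc_rotate \<theta> Z) = cis (- \<theta>) * idem_minus Z"
  by (simp_all add: bc_rotate_def idem_plus_def idem_minus_def complex_eq_iff algebra_simps)

lemma norm_bc_rotate [simp]: "norm (bc_rotate \<theta> Z) = norm Z"
proof -
  have "(norm (bc_rotate \<theta> Z))\<^sup>2 = (norm Z)\<^sup>2"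
    unfolding norm_bicomplex_idem idem_bc_rotate by (simp add: norm_mult)
  then show ?thesis by simp
qed

lemma bc_rotate_measurable [measurable]: "bc_rotate \<theta> \<in> borel_measurable borel"
  unfolding bc_rotate_def by (intro borel_measurable_continuous_onI continuous_intros)

lemma bc_rotate_add: "bc_rotate a (bc_rotate b Z) = bc_rotate (a + b) Z"
  by (simp add: bc_rotate_def cos_add sin_add algebra_simps)

text \<open>A rotation by \<open>\<theta>\<close> is a product of three shears, the outer ones of slope \<open>tan (\<theta> / 2)\<close>.  Where this
  slope is infinite, the rotation by \<open>\<theta> / 2\<close> is applied twice.\<close>

lemma lborel_distr_bc_rotate: "distr lborel borel (bc_rotate \<theta>) = lborel"
proof -
  have *: "distr lborel borel (bc_rotate \<theta>) = lborel" if "cos (\<theta> / 2) \<noteq> 0" for \<theta>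
  proof -
    define t s where "t = tan (\<theta> / 2)" and "s = - sin \<theta>"
    have th: "\<theta> = 2 * (\<theta> / 2)" by simp
    have c: "1 - t * sin \<theta> = cos \<theta>"
      by (subst (1 2) th, subst sin_double, subst cos_double_sin)
         (use that in \<open>simp add: t_def tan_def power2_eq_square field_simps\<close>)
    have ts: "(cos \<theta> + 1) * t = sin \<theta>"
      by (subst (1 2) th, subst sin_double, subst cos_double_cos)
         (use that in \<open>simp add: t_def tan_def power2_eq_square field_simps\<close>)
    let ?U = "\<lambda>t (a::complex, b::complex). (a + t *\<^sub>R b, b)" and ?L = "\<lambda>t (a::complex, b::complex). (a, b + t *\<^sub>R a)"
    have m [measurable]: "?U t \<in> borel_measurable borel" "?L t \<in> borel_measurable borel" for t
      by (intro borel_measurable_continuous_onI; auto simp: case_prod_unfold intro!: continuous_intros)+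
    have "bc_rotate \<theta> Z = ?U t (?L s (?U t Z))" for Z
    proof (cases Z)
      case (Pair a b)
      have "a + t *\<^sub>R b + t *\<^sub>R (b + s *\<^sub>R (a + t *\<^sub>R b)) =
          (1 - t * sin \<theta>) *\<^sub>R a + ((1 - t * sin \<theta> + 1) * t) *\<^sub>R b"
        by (simp add: s_def complex_eq_iff algebra_simps)
      moreover have "b + s *\<^sub>R (a + t *\<^sub>R b) = - sin \<theta> *\<^sub>R a + (1 - t * sin \<theta>) *\<^sub>R b"
        by (simp add: s_def algebra_simps)
      ultimately show ?thesis
        unfolding c ts by (simp add: Pair bc_rotate_def)
    qed
    then have "bc_rotate \<theta> = ?U t \<circ> (?L s \<circ> ?U t)" by (simp add: fun_eq_iff)
    then have "distr lborel borel (bc_rotate \<theta>) =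
        distr (distr (distr lborel borel (?U t)) borel (?L s)) borel (?U t)"
      by (simp add: distr_distr)
    also have "\<dots> = lborel" by (simp only: lborel_distr_shear)
    finally show ?thesis .
  qed
  show ?thesis
  proof (cases "cos (\<theta> / 2) = 0")
    case True
    have "cos (\<theta> / 2) = 2 * (cos (\<theta> / 2 / 2))\<^sup>2 - 1"
      using cos_double_cos[of "\<theta> / 2 / 2"] by simp
    then have "cos (\<theta> / 2 / 2) \<noteq> 0" using True by auto
    from *[OF this] have h: "distr lborel borel (bc_rotate (\<theta> / 2)) = lborel" .
    have "bc_rotate \<theta> = bc_rotate (\<theta> / 2) \<circ> bc_rotate (\<theta> / 2)"
      by (simp add: fun_eq_iff bc_rotate_add)
    then have "distr lborel borel (bc_rotate \<theta>) =
        distr (distr lborel borel (bc_rotate (\<theta> / 2))) borel (bc_rotate (\<theta> / 2))"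
      by (simp add: distr_distr)
    then show ?thesis by (simp add: h)
  qed (use * in blast)
qed

lemma distr_gauss_bc_rotate: "distr (gauss c) borel (bc_rotate \<theta>) = gauss c"
proof (rule measure_eqI)
  fix A assume "A \<in> sets (distr (gauss c) borel (bc_rotate \<theta>))"
  then have A [measurable]: "A \<in> sets borel" by simp
  let ?w = "\<lambda>Z::bicomplex. ennreal (sqrt (c / pi) ^ DIM(bicomplex) * exp (- c * (norm Z)\<^sup>2))"
  have "emeasure (distr (gauss c) borel (bc_rotate \<theta>)) A = (\<integral>\<^sup>+Z. indicator A (bc_rotate \<theta> Z) \<partial>gauss c)"
    by (simp add: nn_integral_distr flip: nn_integral_indicator)
  also have "\<dots> = (\<integral>\<^sup>+Z. ?w (bc_rotate \<theta> Z) * indicator A (bc_rotate \<theta> Z) \<partial>lborel)"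
    unfolding gauss_def norm_bc_rotate by (intro nn_integral_density) auto
  also have "\<dots> = (\<integral>\<^sup>+Z. ?w Z * indicator A Z \<partial>distr lborel borel (bc_rotate \<theta>))"
    by (subst nn_integral_distr) auto
  also have "\<dots> = emeasure (gauss c) A"
    unfolding lborel_distr_bc_rotate gauss_def by (subst emeasure_density) auto
  finally show "emeasure (distr (gauss c) borel (bc_rotate \<theta>)) A = emeasure (gauss c) A" .
qed simp

lemma circle_mean_value:
  assumes F: "F holomorphic_on UNIV"
  shows "(LINT t|density lborel (indicator {0..1}). F (cis (2 * pi * t) * z)) = F 0"
proof -
  have cont: "continuous_on A F" for A
    using holomorphic_on_imp_continuous_on[OF F] continuous_on_subset by blast
  let ?G = "\<lambda>w. F (w * z)"
  have G: "?G holomorphic_on A" for A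
    by (rule holomorphic_on_compose_gen[unfolded o_def, OF _ F]) (auto intro!: holomorphic_intros)
  have "((\<lambda>u. ?G u / (u - 0)) has_contour_integral (2 * of_real pi * \<i> * ?G 0)) (circlepath 0 1)"
    by (rule Cauchy_integral_circlepath)
       (auto intro!: G holomorphic_on_imp_continuous_on)
  then have "((\<lambda>t. ?G (circlepath 0 1 t) / circlepath 0 1 t * vector_derivative (circlepath 0 1) (at t))
      has_integral (2 * of_real pi * \<i> * F 0)) {0..1}"
    by (simp add: has_contour_integral)
  then have "((\<lambda>t. (2 * of_real pi * \<i>) * F (cis (2 * pi * t) * z)) has_integral (2 * of_real pi * \<i> * F 0)) {0..1}"
    by (rule has_integral_eq[rotated], unfold vector_derivative_circlepath)
       (simp add: circlepath cis_conv_exp mult_ac)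
  then have "((\<lambda>t. inverse (2 * of_real pi * \<i>) * ((2 * of_real pi * \<i>) * F (cis (2 * pi * t) * z)))
      has_integral (inverse (2 * of_real pi * \<i>) * (2 * of_real pi * \<i> * F 0))) {0..1}"
    by (rule has_integral_mult_right)
  then have HK: "((\<lambda>t. F (cis (2 * pi * t) * z)) has_integral F 0) {0..1}"
    by (simp add: field_simps)
  have cc: "continuous_on A (\<lambda>t. F (cis (2 * pi * t) * z))" for A
    by (rule continuous_on_compose2[OF cont[of UNIV]]) (auto simp: cis_conv_exp intro!: continuous_intros)
  have "set_integrable lborel {0..1} (\<lambda>t. F (cis (2 * pi * t) * z))"
    by (rule borel_integrable_atLeastAtMost') (rule cc)
  from set_borel_integral_eq_integral(2)[OF this] HK
  have "(LINT t:{0..1}|lborel. F (cis (2 * pi * t) * z)) = F 0"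
    by (simp add: integral_unique)
  moreover have [measurable]: "(\<lambda>t. F (cis (2 * pi * t) * z)) \<in> borel_measurable borel"
    by (intro borel_measurable_continuous_onI cc)
  have "(LINT t|density lborel (\<lambda>x. ennreal (indicator {0..1} x)). F (cis (2 * pi * t) * z)) =
    (LINT t:{0..1}|lborel. F (cis (2 * pi * t) * z))"
    by (subst integral_density) (auto simp: set_lebesgue_integral_def)
  ultimately show ?thesis by (simp add: ennreal_indicator)
qed

text \<open>The two components are treated at once.  Functions of \<open>p(Z)\<close> are integrated over the whole bicomplex
  space.\<close>

locale idempotent_component =
  fixes p :: "bicomplex \<Rightarrow> complex" and \<nu> :: real
  assumes p: "p = idem_plus \<or> p = idem_minus" and \<nu>: "\<nu> > 0"
begin

lemma p_continuous: "continuous_on A p"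
  using p unfolding idem_plus_def[abs_def] idem_minus_def[abs_def]
  by (auto intro!: continuous_intros)

lemma p_measurable [measurable]: "p \<in> borel_measurable borel"
  by (intro borel_measurable_continuous_onI p_continuous)

lemma p_add: "p (Z + W) = p Z + p W"
  using p by (auto simp: idem_plus_def idem_minus_def algebra_simps)

lemma norm_p_le: "norm (p Z) \<le> 2 * norm Z"
proof -
  have "0 \<le> (cmod (idem_plus Z))\<^sup>2" "0 \<le> (cmod (idem_minus Z))\<^sup>2" by simp_all
  moreover have "2 * (norm Z)\<^sup>2 = (cmod (idem_plus Z))\<^sup>2 + (cmod (idem_minus Z))\<^sup>2"
    using norm_bicomplex_idem[of Z] by simp
  ultimately have "(norm (p Z))\<^sup>2 \<le> 2 * (norm Z)\<^sup>2"
    using p by auto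
  also have "\<dots> \<le> (2 * norm Z)\<^sup>2" by (simp add: power_mult_distrib)
  finally show ?thesis by (rule power2_le_imp_le) simp
qed

text \<open>Here \<open>e\<close> has \<open>w\<close> as its \<open>p\<close>-component and \<open>0\<close> as the other one; translation by \<open>e\<close> moves the
  \<open>p\<close>-component of a point by \<open>w\<close>.\<close>

lemma embed:
  obtains e where "p e = w" and "\<And>Z. (norm (Z - e))\<^sup>2 = (norm Z)\<^sup>2 - Re (p Z * cnj w) + (norm w)\<^sup>2 / 2"
proof -
  have sub: "idem_plus (Z - W) = idem_plus Z - idem_plus W" "idem_minus (Z - W) = idem_minus Z - idem_minus W" for Z W
    by (simp_all add: idem_plus_def idem_minus_def algebra_simps)
  have sq: "(norm (z - w))\<^sup>2 = (norm z)\<^sup>2 - 2 * Re (z * cnj w) + (norm w)\<^sup>2" for z :: complex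
    by (simp add: cmod_power2, simp add: power2_eq_square algebra_simps)
  show ?thesis
  proof (cases "p = idem_plus")
    case True
    show ?thesis
      by (rule that[of "of_idem w 0"]) (simp_all add: True norm_bicomplex_idem sub sq field_simps)
  next
    case False
    then have "p = idem_minus" using p by auto
    then show ?thesis
      by (intro that[of "of_idem 0 w"]) (simp_all add: norm_bicomplex_idem sub sq field_simps)
  qed
qed

sublocale gauss: prob_space "gauss \<nu> :: bicomplex measure"
  using \<nu> by (rule prob_space_gauss)

lemma entire_measurable:
  assumes "F holomorphic_on UNIV" shows "F \<in> borel_measurable borel"
  by (intro borel_measurable_continuous_onI holomorphic_on_imp_continuous_on assms)

text \<open>By rotation invariance, \<open>F(p(Z))\<close> may be replaced by \<open>F(cis \<theta> * p(Z))\<close> for every angle.  Averaging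
  over the angle and exchanging the integrals leaves the mean of \<open>F\<close> over the circle through \<open>p(Z)\<close>, which
  is \<open>F(0)\<close>.\<close>

lemma gauss_mean_value:
  assumes F: "F holomorphic_on UNIV" and int: "integrable (gauss \<nu>) (\<lambda>Z. F (p Z))"
  shows "(LINT Z|gauss \<nu>. F (p Z)) = F 0"
proof -
  note [measurable] = entire_measurable[OF F]
  define U :: "real measure" where "U = density lborel (indicator {0..1})"
  have setsU [measurable_cong]: "sets U = sets borel" by (simp add: U_def)
  interpret U: prob_space U
    by (rule prob_spaceI) (simp add: U_def emeasure_density)
  interpret pair_sigma_finite U "gauss \<nu> :: bicomplex measure" ..
  obtain R where R: "R = bc_rotate \<or> R = (\<lambda>\<theta>. bc_rotate (- \<theta>))" "\<And>\<theta> Z. p (R \<theta> Z) = cis \<theta> * p Z"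
    using p idem_bc_rotate(1) idem_bc_rotate(2)[of "- \<theta>" for \<theta>] by force
  have Rm [measurable]: "R \<theta> \<in> borel_measurable borel" for \<theta>
    using R(1) by auto
  have inv: "distr (gauss \<nu>) borel (R \<theta>) = gauss \<nu>" for \<theta>
    using R(1) by (auto simp: distr_gauss_bc_rotate)
  have rot: "(LINT Z|gauss \<nu>. h (cis \<theta> * p Z)) = (LINT Z|gauss \<nu>. h (p Z))"
    if [measurable]: "h \<in> borel_measurable borel"
    for h :: "complex \<Rightarrow> 'b::{banach, second_countable_topology}" and \<theta>
    by (subst (2) inv[of \<theta>, symmetric], subst integral_distr) (auto simp: R(2))
  have roti: "integrable (gauss \<nu>) (\<lambda>Z. F (cis \<theta> * p Z))" for \<theta>
    using int by (subst (asm) inv[of \<theta>, symmetric], subst (asm) integrable_distr_eq) (auto simp: R(2))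
  have "integrable (U \<Otimes>\<^sub>M gauss \<nu>) (\<lambda>(t, Z). F (cis (2 * pi * t) * p Z))"
  proof (rule Fubini_integrable)
    have "continuous_on UNIV (\<lambda>x. cis (2 * pi * fst x) * p (snd x))"
      unfolding cis_conv_exp
      by (intro continuous_intros continuous_on_compose2[OF p_continuous[of UNIV]]) auto
    then have "(\<lambda>x. cis (2 * pi * fst x) * p (snd x)) \<in> borel_measurable (borel \<Otimes>\<^sub>M borel)"
      by (simp add: borel_prod borel_measurable_continuous_onI)
    then show "(\<lambda>(t, Z). F (cis (2 * pi * t) * p Z)) \<in> borel_measurable (U \<Otimes>\<^sub>M gauss \<nu>)"
      unfolding case_prod_unfold by measurable
    show "integrable U (\<lambda>t. LINT Z|gauss \<nu>. norm (case (t, Z) of (t, Z) \<Rightarrow> F (cis (2 * pi * t) * p Z)))"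
      by (simp add: rot[of "\<lambda>z. norm (F z)"])
    show "AE t in U. integrable (gauss \<nu>) (\<lambda>Z. case (t, Z) of (t, Z) \<Rightarrow> F (cis (2 * pi * t) * p Z))"
      by (simp add: roti)
  qed
  from Fubini_integral[OF this]
  have "(LINT t|U. LINT Z|gauss \<nu>. F (cis (2 * pi * t) * p Z)) = (LINT Z|gauss \<nu>. LINT t|U. F (cis (2 * pi * t) * p Z))"
    by simp
  then show ?thesis
    unfolding rot[OF entire_measurable[OF F]] unfolding U_def circle_mean_value[OF F]
    using U.prob_space gauss.prob_space by (simp add: U_def[symmetric])
qed

lemma exp_p_L2: "(\<lambda>Z. exp (a * cnj (p Z))) \<in> L2 (gauss \<nu>)"
proof (rule L2_gaussI[OF \<nu>])
  show "(\<lambda>Z. exp (a * cnj (p Z))) \<in> borel_measurable borel"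
    by (intro borel_measurable_continuous_onI continuous_intros p_continuous)
  fix Z :: bicomplex
  have "Re (a * cnj (p Z)) \<le> cmod (a * cnj (p Z))" by (rule complex_Re_le_cmod)
  also have "\<dots> \<le> cmod a * (2 * norm Z)"
    by (simp add: norm_mult mult_left_mono norm_p_le)
  finally show "cmod (exp (a * cnj (p Z))) \<le> 1 * exp ((2 * cmod a) * norm Z)"
    by (simp add: mult_ac)
qed

text \<open>The mean value property is applied to \<open>G(z) = F(z + w) exp (- \<nu> z cnj w / 2)\<close>.  After the translation
  by \<open>w\<close> the Gaussian weight and the exponential in \<open>G\<close> combine to the kernel \<open>exp (\<nu> w cnj z / 2)\<close>.\<close>

lemma reproducing:
  assumes F: "F holomorphic_on UNIV" and L2: "(\<lambda>Z. F (p Z)) \<in> L2 (gauss \<nu>)"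
  shows "(LINT Z|gauss \<nu>. F (p Z) * exp (of_real (\<nu> / 2) * w * cnj (p Z))) = F w"
proof -
  note [measurable] = entire_measurable[OF F]
  obtain e where e: "p e = w"
    "\<And>Z. (norm (Z - e))\<^sup>2 = (norm Z)\<^sup>2 - Re (p Z * cnj w) + (norm w)\<^sup>2 / 2"
    using embed by metis
  define G where "G z = F (z + w) * exp (- of_real (\<nu> / 2) * z * cnj w)" for z
  have G: "G holomorphic_on UNIV"
    unfolding G_def
    by (intro holomorphic_intros holomorphic_on_compose_gen[unfolded o_def, OF _ F]) auto
  note [measurable] = entire_measurable[OF G]
  have int: "integrable (gauss \<nu>) (\<lambda>Z. F (p Z) * exp (of_real (\<nu> / 2) * w * cnj (p Z)))"
    by (intro L2_mult_integrable L2 exp_p_L2)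
  have key: "exp (- \<nu> * (norm (Z - e))\<^sup>2) *\<^sub>R G (p (Z - e)) =
      exp (- \<nu> * (norm Z)\<^sup>2) *\<^sub>R (F (p Z) * exp (of_real (\<nu> / 2) * w * cnj (p Z)))" for Z
  proof -
    have pZ: "p (Z - e) = p Z - w"
      using p_add[of "Z - e" e] by (simp add: e(1))
    have "of_real (- \<nu> * (norm (Z - e))\<^sup>2) + - of_real (\<nu> / 2) * (p Z - w) * cnj w =
        of_real (- \<nu> * (norm Z)\<^sup>2) + of_real (\<nu> / 2) * w * cnj (p Z)"
      unfolding e(2) by (simp add: cmod_power2 complex_eq_iff, simp add: field_simps power2_eq_square)
    then have "exp (of_real (- \<nu> * (norm (Z - e))\<^sup>2)) * exp (- of_real (\<nu> / 2) * (p Z - w) * cnj w) =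
        exp (of_real (- \<nu> * (norm Z)\<^sup>2)) * exp (of_real (\<nu> / 2) * w * cnj (p Z))"
      unfolding exp_add[symmetric] by (rule arg_cong)
    then show ?thesis
      unfolding G_def pZ scaleR_conv_of_real exp_of_real[symmetric] by simp
  qed
  have tr: "integral\<^sup>L lborel h = (LINT Z|lborel. h (Z - e))" "integrable lborel h \<longleftrightarrow> integrable lborel (\<lambda>Z. h (Z - e))"
    if [measurable]: "h \<in> borel_measurable borel" for h :: "bicomplex \<Rightarrow> complex"
    by (subst lborel_distr_plus[of "- e", symmetric], subst integral_distr; simp)
       (subst (1) lborel_distr_plus[of "- e", symmetric], subst integrable_distr_eq; simp)
  have [measurable]: "(\<lambda>Z. cnj (p Z)) \<in> borel_measurable borel"
    by (intro borel_measurable_continuous_onI continuous_intros p_continuous)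
  have m1: "(\<lambda>Z. F (p Z) * exp (of_real (\<nu> / 2) * w * cnj (p Z))) \<in> borel_measurable borel"
    by measurable
  have m2: "(\<lambda>Z. G (p Z)) \<in> borel_measurable borel"
    and m3: "(\<lambda>Z. exp (- \<nu> * (norm Z)\<^sup>2) *\<^sub>R G (p Z)) \<in> borel_measurable borel"
    by measurable
  have "integrable (gauss \<nu>) (\<lambda>Z. G (p Z))"
    using int unfolding integrable_gauss_iff[OF \<nu> m1] integrable_gauss_iff[OF \<nu> m2] tr(2)[OF m3] key .
  then have "(LINT Z|gauss \<nu>. G (p Z)) = G 0"
    by (rule gauss_mean_value[OF G])
  moreover have "(LINT Z|gauss \<nu>. G (p Z)) = (LINT Z|gauss \<nu>. F (p Z) * exp (of_real (\<nu> / 2) * w * cnj (p Z)))"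
    unfolding integral_gauss[OF \<nu> m1] integral_gauss[OF \<nu> m2] tr(1)[OF m3] key ..
  ultimately show ?thesis
    by (simp add: G_def)
qed

end

section \<open>The complex Bargmann transform\<close>

text \<open>The kernel \<open>exp (- \<sigma> (x - sqrt (\<nu> / (4 \<sigma>)) z)\<^sup>2)\<close> of the transform without its factor
  \<open>exp (- \<sigma> x\<^sup>2)\<close>, which belongs to the Gaussian measure.\<close>

definition sb_kernel :: "real \<Rightarrow> real \<Rightarrow> complex \<Rightarrow> real \<Rightarrow> complex" where
  "sb_kernel \<sigma> \<nu> z x = exp (of_real (sqrt (\<sigma> * \<nu>) * x) * z - of_real (\<nu> / 4) * z\<^sup>2)"

definition bargmann :: "real \<Rightarrow> real \<Rightarrow> (real \<Rightarrow> complex) \<Rightarrow> complex \<Rightarrow> complex" where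
  "bargmann \<sigma> \<nu> \<phi> z = (LINT x|gauss \<sigma>. sb_kernel \<sigma> \<nu> z x * \<phi> x)"

locale bargmann_component = idempotent_component p \<nu> for p \<nu> +
  fixes \<sigma> :: real
  assumes \<sigma>: "\<sigma> > 0"
begin

abbreviation "k \<equiv> sb_kernel \<sigma> \<nu>"
abbreviation "B \<equiv> bargmann \<sigma> \<nu>"
abbreviation \<mu> :: "real measure" where "\<mu> \<equiv> gauss \<sigma>"
abbreviation \<gamma> :: "bicomplex measure" where "\<gamma> \<equiv> gauss \<nu>"

sublocale mu: prob_space \<mu>
  using \<sigma> by (rule prob_space_gauss)

lemma kernel_bound:
  "cmod (k z x) \<le> exp (\<nu> / 4 * (cmod z)\<^sup>2) * exp ((sqrt (\<sigma> * \<nu>) * cmod z) * norm x)"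
proof -
  have "Re (of_real (sqrt (\<sigma> * \<nu>) * x) * z - of_real (\<nu> / 4) * z\<^sup>2)
      \<le> cmod (of_real (sqrt (\<sigma> * \<nu>) * x) * z - of_real (\<nu> / 4) * z\<^sup>2)"
    by (rule complex_Re_le_cmod)
  also have "\<dots> \<le> cmod (of_real (sqrt (\<sigma> * \<nu>) * x) * z) + cmod (of_real (\<nu> / 4) * z\<^sup>2)"
    by (rule norm_triangle_ineq4)
  also have "\<dots> = \<nu> / 4 * (cmod z)\<^sup>2 + (sqrt (\<sigma> * \<nu>) * cmod z) * norm x"
    using \<sigma> \<nu> by (simp add: norm_mult norm_power abs_mult)
  finally show ?thesis
    unfolding sb_kernel_def exp_add[symmetric] norm_exp_eq_Re exp_le_cancel_iff .
qed

lemma kernel_measurable [measurable]: "k z \<in> borel_measurable borel"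
  unfolding sb_kernel_def[abs_def] by (intro borel_measurable_continuous_onI continuous_intros)

lemma kernel_p_measurable [measurable]:
  "(\<lambda>(x, Z). cnj (k (p Z) x)) \<in> borel_measurable (borel \<Otimes>\<^sub>M borel)"
  unfolding borel_prod sb_kernel_def[abs_def] case_prod_unfold
  by (intro borel_measurable_continuous_onI continuous_intros continuous_on_compose2[OF p_continuous[of UNIV]]) auto

lemma kernel_L2: "k z \<in> L2 \<mu>"
  by (rule L2_gaussI[OF \<sigma> kernel_measurable kernel_bound])

lemma kernel_gram: "ip \<mu> (k z) (k w) = exp (of_real (\<nu> / 2) * z * cnj w)"
proof -
  let ?s = "complex_of_real (sqrt (\<sigma> * \<nu>))"
  have s: "?s\<^sup>2 = of_real (\<sigma> * \<nu>)"
    using \<sigma> \<nu> by (simp flip: of_real_power)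
  let ?C = "exp (- of_real (\<nu> / 4) * (z\<^sup>2 + (cnj w)\<^sup>2))"
  have "ip \<mu> (k z) (k w) = (LINT x|\<mu>. ?C * exp ((?s * (z + cnj w)) * of_real x))"
    unfolding ip_def sb_kernel_def exp_cnj exp_add[symmetric]
    by (intro Bochner_Integration.integral_cong refl arg_cong[where f = exp]) (simp add: algebra_simps)
  also have "\<dots> = ?C * exp ((?s * (z + cnj w))\<^sup>2 / (4 * of_real \<sigma>))"
    by (simp add: gauss_mgf[OF \<sigma>])
  also have "\<dots> = exp (of_real (\<nu> / 2) * z * cnj w)"
    unfolding exp_add[symmetric] power_mult_distrib s using \<sigma>
    by (intro arg_cong[where f = exp]) (simp add: field_simps power2_eq_square)
  finally show ?thesis .
qed

lemma bargmann_eq_ip: "B \<phi> z = ip \<mu> \<phi> (\<lambda>x. cnj (k z x))"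
  by (simp add: bargmann_def ip_def mult.commute)

text \<open>The factor \<open>exp (- \<nu> z\<^sup>2 / 4)\<close> is split off, and the remaining integral of \<open>exp (c x z) \<phi>(x)\<close> is
  differentiated under the integral sign.  The difference quotients are dominated by a function of the form
  \<open>exp (C |x|) |\<phi>(x)|\<close>, which is integrable because both factors are square integrable.\<close>

lemma bargmann_entire:
  assumes \<phi>: "\<phi> \<in> L2 \<mu>"
  shows "B \<phi> holomorphic_on UNIV"
proof -
  define c where "c = sqrt (\<sigma> * \<nu>)"
  have c: "c \<ge> 0" using \<sigma> \<nu> by (simp add: c_def)
  have [measurable]: "\<phi> \<in> borel_measurable borel"
    using L2_measurable[OF \<phi>] by simp
  define H where "H z = (LINT x|\<mu>. exp (of_real (c * x) * z) * \<phi> x)" for z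
  have em [measurable]: "(\<lambda>x. exp (of_real (c * x) * z)) \<in> borel_measurable borel" for z :: complex
    by (intro borel_measurable_continuous_onI continuous_intros)
  have e_bound: "cmod (exp (of_real (c * x) * z)) \<le> exp ((c * cmod z) * norm x)" for x z
  proof -
    have "cmod (exp (of_real (c * x) * z)) \<le> exp (cmod (of_real (c * x) * z))"
      unfolding norm_exp_eq_Re exp_le_cancel_iff by (rule complex_Re_le_cmod)
    then show ?thesis using c by (simp add: norm_mult abs_mult mult_ac)
  qed
  have e_int: "integrable \<mu> (\<lambda>x. exp (of_real (c * x) * z) * \<phi> x)" for z
    by (intro L2_mult_integrable \<phi> L2_gaussI[OF \<sigma> em, of _ 1 "c * cmod z"]) (use e_bound in simp)
  have "(H has_field_derivative (LINT x|\<mu>. of_real (c * x) * exp (of_real (c * x) * z) * \<phi> x)) (at z)" for z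
    unfolding DERIV_def tendsto_at_iff_sequentially comp_def
  proof (intro allI impI)
    fix h :: "nat \<Rightarrow> complex"
    assume nz: "\<forall>i. h i \<in> UNIV - {0}" and lim: "h \<longlonglongrightarrow> 0"
    from convergent_imp_Bseq[OF convergentI[OF lim]] obtain K where K: "K > 0" "\<And>n. norm (h n) \<le> K"
      by (auto simp: Bseq_def)
    have "(\<lambda>n. LINT x|\<mu>. (exp (of_real (c * x) * (z + h n)) * \<phi> x - exp (of_real (c * x) * z) * \<phi> x) / h n)
        \<longlonglongrightarrow> (LINT x|\<mu>. of_real (c * x) * exp (of_real (c * x) * z) * \<phi> x)"
    proof (rule integral_dominated_convergence)
      show "integrable \<mu> (\<lambda>x. cmod (of_real (exp ((c * (cmod z + 1 + K)) * norm x)) * \<phi> x))"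
        by (intro integrable_norm L2_mult_integrable \<phi> L2_gaussI[OF \<sigma>, of _ 1]) auto
      show "AE x in \<mu>. (\<lambda>n. (exp (of_real (c * x) * (z + h n)) * \<phi> x - exp (of_real (c * x) * z) * \<phi> x) / h n)
          \<longlonglongrightarrow> of_real (c * x) * exp (of_real (c * x) * z) * \<phi> x"
      proof (rule AE_I2)
        fix x
        have "((\<lambda>w. exp (of_real (c * x) * w) * \<phi> x) has_field_derivative
            of_real (c * x) * exp (of_real (c * x) * z) * \<phi> x) (at z)"
          by (auto intro!: derivative_eq_intros)
        from this[unfolded DERIV_def tendsto_at_iff_sequentially comp_def] nz lim
        show "(\<lambda>n. (exp (of_real (c * x) * (z + h n)) * \<phi> x - exp (of_real (c * x) * z) * \<phi> x) / h n)
          \<longlonglongrightarrow> of_real (c * x) * exp (of_real (c * x) * z) * \<phi> x"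
          by blast
      qed
      fix n
      show "AE x in \<mu>. norm ((exp (of_real (c * x) * (z + h n)) * \<phi> x - exp (of_real (c * x) * z) * \<phi> x) / h n)
          \<le> cmod (of_real (exp ((c * (cmod z + 1 + K)) * norm x)) * \<phi> x)"
      proof (rule AE_I2)
        fix x
        let ?y = "complex_of_real (c * x)" and ?t = "c * norm x"
        have t: "?t \<ge> 0" using c by simp
        have te: "?t \<le> exp ?t" using exp_ge_add_one_self[of ?t] by linarith
        have hn: "cmod (h n) > 0" using nz by simp
        have y: "cmod ?y = ?t" unfolding norm_of_real using c by (simp add: abs_mult)
        have "cmod (exp (?y * h n) - 1) \<le> exp \<bar>Re (?y * h n)\<bar> * cmod (?y * h n)"
          using Taylor_exp[of "?y * h n" 0] by simp
        also have "\<dots> \<le> exp (?t * K) * (?t * cmod (h n))"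
        proof (intro mult_mono)
          have "\<bar>Re (?y * h n)\<bar> \<le> cmod (?y * h n)" by (rule abs_Re_le_cmod)
          also have "\<dots> \<le> ?t * K"
            unfolding norm_mult y using K(2)[of n] t by (intro mult_left_mono) auto
          finally show "exp \<bar>Re (?y * h n)\<bar> \<le> exp (?t * K)" by simp
          show "cmod (?y * h n) \<le> ?t * cmod (h n)" unfolding norm_mult y ..
        qed auto
        also have "\<dots> \<le> exp (?t * K) * (exp ?t * cmod (h n))"
          by (intro mult_left_mono mult_right_mono te) auto
        finally have 1: "cmod ((exp (?y * h n) - 1) / h n) \<le> exp (?t * K) * exp ?t"
          using hn by (simp add: norm_divide divide_le_eq mult_ac)
        have eq: "(exp (?y * (z + h n)) * \<phi> x - exp (?y * z) * \<phi> x) / h n =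
            exp (?y * z) * ((exp (?y * h n) - 1) / h n) * \<phi> x"
          by (simp add: distrib_left exp_add field_simps)
        have "cmod (exp (?y * z) * ((exp (?y * h n) - 1) / h n)) \<le> exp ((c * cmod z) * norm x) * (exp (?t * K) * exp ?t)"
          unfolding norm_mult by (intro mult_mono 1 e_bound) auto
        also have "\<dots> = exp ((c * (cmod z + 1 + K)) * norm x)"
          by (simp add: exp_add[symmetric] algebra_simps)
        finally show "norm ((exp (?y * (z + h n)) * \<phi> x - exp (?y * z) * \<phi> x) / h n)
          \<le> cmod (of_real (exp ((c * (cmod z + 1 + K)) * norm x)) * \<phi> x)"
          unfolding eq norm_mult[of _ "\<phi> x"] norm_of_real abs_exp_cancel by (rule mult_right_mono) simp
      qed
    qed measurable
    moreover have "(LINT x|\<mu>. (exp (of_real (c * x) * (z + h n)) * \<phi> x - exp (of_real (c * x) * z) * \<phi> x) / h n) =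
        (H (z + h n) - H z) / h n" for n
      unfolding H_def
      by (subst Bochner_Integration.integral_diff[symmetric, OF e_int e_int]) simp
    ultimately show "(\<lambda>n. (H (z + h n) - H z) / h n)
        \<longlonglongrightarrow> (LINT x|\<mu>. of_real (c * x) * exp (of_real (c * x) * z) * \<phi> x)"
      by (simp only:)
  qed
  then have H: "H holomorphic_on UNIV"
    by (auto simp: holomorphic_on_def field_differentiable_def intro: DERIV_subset)
  have ker: "k z x = exp (- of_real (\<nu> / 4) * z\<^sup>2) * exp (of_real (c * x) * z)" for z x
    unfolding sb_kernel_def c_def exp_add[symmetric] by (rule arg_cong[where f = exp]) simp
  have "B \<phi> = (\<lambda>z. exp (- of_real (\<nu> / 4) * z\<^sup>2) * H z)"
    unfolding H_def bargmann_def integral_mult_right_zero[symmetric]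
    by (intro ext Bochner_Integration.integral_cong refl)
       (simp only: ker mult.assoc)
  then show ?thesis
    by (simp only:) (intro holomorphic_intros H)
qed

end

section \<open>The adjoint and the reproducing projection\<close>

text \<open>The class of functions on which the adjoint is given by an absolutely convergent integral and on
  which Fubini's theorem applies.  It contains the restriction of every continuous function to a ball.\<close>

definition bounded_support :: "('a::euclidean_space \<Rightarrow> complex) \<Rightarrow> bool" where
  "bounded_support g \<longleftrightarrow> g \<in> borel_measurable borel \<and>
     (\<exists>K\<ge>0. \<exists>R\<ge>0. \<forall>Z. cmod (g Z) \<le> K \<and> (norm Z > R \<longrightarrow> g Z = 0))"

lemma bounded_support_L2:
  assumes "bounded_support (g :: 'a::euclidean_space \<Rightarrow> complex)" "c > 0" shows "g \<in> L2 (gauss c)"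
proof -
  obtain K where "\<And>Z. cmod (g Z) \<le> K" and "g \<in> borel_measurable borel"
    using assms by (auto simp: bounded_support_def)
  then show ?thesis by (intro L2_gaussI[OF assms(2), of _ K 0]) auto
qed

lemma bounded_support_diff:
  assumes "bounded_support f" "bounded_support g"
  shows "bounded_support (\<lambda>Z. f Z - g Z)"
proof -
  obtain K R where f: "K \<ge> 0" "R \<ge> 0" "\<And>Z. cmod (f Z) \<le> K" "\<And>Z. norm Z > R \<Longrightarrow> f Z = 0"
    and [measurable]: "f \<in> borel_measurable borel"
    using assms by (auto simp: bounded_support_def)
  obtain K' R' where g: "K' \<ge> 0" "R' \<ge> 0" "\<And>Z. cmod (g Z) \<le> K'" "\<And>Z. norm Z > R' \<Longrightarrow> g Z = 0"
    and [measurable]: "g \<in> borel_measurable borel"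
    using assms by (auto simp: bounded_support_def)
  have "cmod (f Z - g Z) \<le> K + K'" for Z
    using norm_triangle_ineq4[of "f Z" "g Z"] f(3)[of Z] g(3)[of Z] by linarith
  then show ?thesis
    unfolding bounded_support_def using f g
    by (intro conjI exI[of _ "K + K'"] exI[of _ "max R R'"]) auto
qed

definition cutoff :: "real \<Rightarrow> ('a::euclidean_space \<Rightarrow> complex) \<Rightarrow> 'a \<Rightarrow> complex" where
  "cutoff R f Z = indicator (cball 0 R) Z *\<^sub>R f Z"

lemma cutoff_measurable [measurable]:
  "f \<in> borel_measurable borel \<Longrightarrow> cutoff R f \<in> borel_measurable borel"
  unfolding cutoff_def[abs_def]
  by (intro borel_measurable_scaleR borel_measurable_indicator) auto

lemma bounded_support_cutoff:
  assumes f: "continuous_on UNIV f" shows "bounded_support (cutoff R f)"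
proof -
  have "bounded (f ` cball 0 R)"
    by (intro compact_imp_bounded compact_continuous_image continuous_on_subset[OF f]) auto
  then obtain K where "\<forall>w\<in>f ` cball 0 R. cmod w \<le> K"
    unfolding bounded_iff by blast
  then have K: "cmod (f Z) \<le> K" if "Z \<in> cball 0 R" for Z
    using that by blast
  have [measurable]: "f \<in> borel_measurable borel" using f by (rule borel_measurable_continuous_onI)
  have "cutoff R f \<in> borel_measurable borel" by measurable
  moreover have "cmod (cutoff R f Z) \<le> \<bar>K\<bar>" for Z
    using K[of Z] by (auto simp: cutoff_def indicator_def)
  moreover have "cutoff R f Z = 0" if "norm Z > \<bar>R\<bar>" for Z
    using that by (auto simp: cutoff_def indicator_def)
  ultimately show ?thesis
    unfolding bounded_support_def by (intro conjI exI[of _ "\<bar>K\<bar>"] exI[of _ "\<bar>R\<bar>"]) auto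
qed

lemma cmod_cutoff_le: "cmod (cutoff R f Z) \<le> cmod (f Z)"
  by (simp add: cutoff_def indicator_def)

lemma ip_cutoff: "ip M (cutoff R f) f = of_real (sqnorm M (cutoff R f))"
  unfolding ip_self[symmetric] ip_def
  by (intro Bochner_Integration.integral_cong refl) (simp add: cutoff_def indicator_def)

lemma sqnorm_cutoff_tendsto:
  fixes f :: "'a::euclidean_space \<Rightarrow> complex"
  assumes f: "f \<in> L2 (gauss c)"
  shows "((\<lambda>R. sqnorm (gauss c) (\<lambda>Z. f Z - cutoff R f Z)) \<longlongrightarrow> 0) at_top"
proof -
  have [measurable]: "f \<in> borel_measurable borel" using L2_measurable[OF f] by simp
  have "((\<lambda>R. LINT Z|gauss c. (cmod (f Z - cutoff R f Z))\<^sup>2) \<longlongrightarrow> integral\<^sup>L (gauss c) (\<lambda>Z :: 'a. 0)) at_top"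
  proof (rule integral_dominated_convergence_at_top[where s = "\<lambda>R Z. (cmod (f Z - cutoff R f Z))\<^sup>2"
        and w = "\<lambda>Z. (cmod (f Z))\<^sup>2"])
    show "integrable (gauss c) (\<lambda>Z. (cmod (f Z))\<^sup>2)" using f by (rule L2_integrable)
    show "AE Z in gauss c. ((\<lambda>R. (cmod (f Z - cutoff R f Z))\<^sup>2) \<longlongrightarrow> 0) at_top"
    proof (rule AE_I2)
      fix Z
      show "((\<lambda>R. (cmod (f Z - cutoff R f Z))\<^sup>2) \<longlongrightarrow> 0) at_top"
        by (rule tendsto_eventually, rule eventually_mono[OF eventually_ge_at_top[of "norm Z"]])
           (simp add: cutoff_def)
    qed
    show "\<forall>\<^sub>F R in at_top. AE Z in gauss c. norm ((cmod (f Z - cutoff R f Z))\<^sup>2) \<le> (cmod (f Z))\<^sup>2"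
      by (intro always_eventually allI AE_I2) (simp add: cutoff_def indicator_def)
  qed measurable
  then show ?thesis by (simp add: sqnorm_def)
qed

context bargmann_component
begin

text \<open>The inversion integral of one component.  For bounded functions of bounded support it is the adjoint of
  the transform; the definition makes sense for every function for which the integral exists.\<close>

definition Bstar :: "(bicomplex \<Rightarrow> complex) \<Rightarrow> real \<Rightarrow> complex" where
  "Bstar g x = (LINT Z|\<gamma>. cnj (k (p Z) x) * g Z)"

text \<open>The operator \<open>B B*\<close> as an integral operator.  It extends to the orthogonal projection of \<open>L\<^sup>2(\<gamma>)\<close> onto
  the subspace of the functions \<open>F \<circ> p\<close> with \<open>F\<close> entire.\<close>

definition proj :: "(bicomplex \<Rightarrow> complex) \<Rightarrow> complex \<Rightarrow> complex" where
  "proj g w = (LINT Z|\<gamma>. g Z * exp (of_real (\<nu> / 2) * w * cnj (p Z)))"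

lemma Bstar_bound:
  assumes "bounded_support g"
  obtains C a where "C \<ge> 0" "\<And>x Z. cmod (cnj (k (p Z) x) * g Z) \<le> C * exp (a * norm x)"
proof -
  obtain K R where g: "K \<ge> 0" "R \<ge> 0" "\<And>Z. cmod (g Z) \<le> K" "\<And>Z. norm Z > R \<Longrightarrow> g Z = 0"
    using assms by (auto simp: bounded_support_def)
  have "cmod (cnj (k (p Z) x) * g Z) \<le> (exp (\<nu> / 4 * (2 * R)\<^sup>2) * K) * exp ((sqrt (\<sigma> * \<nu>) * (2 * R)) * norm x)" for x Z
  proof (cases "norm Z > R")
    case True
    then show ?thesis using g by simp
  next
    case False
    then have pR: "cmod (p Z) \<le> 2 * R" using norm_p_le[of Z] by linarith
    have "cmod (k (p Z) x) \<le> exp (\<nu> / 4 * (cmod (p Z))\<^sup>2) * exp ((sqrt (\<sigma> * \<nu>) * cmod (p Z)) * norm x)"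
      by (rule kernel_bound)
    also have "\<dots> \<le> exp (\<nu> / 4 * (2 * R)\<^sup>2) * exp ((sqrt (\<sigma> * \<nu>) * (2 * R)) * norm x)"
    proof (rule mult_mono)
      have "(cmod (p Z))\<^sup>2 \<le> (2 * R)\<^sup>2" using pR by (intro power_mono) auto
      then show "exp (\<nu> / 4 * (cmod (p Z))\<^sup>2) \<le> exp (\<nu> / 4 * (2 * R)\<^sup>2)"
        using \<nu> by (intro iffD2[OF exp_le_cancel_iff] mult_left_mono) auto
      show "exp (sqrt (\<sigma> * \<nu>) * cmod (p Z) * norm x) \<le> exp (sqrt (\<sigma> * \<nu>) * (2 * R) * norm x)"
        using \<nu> \<sigma> pR by (intro iffD2[OF exp_le_cancel_iff] mult_right_mono mult_left_mono) auto
    qed auto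
    finally have "cmod (k (p Z) x) * cmod (g Z) \<le>
        exp (\<nu> / 4 * (2 * R)\<^sup>2) * exp ((sqrt (\<sigma> * \<nu>) * (2 * R)) * norm x) * K"
      using g(3)[of Z] by (intro mult_mono) auto
    then show ?thesis by (simp add: norm_mult mult_ac)
  qed
  moreover have "0 \<le> exp (\<nu> / 4 * (2 * R)\<^sup>2) * K" using g(1) by simp
  ultimately show ?thesis by (rule that[rotated])
qed

lemma bounded_support_measurable: "bounded_support g \<Longrightarrow> g \<in> borel_measurable borel"
  by (simp add: bounded_support_def)

lemma Bstar_integrable:
  assumes g: "bounded_support g"
  shows "integrable \<gamma> (\<lambda>Z. cnj (k (p Z) x) * g Z)"
proof -
  obtain C a where C: "\<And>x Z. cmod (cnj (k (p Z) x) * g Z) \<le> C * exp (a * norm x)"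
    using Bstar_bound[OF g] by metis
  note [measurable] = bounded_support_measurable[OF g]
  show ?thesis
    by (rule gauss.integrable_const_bound[of _ "C * exp (a * norm x)"]) (use C in auto)
qed

lemma Bstar_L2:
  assumes g: "bounded_support g" shows "Bstar g \<in> L2 \<mu>"
proof -
  obtain C a where C: "C \<ge> 0" "\<And>x Z. cmod (cnj (k (p Z) x) * g Z) \<le> C * exp (a * norm x)"
    using Bstar_bound[OF g] by metis
  note [measurable] = bounded_support_measurable[OF g]
  have "Bstar g \<in> borel_measurable borel"
    unfolding Bstar_def[abs_def] by measurable
  moreover have "cmod (Bstar g x) \<le> C * exp (a * norm x)" for x
  proof -
    have "cmod (Bstar g x) \<le> (LINT Z|\<gamma>. cmod (cnj (k (p Z) x) * g Z))"
      unfolding Bstar_def by (rule integral_norm_bound)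
    also have "\<dots> \<le> (LINT Z|\<gamma>. C * exp (a * norm x))"
      by (intro integral_mono integrable_norm Bstar_integrable g C) simp
    also have "\<dots> = C * exp (a * norm x)" using gauss.prob_space by simp
    finally show ?thesis .
  qed
  ultimately show ?thesis by (intro L2_gaussI[OF \<sigma>])
qed

lemma Bstar_diff:
  assumes "bounded_support f" "bounded_support g"
  shows "Bstar (\<lambda>Z. f Z - g Z) x = Bstar f x - Bstar g x"
  unfolding Bstar_def right_diff_distrib
  by (intro Bochner_Integration.integral_diff Bstar_integrable assms)

lemma adjoint:
  assumes g: "bounded_support g" and \<psi>: "\<psi> \<in> L2 \<mu>"
  shows "ip \<mu> (Bstar g) \<psi> = ip \<gamma> g (\<lambda>Z. B \<psi> (p Z))"
proof -
  obtain C a where C: "C \<ge> 0" "\<And>x Z. cmod (cnj (k (p Z) x) * g Z) \<le> C * exp (a * norm x)"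
    using Bstar_bound[OF g] by metis
  note [measurable] = bounded_support_measurable[OF g]
  have [measurable]: "\<psi> \<in> borel_measurable borel" using L2_measurable[OF \<psi>] by simp
  have [measurable]: "(\<lambda>x. cnj (\<psi> x)) \<in> borel_measurable borel"
    using L2_measurable[OF L2_cnj[OF \<psi>]] by simp
  have "ip \<mu> (Bstar g) \<psi> = (LINT x|\<mu>. LINT Z|\<gamma>. cnj (k (p Z) x) * g Z * cnj (\<psi> x))"
    unfolding ip_def Bstar_def by simp
  also have "\<dots> = (LINT Z|\<gamma>. LINT x|\<mu>. cnj (k (p Z) x) * g Z * cnj (\<psi> x))"
  proof (rule fubini_dominated)
    show "integrable \<mu> (\<lambda>x. C * cmod (of_real (exp (a * norm x)) * \<psi> x))"
      by (intro integrable_mult_right integrable_norm L2_mult_integrable \<psi> L2_gaussI[OF \<sigma>, of _ 1]) auto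
    show "integrable \<gamma> (\<lambda>Z. 1 :: real)" by simp
    show "cmod (cnj (k (p Z) x) * g Z * cnj (\<psi> x)) \<le> C * cmod (of_real (exp (a * norm x)) * \<psi> x) * 1" for x Z
      using mult_right_mono[OF C(2)[of Z x], of "cmod (\<psi> x)"] by (simp add: norm_mult mult_ac)
  qed (simp_all add: mu.sigma_finite_measure_axioms gauss.sigma_finite_measure_axioms)
  also have "\<dots> = ip \<gamma> g (\<lambda>Z. B \<psi> (p Z))"
    unfolding ip_def bargmann_def
  proof (intro Bochner_Integration.integral_cong refl)
    fix Z
    have "(LINT x|\<mu>. cnj (k (p Z) x) * g Z * cnj (\<psi> x)) = (LINT x|\<mu>. g Z * cnj (k (p Z) x * \<psi> x))"
      by (simp add: mult_ac)
    also have "\<dots> = g Z * (LINT x|\<mu>. cnj (k (p Z) x * \<psi> x))"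
      by (rule integral_mult_right_zero)
    finally show "(LINT x|\<mu>. cnj (k (p Z) x) * g Z * cnj (\<psi> x)) = g Z * cnj (LINT x|\<mu>. k (p Z) x * \<psi> x)"
      by (simp only: Bochner_Integration.integral_cnj)
  qed
  finally show ?thesis .
qed

text \<open>The value of \<open>B\<close> at \<open>w\<close> is an inner product with \<open>cnj k(w,-)\<close>, to which \<open>adjoint\<close> applies; the transform
  of \<open>cnj k(w,-)\<close> is given by \<open>kernel_gram\<close>.\<close>

lemma bargmann_Bstar:
  assumes g: "bounded_support g"
  shows "B (Bstar g) w = proj g w"
proof -
  have gram: "B (\<lambda>x. cnj (k w x)) z = exp (of_real (\<nu> / 2) * z * cnj w)" for z
    unfolding bargmann_def kernel_gram[symmetric] ip_def ..
  have "B (Bstar g) w = ip \<gamma> g (\<lambda>Z. B (\<lambda>x. cnj (k w x)) (p Z))"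
    unfolding bargmann_eq_ip[of "Bstar g"] by (intro adjoint g L2_cnj kernel_L2)
  then show ?thesis
    unfolding gram by (simp add: proj_def ip_def exp_cnj mult_ac)
qed

lemma proj_entire:
  assumes g: "bounded_support g" shows "proj g holomorphic_on UNIV"
proof -
  have "B (Bstar g) = proj g" by (rule ext) (rule bargmann_Bstar[OF g])
  then show ?thesis using bargmann_entire[OF Bstar_L2[OF g]] by simp
qed

lemma exp_gram_bound:
  assumes "cmod z \<le> 2 * R" 
  shows "cmod (exp (of_real (\<nu> / 2) * w * cnj z)) \<le> exp (\<nu> * R * cmod w)"
proof -
  have "Re (of_real (\<nu> / 2) * w * cnj z) \<le> cmod (of_real (\<nu> / 2) * w * cnj z)" by (rule complex_Re_le_cmod)
  also have "\<dots> = \<nu> / 2 * cmod w * cmod z" using \<nu> by (simp add: norm_mult)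
  also have "\<dots> \<le> \<nu> / 2 * cmod w * (2 * R)" using \<nu> assms by (intro mult_left_mono) auto
  finally show ?thesis by (simp add: mult_ac)
qed

lemma gram_bound:
  assumes "bounded_support g"
  obtains C a where "C \<ge> 0" "\<And>W Z. cmod (g Z * exp (of_real (\<nu> / 2) * p W * cnj (p Z))) \<le> C * exp (a * norm W)"
proof -
  obtain K R where g: "K \<ge> 0" "R \<ge> 0" "\<And>Z. cmod (g Z) \<le> K" "\<And>Z. norm Z > R \<Longrightarrow> g Z = 0"
    using assms by (auto simp: bounded_support_def)
  have "cmod (g Z * exp (of_real (\<nu> / 2) * p W * cnj (p Z))) \<le> K * exp ((2 * \<nu> * R) * norm W)" for W Z
  proof (cases "norm Z > R")
    case True
    then show ?thesis using g by simp
  next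
    case False
    then have pR: "cmod (p Z) \<le> 2 * R" using norm_p_le[of Z] by linarith
    have "cmod (exp (of_real (\<nu> / 2) * p W * cnj (p Z))) \<le> exp (\<nu> * R * cmod (p W))"
      by (rule exp_gram_bound[OF pR])
    also have "\<dots> \<le> exp (\<nu> * R * (2 * norm W))"
      using \<nu> g(2) norm_p_le[of W] by (simp add: mult_left_mono)
    finally have "cmod (g Z) * cmod (exp (of_real (\<nu> / 2) * p W * cnj (p Z))) \<le> K * exp (\<nu> * R * (2 * norm W))"
      using g(1) g(3)[of Z] by (intro mult_mono) auto
    then show ?thesis by (simp add: norm_mult mult_ac)
  qed
  then show ?thesis using that g by blast
qed

lemma gram_measurable [measurable]:
  "(\<lambda>(W, Z). exp (of_real (\<nu> / 2) * p W * cnj (p Z))) \<in> borel_measurable (borel \<Otimes>\<^sub>M borel)"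
  unfolding borel_prod case_prod_unfold
  by (intro borel_measurable_continuous_onI continuous_intros continuous_on_compose2[OF p_continuous[of UNIV]]) auto

lemma gram_measurable_right [measurable]:
  "(\<lambda>Z. exp (of_real (\<nu> / 2) * w * cnj (p Z))) \<in> borel_measurable borel"
  by (intro borel_measurable_continuous_onI continuous_intros p_continuous)

lemma proj_L2:
  assumes g: "bounded_support g" shows "(\<lambda>W. proj g (p W)) \<in> L2 \<gamma>"
proof -
  obtain C a where C: "C \<ge> 0" "\<And>W Z. cmod (g Z * exp (of_real (\<nu> / 2) * p W * cnj (p Z))) \<le> C * exp (a * norm W)"
    using gram_bound[OF g] by metis
  note [measurable] = bounded_support_measurable[OF g] entire_measurable[OF proj_entire[OF g]]
  have "cmod (proj g (p W)) \<le> C * exp (a * norm W)" for W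
  proof -
    have i: "integrable \<gamma> (\<lambda>Z. g Z * exp (of_real (\<nu> / 2) * p W * cnj (p Z)))"
      by (rule gauss.integrable_const_bound[of _ "C * exp (a * norm W)"], rule AE_I2, rule C) measurable
    have "cmod (proj g (p W)) \<le> (LINT Z|\<gamma>. cmod (g Z * exp (of_real (\<nu> / 2) * p W * cnj (p Z))))"
      unfolding proj_def by (rule integral_norm_bound)
    also have "\<dots> \<le> (LINT Z|\<gamma>. C * exp (a * norm W))"
      by (intro integral_mono integrable_norm i C) simp
    also have "\<dots> = C * exp (a * norm W)" using gauss.prob_space by simp
    finally show ?thesis .
  qed
  then show ?thesis by (intro L2_gaussI[OF \<nu>]) measurable
qed

text \<open>The kernel is Hermitian, so moving \<open>proj\<close> to the left argument turns it into the reproducing integral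
  of \<open>F\<close>.\<close>

lemma proj_adjoint:
  assumes g: "bounded_support g" and F: "F holomorphic_on UNIV" and L2: "(\<lambda>Z. F (p Z)) \<in> L2 \<gamma>"
  shows "ip \<gamma> (\<lambda>W. F (p W)) (\<lambda>W. proj g (p W)) = ip \<gamma> (\<lambda>W. F (p W)) g"
proof -
  obtain C a where C: "C \<ge> 0" "\<And>W Z. cmod (g Z * exp (of_real (\<nu> / 2) * p W * cnj (p Z))) \<le> C * exp (a * norm W)"
    using gram_bound[OF g] by metis
  note [measurable] = bounded_support_measurable[OF g] entire_measurable[OF F]
  let ?E = "\<lambda>W Z. exp (of_real (\<nu> / 2) * p W * cnj (p Z))"
  have c1: "cnj (?E W Z) = ?E Z W" for W Z
    by (simp add: exp_cnj mult_ac)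
  have [measurable]: "(\<lambda>Z. cnj (g Z)) \<in> borel_measurable borel"
    by (simp add: borel_measurable_complex_iff)
  have "ip \<gamma> (\<lambda>W. F (p W)) (\<lambda>W. proj g (p W)) = (LINT W|\<gamma>. LINT Z|\<gamma>. F (p W) * (cnj (g Z) * ?E Z W))"
    unfolding ip_def proj_def integral_mult_right_zero
    by (simp only: Bochner_Integration.integral_cnj[symmetric] complex_cnj_mult c1)
  also have "\<dots> = (LINT Z|\<gamma>. LINT W|\<gamma>. F (p W) * (cnj (g Z) * ?E Z W))"
  proof (rule fubini_dominated)
    show "integrable \<gamma> (\<lambda>W. C * cmod (of_real (exp (a * norm W)) * F (p W)))"
      by (intro integrable_mult_right integrable_norm L2_mult_integrable L2 L2_gaussI[OF \<nu>, of _ 1]) auto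
    show "integrable \<gamma> (\<lambda>Z. 1 :: real)" by simp
    show "cmod (F (p W) * (cnj (g Z) * ?E Z W)) \<le> C * cmod (of_real (exp (a * norm W)) * F (p W)) * 1" for W Z
    proof -
      have "cmod (cnj (g Z) * ?E Z W) = cmod (cnj (g Z * ?E W Z))"
        by (simp only: complex_cnj_mult c1)
      also have "\<dots> = cmod (g Z * ?E W Z)" by (rule complex_mod_cnj)
      finally show ?thesis
        using mult_left_mono[OF C(2)[of Z W], of "cmod (F (p W))"] by (simp add: norm_mult mult_ac)
    qed
    have "(\<lambda>(W, Z). F (p W) * (cnj (g Z) * ?E Z W)) \<in> borel_measurable (borel \<Otimes>\<^sub>M borel)"
      by measurable
    then show "(\<lambda>(W, Z). F (p W) * (cnj (g Z) * ?E Z W)) \<in> borel_measurable (\<gamma> \<Otimes>\<^sub>M \<gamma>)"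
      by measurable
  qed (simp_all add: gauss.sigma_finite_measure_axioms)
  also have "\<dots> = (LINT Z|\<gamma>. cnj (g Z) * (LINT W|\<gamma>. F (p W) * ?E Z W))"
    by (intro Bochner_Integration.integral_cong refl)
       (subst integral_mult_right_zero[symmetric], simp only: mult_ac)
  also have "\<dots> = ip \<gamma> (\<lambda>W. F (p W)) g"
    unfolding reproducing[OF F L2] ip_def by (simp add: mult.commute)
  finally show ?thesis .
qed

text \<open>With \<open>P = B B*\<close> one has \<open>\<parallel>B* g\<parallel>\<^sup>2 = \<langle>g, P g\<rangle>\<close> and, by \<open>proj_adjoint\<close>, \<open>\<parallel>P g\<parallel>\<^sup>2 = \<langle>g, P g\<rangle>\<close>.  Hence
  \<open>0 \<le> \<parallel>g - P g\<parallel>\<^sup>2 = \<parallel>g\<parallel>\<^sup>2 - \<parallel>B* g\<parallel>\<^sup>2\<close>.\<close>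

lemma Bstar_contraction:
  assumes g: "bounded_support g"
  shows "sqnorm \<mu> (Bstar g) \<le> sqnorm \<gamma> g"
proof -
  let ?P = "\<lambda>W. proj g (p W)"
  note gL = bounded_support_L2[OF g \<nu>] and PL = proj_L2[OF g]
  have "ip \<gamma> ?P ?P = ip \<gamma> ?P g"
    by (rule proj_adjoint[OF g proj_entire[OF g] PL])
  then have "Re (ip \<gamma> ?P ?P) = Re (cnj (ip \<gamma> ?P g))" by simp
  then have 1: "sqnorm \<gamma> ?P = Re (ip \<gamma> g ?P)"
    unfolding cnj_ip ip_self by simp
  have "complex_of_real (sqnorm \<mu> (Bstar g)) = ip \<gamma> g ?P"
    unfolding ip_self[symmetric] adjoint[OF g Bstar_L2[OF g]] bargmann_Bstar[OF g] ..
  then have 2: "sqnorm \<mu> (Bstar g) = Re (ip \<gamma> g ?P)"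
    by (metis Re_complex_of_real)
  have "0 \<le> sqnorm \<gamma> (\<lambda>Z. g Z - ?P Z)" by simp
  then show ?thesis
    unfolding sqnorm_diff[OF gL PL] using 1 2 by simp
qed

end

section \<open>Uniqueness of Fourier transforms\<close>

text \<open>The functions \<open>u = 1 + max r 0\<close> and \<open>v = 1 + max (- r) 0\<close> have the same Fourier transform.  Divided by
  their common integral they are densities of probability measures with equal characteristic functions.
  The summand 1 keeps this integral positive also when \<open>r\<close> vanishes.\<close>

lemma fourier_zero_real:
  fixes r :: "real \<Rightarrow> real"
  assumes "prob_space M" and M: "sets M = sets borel" and int: "integrable M r"
    and four: "\<And>t. (CLINT x|M. iexp (t * x) * of_real (r x)) = 0"
  shows "AE x in M. r x = 0"
proof -
  interpret prob_space M by fact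
  note [measurable_cong] = M
  have [measurable]: "r \<in> borel_measurable borel"
    using borel_measurable_integrable[OF int] M by (simp cong: measurable_cong_sets)
  define u v where "u x = 1 + max (r x) 0" and "v x = 1 + max (- r x) 0" for x
  have um [measurable]: "u \<in> borel_measurable borel" and vm [measurable]: "v \<in> borel_measurable borel"
    by (simp_all add: u_def[abs_def] v_def[abs_def])
  have ui: "integrable M u" and vi: "integrable M v"
    unfolding u_def[abs_def] v_def[abs_def]
    by (auto intro!: Bochner_Integration.integrable_add integrable_max int)
  have pos: "u x \<ge> 1" "v x \<ge> 1" for x by (auto simp: u_def v_def)
  have uv: "u x - v x = r x" for x by (auto simp: u_def v_def)
  have ie: "integrable M (\<lambda>x. iexp (t * x) * of_real (h x))" if "integrable M h" for t h
  proof (rule Bochner_Integration.integrable_bound[OF that])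
    have "h \<in> borel_measurable M" using that by simp
    then show "(\<lambda>x. iexp (t * x) * of_real (h x)) \<in> borel_measurable M" by measurable
  qed (simp add: norm_mult)
  have diff: "(CLINT x|M. iexp (t * x) * of_real (u x)) = (CLINT x|M. iexp (t * x) * of_real (v x))" for t
  proof -
    have "(CLINT x|M. iexp (t * x) * of_real (u x)) - (CLINT x|M. iexp (t * x) * of_real (v x)) =
      (CLINT x|M. iexp (t * x) * of_real (r x))"
      by (subst Bochner_Integration.integral_diff[symmetric, OF ie[OF ui] ie[OF vi]])
         (simp flip: uv add: right_diff_distrib)
    then show ?thesis using four by simp
  qed
  define m where "m = (LINT x|M. u x)"
  have mv: "m = (LINT x|M. v x)"
    using diff[of 0] unfolding m_def by (simp del: of_real_eq_iff add: of_real_eq_iff[symmetric, where 'a = complex])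
  have m: "m > 0"
  proof -
    have "(LINT x|M. 1) \<le> m"
      unfolding m_def by (intro integral_mono ui pos) simp
    then show ?thesis using prob_space by simp
  qed
  define D where "D h = density M (\<lambda>x. ennreal (h x / m))" for h :: "real \<Rightarrow> real"
  have D: "real_distribution (D h)"
    if [measurable]: "h \<in> borel_measurable borel" and hi: "integrable M h" and h1: "\<And>x. h x \<ge> 1" and hm: "(LINT x|M. h x) = m" for h
  proof -
    have h0: "0 \<le> h x" for x using h1[of x] by simp
    have "emeasure (D h) (space (D h)) = (\<integral>\<^sup>+x. ennreal (h x / m) \<partial>M)"
      unfolding D_def by (subst emeasure_density) (auto intro!: nn_integral_cong)
    also have "\<dots> = ennreal (LINT x|M. h x / m)"
      using m h0 hi by (intro nn_integral_eq_integral) auto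
    also have "\<dots> = 1" using m hm by simp
    finally have "prob_space (D h)" by (rule prob_spaceI)
    then show ?thesis
      unfolding real_distribution_def real_distribution_axioms_def
      using M sets_eq_imp_space_eq[OF M] by (simp add: D_def)
  qed
  have charD: "char (D h) t = (CLINT x|M. iexp (t * x) * of_real (h x)) / of_real m"
    if [measurable]: "h \<in> borel_measurable borel" and h1: "\<And>x. h x \<ge> 1" for h t
  proof -
    have h0: "0 \<le> h x" for x using h1[of x] by simp
    have "char (D h) t = (CLINT x|M. (h x / m) *\<^sub>R iexp (t * x))"
      unfolding char_def D_def using m h0 by (subst integral_density) auto
    also have "\<dots> = (CLINT x|M. (iexp (t * x) * of_real (h x)) / of_real m)"
      by (simp add: scaleR_conv_of_real mult_ac)
    finally show ?thesis by simp
  qed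
  have "D u = D v"
  proof (rule Levy_uniqueness)
    show "real_distribution (D u)" "real_distribution (D v)"
      using ui vi pos mv by (auto intro!: D simp: m_def)
    show "char (D u) = char (D v)"
      unfolding fun_eq_iff charD[OF um pos(1)] charD[OF vm pos(2)] diff by blast
  qed
  then have "AE x in M. ennreal (u x / m) = ennreal (v x / m)"
    unfolding D_def by (subst (asm) density_unique_iff) auto
  then show ?thesis
  proof eventually_elim
    case (elim x)
    then have "u x / m = v x / m"
      using m pos[of x] by (subst (asm) ennreal_inj) auto
    then show ?case using m uv[of x] by simp
  qed
qed

text \<open>Conjugation shows that the Fourier transform of \<open>cnj \<rho>\<close> vanishes as well, hence so do those of the real
  and imaginary parts.\<close>

lemma fourier_zero:
  fixes \<rho> :: "real \<Rightarrow> complex"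
  assumes M: "prob_space M" "sets M = sets borel" and int: "integrable M \<rho>"
    and four: "\<And>t. (CLINT x|M. iexp (t * x) * \<rho> x) = 0"
  shows "AE x in M. \<rho> x = 0"
proof -
  have i: "integrable M (\<lambda>x. iexp (t * x) * h x)" if h: "integrable M h" for t and h :: "real \<Rightarrow> complex"
  proof (rule Bochner_Integration.integrable_bound[OF h])
    have [measurable]: "h \<in> borel_measurable M" using h by simp
    show "(\<lambda>x. iexp (t * x) * h x) \<in> borel_measurable M"
      using M(2) by measurable
  qed (simp add: norm_mult)
  have int': "integrable M (\<lambda>x. cnj (\<rho> x))" using int by simp
  have four': "(CLINT x|M. iexp (t * x) * cnj (\<rho> x)) = 0" for t
  proof -
    have "(CLINT x|M. iexp (t * x) * cnj (\<rho> x)) = cnj (CLINT x|M. iexp (- t * x) * \<rho> x)"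
      by (subst Bochner_Integration.integral_cnj[symmetric]) (simp add: exp_cnj)
    then show ?thesis using four[of "- t"] by simp
  qed
  have re: "(CLINT x|M. iexp (t * x) * of_real (Re (\<rho> x))) =
      ((CLINT x|M. iexp (t * x) * \<rho> x) + (CLINT x|M. iexp (t * x) * cnj (\<rho> x))) / 2" for t
    by (subst Bochner_Integration.integral_add[symmetric, OF i[OF int] i[OF int']])
       (simp add: distrib_left[symmetric] complex_add_cnj flip: integral_divide_zero)
  have 1: "AE x in M. Re (\<rho> x) = 0"
    by (rule fourier_zero_real[OF M integrable_Re[OF int]]) (simp only: re four four', simp)
  have "(2 * \<i>) * (CLINT x|M. iexp (t * x) * of_real (Im (\<rho> x))) =
      (CLINT x|M. iexp (t * x) * \<rho> x) - (CLINT x|M. iexp (t * x) * cnj (\<rho> x))" for t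
  proof -
    have e: "(2 * \<i>) * (E * of_real (Im w)) = E * w - E * cnj w" for E w :: complex
      unfolding right_diff_distrib[symmetric] complex_diff_cnj by simp
    show ?thesis
      unfolding Bochner_Integration.integral_diff[symmetric, OF i[OF int] i[OF int']]
        integral_mult_right_zero[symmetric] e ..
  qed
  then have im: "(CLINT x|M. iexp (t * x) * of_real (Im (\<rho> x))) = 0" for t
    unfolding four four' by simp
  have 2: "AE x in M. Im (\<rho> x) = 0"
    by (rule fourier_zero_real[OF M integrable_Im[OF int]]) (rule im)
  from 1 2 show ?thesis by eventually_elim (simp add: complex_eq_iff)
qed

section \<open>Unitarity and inversion for one component\<close>

context bargmann_component
begin

lemma continuous_on_p: 
  assumes "F holomorphic_on UNIV" shows "continuous_on UNIV (\<lambda>Z. F (p Z))"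
  by (rule continuous_on_compose2[OF holomorphic_on_imp_continuous_on[OF assms] p_continuous]) auto

text \<open>With \<open>g\<close> the restriction of \<open>B \<psi>\<close> to a ball, \<open>\<langle>B* g, \<psi>\<rangle> = \<langle>g, B \<psi>\<rangle> = \<parallel>g\<parallel>\<^sup>2\<close>.  Expanding
  \<open>0 \<le> \<parallel>B* g - \<psi>\<parallel>\<^sup>2\<close> and using \<open>\<parallel>B* g\<parallel> \<le> \<parallel>g\<parallel>\<close> gives the bound.\<close>

lemma bargmann_contraction_cutoff:
  assumes \<psi>: "\<psi> \<in> L2 \<mu>"
  shows "sqnorm \<gamma> (cutoff R (\<lambda>Z. B \<psi> (p Z))) \<le> sqnorm \<mu> \<psi>"
proof -
  let ?f = "\<lambda>Z. B \<psi> (p Z)"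
  let ?g = "cutoff R ?f"
  have g: "bounded_support ?g"
    by (intro bounded_support_cutoff continuous_on_p bargmann_entire \<psi>)
  have "ip \<mu> (Bstar ?g) \<psi> = of_real (sqnorm \<gamma> ?g)"
    unfolding adjoint[OF g \<psi>] by (rule ip_cutoff)
  then have "0 \<le> sqnorm \<mu> (Bstar ?g) - 2 * sqnorm \<gamma> ?g + sqnorm \<mu> \<psi>"
    using sqnorm_diff[OF Bstar_L2[OF g] \<psi>] sqnorm_nonneg[of \<mu> "\<lambda>x. Bstar ?g x - \<psi> x"] by simp
  then show ?thesis using Bstar_contraction[OF g] by linarith
qed

lemma bargmann_L2:
  assumes \<psi>: "\<psi> \<in> L2 \<mu>"
  shows "(\<lambda>Z. B \<psi> (p Z)) \<in> L2 \<gamma>"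
proof -
  let ?f = "\<lambda>Z. B \<psi> (p Z)"
  note [measurable] = entire_measurable[OF bargmann_entire[OF \<psi>]]
  have int: "integrable \<gamma> (\<lambda>Z. (cmod (cutoff R ?f Z))\<^sup>2)" for R
    by (intro L2_integrable bounded_support_L2 bounded_support_cutoff continuous_on_p bargmann_entire \<psi> \<nu>)
  have "(\<integral>\<^sup>+Z. ennreal ((cmod (?f Z))\<^sup>2) \<partial>\<gamma>) =
      (\<integral>\<^sup>+Z. liminf (\<lambda>n. ennreal ((cmod (cutoff (real n) ?f Z))\<^sup>2)) \<partial>\<gamma>)"
  proof (rule nn_integral_cong)
    fix Z
    have "\<forall>\<^sub>F n in sequentially. cutoff (real n) ?f Z = ?f Z"
      using eventually_ge_at_top[of "nat \<lceil>norm Z\<rceil>"]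
      by eventually_elim (auto simp: cutoff_def indicator_def nat_ceiling_le_eq)
    then have "(\<lambda>n. ennreal ((cmod (cutoff (real n) ?f Z))\<^sup>2)) \<longlonglongrightarrow> ennreal ((cmod (?f Z))\<^sup>2)"
      by (intro tendsto_eventually) (auto elim: eventually_mono)
    then show "ennreal ((cmod (?f Z))\<^sup>2) = liminf (\<lambda>n. ennreal ((cmod (cutoff (real n) ?f Z))\<^sup>2))"
      by (intro lim_imp_Liminf[symmetric]) auto
  qed
  also have "\<dots> \<le> liminf (\<lambda>n. \<integral>\<^sup>+Z. ennreal ((cmod (cutoff (real n) ?f Z))\<^sup>2) \<partial>\<gamma>)"
    by (intro nn_integral_liminf) measurable
  also have "\<dots> \<le> ennreal (sqnorm \<mu> \<psi>)"
  proof (rule order_trans[OF Liminf_le_Limsup], simp, rule Limsup_bounded, rule always_eventually, rule allI)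
    fix n
    show "(\<integral>\<^sup>+Z. ennreal ((cmod (cutoff (real n) ?f Z))\<^sup>2) \<partial>\<gamma>) \<le> ennreal (sqnorm \<mu> \<psi>)"
      using bargmann_contraction_cutoff[OF \<psi>, of "real n"]
      by (subst nn_integral_eq_integral[OF int]) (auto simp: sqnorm_def ennreal_leI)
  qed
  finally have "integrable \<gamma> (\<lambda>Z. (cmod (?f Z))\<^sup>2)"
    by (intro integrableI_bounded) (auto intro: le_less_trans)
  then show ?thesis by (simp add: L2_def)
qed

text \<open>The truncated inversion integrals form a Cauchy sequence since \<open>B*\<close> is a contraction.  Its limit is
  mapped to \<open>F\<close> because \<open>B B*\<close> of the truncations converges pointwise to the reproducing integral of \<open>F\<close>.\<close>

lemma bargmann_surjective:
  assumes F: "F holomorphic_on UNIV" and L2: "(\<lambda>Z. F (p Z)) \<in> L2 \<gamma>"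
  obtains \<phi> where "\<phi> \<in> L2 \<mu>" "B \<phi> = F"
    "(\<lambda>n. sqnorm \<mu> (\<lambda>x. \<phi> x - Bstar (cutoff (real n) (\<lambda>Z. F (p Z))) x)) \<longlonglongrightarrow> 0"
proof -
  let ?f = "\<lambda>Z. F (p Z)"
  define c where "c n = cutoff (real n) ?f" for n
  have c: "bounded_support (c n)" for n
    unfolding c_def by (intro bounded_support_cutoff continuous_on_p F)
  note cL2 = bounded_support_L2[OF c \<nu>]
  have lim: "(\<lambda>n. sqnorm \<gamma> (\<lambda>Z. ?f Z - c n Z)) \<longlonglongrightarrow> 0"
    unfolding c_def using filterlim_compose[OF sqnorm_cutoff_tendsto[OF L2] filterlim_real_sequentially] .
  obtain \<phi> where \<phi>: "\<phi> \<in> L2 \<mu>" and conv: "(\<lambda>n. sqnorm \<mu> (\<lambda>x. \<phi> x - Bstar (c n) x)) \<longlonglongrightarrow> 0"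
  proof (rule L2_complete[OF mu.finite_measure_axioms _ _ lim])
    show "Bstar (c n) \<in> L2 \<mu>" for n by (rule Bstar_L2[OF c])
    fix m n :: nat assume "m \<le> n"
    have "sqnorm \<mu> (\<lambda>x. Bstar (c m) x - Bstar (c n) x) = sqnorm \<mu> (Bstar (\<lambda>Z. c m Z - c n Z))"
      by (intro arg_cong[where f = "sqnorm \<mu>"] ext) (simp add: Bstar_diff c)
    also have "\<dots> \<le> sqnorm \<gamma> (\<lambda>Z. c m Z - c n Z)"
      by (intro Bstar_contraction bounded_support_diff c)
    also have "\<dots> \<le> sqnorm \<gamma> (\<lambda>Z. ?f Z - c m Z)"
      unfolding sqnorm_def
      by (intro integral_mono L2_integrable L2_diff cL2 L2)
         (use \<open>m \<le> n\<close> in \<open>auto simp: c_def cutoff_def indicator_def\<close>)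
    finally show "sqnorm \<mu> (\<lambda>x. Bstar (c m) x - Bstar (c n) x) \<le> sqnorm \<gamma> (\<lambda>Z. ?f Z - c m Z)" .
  qed
  have "B \<phi> w = F w" for w
  proof (rule LIMSEQ_unique)
    show "(\<lambda>n. B (Bstar (c n)) w) \<longlonglongrightarrow> B \<phi> w"
      unfolding bargmann_eq_ip
      by (rule ip_tendsto[OF Bstar_L2[OF c] \<phi> L2_cnj[OF kernel_L2] conv])
    let ?e = "\<lambda>Z. exp (of_real (\<nu> / 2) * w * cnj (p Z))"
    have eL: "(\<lambda>Z. cnj (?e Z)) \<in> L2 \<gamma>" by (intro L2_cnj exp_p_L2)
    have "(\<lambda>n. ip \<gamma> (c n) (\<lambda>Z. cnj (?e Z))) \<longlonglongrightarrow> ip \<gamma> ?f (\<lambda>Z. cnj (?e Z))"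
      by (rule ip_tendsto[OF cL2 L2 eL lim])
    then show "(\<lambda>n. B (Bstar (c n)) w) \<longlonglongrightarrow> F w"
      unfolding bargmann_Bstar[OF c] proj_def ip_def complex_cnj_cnj reproducing[OF F L2] .
  qed
  then show ?thesis using that[OF \<phi>] conv unfolding c_def by blast
qed

text \<open>At \<open>z = \<i> t / sqrt (\<sigma> \<nu>)\<close> the transform is a nonzero multiple of the Fourier transform of \<open>\<rho> d\<mu>\<close>
  at \<open>t\<close>.\<close>

lemma bargmann_injective:
  assumes \<rho>: "\<rho> \<in> L2 \<mu>" and zero: "\<And>z. B \<rho> z = 0"
  shows "AE x in \<mu>. \<rho> x = 0"
proof (rule fourier_zero[OF mu.prob_space_axioms])
  show "integrable \<mu> \<rho>" by (rule L2_imp_integrable[OF mu.finite_measure_axioms \<rho>])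
  fix t
  define s where "s = sqrt (\<sigma> * \<nu>)"
  have s: "s > 0" using \<sigma> \<nu> by (simp add: s_def)
  define z where "z = \<i> * of_real (t / s)"
  have "k z x = exp (- of_real (\<nu> / 4) * z\<^sup>2) * iexp (t * x)" for x
    unfolding sb_kernel_def exp_add[symmetric] s_def[symmetric]
    using s by (intro arg_cong[where f = exp]) (simp add: z_def field_simps)
  then have "B \<rho> z = exp (- of_real (\<nu> / 4) * z\<^sup>2) * (CLINT x|\<mu>. iexp (t * x) * \<rho> x)"
    unfolding bargmann_def by (simp only: mult.assoc integral_mult_right_zero)
  then show "(CLINT x|\<mu>. iexp (t * x) * \<rho> x) = 0"
    using zero[of z] by (simp only: mult_eq_0_iff exp_not_eq_zero) simp
qed simp

lemma bargmann_diff: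
  assumes "\<phi> \<in> L2 \<mu>" "\<psi> \<in> L2 \<mu>"
  shows "B (\<lambda>x. \<phi> x - \<psi> x) z = B \<phi> z - B \<psi> z"
  unfolding bargmann_eq_ip by (rule ip_diff_left[OF assms L2_cnj[OF kernel_L2]])

text \<open>A preimage \<open>\<phi>'\<close> of \<open>B \<phi>\<close> is constructed by \<open>bargmann_surjective\<close> as a limit of functions \<open>B* f\<^sub>n\<close>, for
  which the adjoint relation gives the inner products with \<open>\<psi>\<close>.  By injectivity \<open>\<phi>'\<close> equals \<open>\<phi>\<close> almost
  everywhere.\<close>

lemma bargmann_isometry:
  assumes \<phi>: "\<phi> \<in> L2 \<mu>" and \<psi>: "\<psi> \<in> L2 \<mu>"
  shows "ip \<gamma> (\<lambda>Z. B \<phi> (p Z)) (\<lambda>Z. B \<psi> (p Z)) = ip \<mu> \<phi> \<psi>"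
proof -
  let ?f = "\<lambda>Z. B \<phi> (p Z)" and ?g = "\<lambda>Z. B \<psi> (p Z)"
  note entire = bargmann_entire[OF \<phi>] and fL2 = bargmann_L2[OF \<phi>]
  obtain \<phi>' where \<phi>': "\<phi>' \<in> L2 \<mu>" "B \<phi>' = B \<phi>"
    and conv: "(\<lambda>n. sqnorm \<mu> (\<lambda>x. \<phi>' x - Bstar (cutoff (real n) ?f) x)) \<longlonglongrightarrow> 0"
    by (rule bargmann_surjective[OF entire fL2])
  have c: "bounded_support (cutoff (real n) ?f)" for n
    by (intro bounded_support_cutoff continuous_on_p entire)
  have "AE x in \<mu>. \<phi>' x - \<phi> x = 0"
    using bargmann_diff[OF \<phi>'(1) \<phi>] \<phi>'(2)
    by (intro bargmann_injective L2_diff \<phi>' \<phi>) simp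
  then have "ip \<mu> \<phi>' \<psi> = ip \<mu> \<phi> \<psi>"
    unfolding ip_def
    by (intro integral_cong_AE)
       (use L2_measurable[OF \<phi>] L2_measurable[OF \<phi>'(1)] L2_measurable[OF L2_cnj[OF \<psi>]] in \<open>auto elim: eventually_mono\<close>)
  moreover have "ip \<mu> \<phi>' \<psi> = ip \<gamma> ?f ?g"
  proof (rule LIMSEQ_unique)
    show "(\<lambda>n. ip \<mu> (Bstar (cutoff (real n) ?f)) \<psi>) \<longlonglongrightarrow> ip \<mu> \<phi>' \<psi>"
      by (rule ip_tendsto[OF Bstar_L2[OF c] \<phi>'(1) \<psi> conv])
    have "(\<lambda>n. sqnorm \<gamma> (\<lambda>Z. ?f Z - cutoff (real n) ?f Z)) \<longlonglongrightarrow> 0"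
      using filterlim_compose[OF sqnorm_cutoff_tendsto[OF fL2] filterlim_real_sequentially] .
    then show "(\<lambda>n. ip \<mu> (Bstar (cutoff (real n) ?f)) \<psi>) \<longlonglongrightarrow> ip \<gamma> ?f ?g"
      unfolding adjoint[OF c \<psi>]
      by (rule ip_tendsto[OF bounded_support_L2[OF c \<nu>] fL2 bargmann_L2[OF \<psi>]])
  qed
  ultimately show ?thesis by simp
qed

text \<open>With \<open>f = B \<phi>\<close> and a truncation \<open>g\<close> of \<open>f\<close>, expand \<open>\<parallel>\<phi> - B* g\<parallel>\<^sup>2\<close> and \<open>\<parallel>f - g\<parallel>\<^sup>2\<close>: the squared norms
  of \<open>\<phi>\<close> and \<open>f\<close> and the mixed terms agree, and \<open>\<parallel>B* g\<parallel> \<le> \<parallel>g\<parallel>\<close>.\<close>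

lemma inversion_error:
  assumes \<phi>: "\<phi> \<in> L2 \<mu>"
  shows "sqnorm \<mu> (\<lambda>x. \<phi> x - Bstar (cutoff R (\<lambda>Z. B \<phi> (p Z))) x)
    \<le> sqnorm \<gamma> (\<lambda>Z. B \<phi> (p Z) - cutoff R (\<lambda>Z. B \<phi> (p Z)) Z)"
proof -
  let ?f = "\<lambda>Z. B \<phi> (p Z)"
  let ?g = "cutoff R ?f"
  note entire = bargmann_entire[OF \<phi>] and fL2 = bargmann_L2[OF \<phi>]
  have g: "bounded_support ?g"
    by (intro bounded_support_cutoff continuous_on_p entire)
  note gL2 = bounded_support_L2[OF g \<nu>]
  have "sqnorm \<mu> \<phi> = sqnorm \<gamma> ?f"
    using bargmann_isometry[OF \<phi> \<phi>] by (simp add: ip_self)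
  moreover have "ip \<mu> \<phi> (Bstar ?g) = ip \<gamma> ?f ?g"
    unfolding cnj_ip[of \<mu> "Bstar ?g" \<phi>, symmetric] adjoint[OF g \<phi>] by (rule cnj_ip)
  ultimately show ?thesis
    unfolding sqnorm_diff[OF \<phi> Bstar_L2[OF g]] sqnorm_diff[OF fL2 gL2]
    using Bstar_contraction[OF g] by simp
qed

text \<open>A subsequence of the truncated integrals converges to \<open>\<phi>\<close> almost everywhere, and where the full
  integral converges absolutely, the truncated integrals also converge to it.\<close>

lemma pointwise_inversion:
  assumes \<phi>: "\<phi> \<in> L2 \<mu>"
  shows "AE x in \<mu>. integrable \<gamma> (\<lambda>Z. cnj (k (p Z) x) * B \<phi> (p Z)) \<longrightarrow>
    \<phi> x = Bstar (\<lambda>Z. B \<phi> (p Z)) x"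
proof -
  let ?f = "\<lambda>Z. B \<phi> (p Z)"
  define c where "c n = cutoff (real n) ?f" for n
  note entire = bargmann_entire[OF \<phi>]
  note [measurable] = entire_measurable[OF entire]
  have c: "bounded_support (c n)" for n
    unfolding c_def by (intro bounded_support_cutoff continuous_on_p entire)
  note [measurable] = bounded_support_measurable[OF c]
  have d: "(\<lambda>x. \<phi> x - Bstar (c n) x) \<in> L2 \<mu>" for n by (intro L2_diff \<phi> Bstar_L2 c)
  have "(\<lambda>n. sqnorm \<gamma> (\<lambda>Z. ?f Z - c n Z)) \<longlonglongrightarrow> 0"
    unfolding c_def using filterlim_compose[OF sqnorm_cutoff_tendsto[OF bargmann_L2[OF \<phi>]] filterlim_real_sequentially] .
  moreover have "sqnorm \<mu> (\<lambda>x. \<phi> x - Bstar (c n) x) \<le> sqnorm \<gamma> (\<lambda>Z. ?f Z - c n Z)" for n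
    unfolding c_def by (rule inversion_error[OF \<phi>])
  ultimately have "(\<lambda>n. sqnorm \<mu> (\<lambda>x. \<phi> x - Bstar (c n) x)) \<longlonglongrightarrow> 0"
    by - (rule tendsto_sandwich[OF always_eventually always_eventually tendsto_const], auto)
  then have "(\<lambda>n. LINT x|\<mu>. norm ((cmod (\<phi> x - Bstar (c n) x))\<^sup>2)) \<longlonglongrightarrow> 0"
    by (simp add: sqnorm_def)
  from tendsto_L1_AE_subseq[OF L2_integrable[OF d] this]
  obtain r where r: "strict_mono r"
    and ae: "AE x in \<mu>. (\<lambda>n. (cmod (\<phi> x - Bstar (c (r n)) x))\<^sup>2) \<longlonglongrightarrow> 0"
    by blast
  from ae show ?thesis
  proof eventually_elim
    case (elim x)
    have "(\<lambda>n. norm (Bstar (c (r n)) x - \<phi> x)) \<longlonglongrightarrow> 0"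
      using tendsto_real_sqrt[OF elim] by (simp add: norm_minus_commute)
    then have 1: "(\<lambda>n. Bstar (c (r n)) x) \<longlonglongrightarrow> \<phi> x"
      by (rule LIM_zero_cancel[OF tendsto_norm_zero_cancel])
    show ?case
    proof
      assume int: "integrable \<gamma> (\<lambda>Z. cnj (k (p Z) x) * ?f Z)"
      have "(\<lambda>n. Bstar (c n) x) \<longlonglongrightarrow> Bstar ?f x"
        unfolding Bstar_def
      proof (rule integral_dominated_convergence)
        show "integrable \<gamma> (\<lambda>Z. norm (cnj (k (p Z) x) * ?f Z))" using int by (rule integrable_norm)
        show "AE Z in \<gamma>. (\<lambda>n. cnj (k (p Z) x) * c n Z) \<longlonglongrightarrow> cnj (k (p Z) x) * ?f Z"
        proof (rule AE_I2)
          fix Z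
          have "\<forall>\<^sub>F n in sequentially. c n Z = ?f Z"
            using eventually_ge_at_top[of "nat \<lceil>norm Z\<rceil>"]
            by eventually_elim (simp add: c_def cutoff_def indicator_def nat_ceiling_le_eq)
          then show "(\<lambda>n. cnj (k (p Z) x) * c n Z) \<longlonglongrightarrow> cnj (k (p Z) x) * ?f Z"
            by (intro tendsto_eventually) (auto elim: eventually_mono)
        qed
        show "AE Z in \<gamma>. norm (cnj (k (p Z) x) * c n Z) \<le> norm (cnj (k (p Z) x) * ?f Z)" for n
          unfolding norm_mult c_def by (intro AE_I2 mult_left_mono cmod_cutoff_le norm_ge_zero)
      qed measurable
      from LIMSEQ_subseq_LIMSEQ[OF this r] have "(\<lambda>n. Bstar (c (r n)) x) \<longlonglongrightarrow> Bstar ?f x"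
        unfolding comp_def .
      with 1 show "\<phi> x = Bstar ?f x" by (rule LIMSEQ_unique)
    qed
  qed
qed

end

section \<open>Bicomplex holomorphic functions\<close>

text \<open>The increments \<open>(a, b)\<close> avoid both axes, so no continuity in \<open>\<beta>\<close> is given directly.  The existence of
  the limit bounds \<open>\<Phi>(\<alpha> + a, \<beta> + b) - \<Phi>(\<alpha>, \<beta>)\<close> by a multiple of \<open>|a|\<close>, uniformly in small \<open>b\<close>.  Comparing
  one value of \<open>\<Phi>\<close> at first coordinate \<open>\<alpha> + a\<close> with the two base points \<open>(\<alpha>, \<beta>)\<close> and \<open>(\<alpha>, \<beta> + b)\<close> and letting
  \<open>a\<close> tend to \<open>0\<close> shows that \<open>\<Phi>(\<alpha>, -)\<close> is locally constant.\<close>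

lemma entire_of_partial_quotient:
  fixes \<Phi> :: "complex \<Rightarrow> complex \<Rightarrow> complex"
  assumes lim: "\<And>\<alpha> \<beta>. \<exists>l. ((\<lambda>h. (\<Phi> (\<alpha> + fst h) (\<beta> + snd h) - \<Phi> \<alpha> \<beta>) / fst h) \<longlongrightarrow> l)
      (at 0 within {h. fst h \<noteq> 0 \<and> snd h \<noteq> 0})"
  obtains F where "F holomorphic_on UNIV" "\<And>\<alpha> \<beta>. \<Phi> \<alpha> \<beta> = F \<alpha>"
proof -
  have lim: "\<exists>l. \<forall>\<epsilon>>0. \<exists>\<delta>>0. \<forall>a b. a \<noteq> 0 \<and> b \<noteq> 0 \<and> cmod a < \<delta> \<and> cmod b < \<delta> \<longrightarrow>
      cmod ((\<Phi> (\<alpha> + a) (\<beta> + b) - \<Phi> \<alpha> \<beta>) / a - l) < \<epsilon>" for \<alpha> \<beta>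
  proof -
    obtain l where l: "((\<lambda>h. (\<Phi> (\<alpha> + fst h) (\<beta> + snd h) - \<Phi> \<alpha> \<beta>) / fst h) \<longlongrightarrow> l)
        (at 0 within {h. fst h \<noteq> 0 \<and> snd h \<noteq> 0})"
      using lim by blast
    show ?thesis
    proof (rule exI[of _ l], intro allI impI)
      fix \<epsilon> :: real assume "\<epsilon> > 0"
      from tendstoD[OF l this] obtain d where d: "d > 0" "\<And>h. fst h \<noteq> 0 \<Longrightarrow> snd h \<noteq> 0 \<Longrightarrow> h \<noteq> 0 \<Longrightarrow> dist h 0 < d \<Longrightarrow>
          dist ((\<Phi> (\<alpha> + fst h) (\<beta> + snd h) - \<Phi> \<alpha> \<beta>) / fst h) l < \<epsilon>"
        unfolding eventually_at by blast
      have "cmod ((\<Phi> (\<alpha> + a) (\<beta> + b) - \<Phi> \<alpha> \<beta>) / a - l) < \<epsilon>"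
        if "a \<noteq> 0" "b \<noteq> 0" "cmod a < d / 2" "cmod b < d / 2" for a b
      proof -
        have "norm (a, b) < d" using norm_Pair_le[of a b] that(3,4) by linarith
        then show ?thesis using d(2)[of "(a, b)"] that(1,2) by (simp add: dist_norm zero_prod_def)
      qed
      then show "\<exists>\<delta>>0. \<forall>a b. a \<noteq> 0 \<and> b \<noteq> 0 \<and> cmod a < \<delta> \<and> cmod b < \<delta> \<longrightarrow>
          cmod ((\<Phi> (\<alpha> + a) (\<beta> + b) - \<Phi> \<alpha> \<beta>) / a - l) < \<epsilon>"
        using d(1) by (intro exI[of _ "d / 2"]) auto
    qed
  qed
  have bound: "\<exists>C \<delta>. \<delta> > 0 \<and> (\<forall>a b. a \<noteq> 0 \<and> b \<noteq> 0 \<and> cmod a < \<delta> \<and> cmod b < \<delta> \<longrightarrow>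
      cmod (\<Phi> (\<alpha> + a) (\<beta> + b) - \<Phi> \<alpha> \<beta>) \<le> C * cmod a)" for \<alpha> \<beta>
  proof -
    obtain l where "\<forall>\<epsilon>>0. \<exists>\<delta>>0. \<forall>a b. a \<noteq> 0 \<and> b \<noteq> 0 \<and> cmod a < \<delta> \<and> cmod b < \<delta> \<longrightarrow>
      cmod ((\<Phi> (\<alpha> + a) (\<beta> + b) - \<Phi> \<alpha> \<beta>) / a - l) < \<epsilon>"
      using lim by blast
    from this[rule_format, of 1] obtain \<delta> where \<delta>: "\<delta> > 0" "\<And>a b. a \<noteq> 0 \<Longrightarrow> b \<noteq> 0 \<Longrightarrow> cmod a < \<delta> \<Longrightarrow> cmod b < \<delta> \<Longrightarrow>
      cmod ((\<Phi> (\<alpha> + a) (\<beta> + b) - \<Phi> \<alpha> \<beta>) / a - l) < 1"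
      by auto
    have "cmod (\<Phi> (\<alpha> + a) (\<beta> + b) - \<Phi> \<alpha> \<beta>) \<le> (cmod l + 1) * cmod a"
      if "a \<noteq> 0" "b \<noteq> 0" "cmod a < \<delta>" "cmod b < \<delta>" for a b
    proof -
      let ?q = "(\<Phi> (\<alpha> + a) (\<beta> + b) - \<Phi> \<alpha> \<beta>) / a"
      have "cmod ?q \<le> cmod l + 1"
        using norm_triangle_ineq2[of ?q l] \<delta>(2)[OF that] by linarith
      then show ?thesis using that(1) by (simp add: norm_divide divide_le_eq)
    qed
    then show ?thesis using \<delta>(1) by blast
  qed
  have loc: "\<exists>\<delta>>0. \<forall>b. cmod b < \<delta> \<longrightarrow> \<Phi> \<alpha> (\<beta> + b) = \<Phi> \<alpha> \<beta>" for \<alpha> \<beta>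
  proof -
    obtain C \<delta> where \<delta>: "\<delta> > 0" "\<And>a b. a \<noteq> 0 \<Longrightarrow> b \<noteq> 0 \<Longrightarrow> cmod a < \<delta> \<Longrightarrow> cmod b < \<delta> \<Longrightarrow>
      cmod (\<Phi> (\<alpha> + a) (\<beta> + b) - \<Phi> \<alpha> \<beta>) \<le> C * cmod a"
      using bound[of \<alpha> \<beta>] by blast
    have "\<Phi> \<alpha> (\<beta> + b) = \<Phi> \<alpha> \<beta>" if b: "cmod b < \<delta>" for b
    proof (cases "b = 0")
      case False
      obtain C' \<delta>' where \<delta>': "\<delta>' > 0" "\<And>a b'. a \<noteq> 0 \<Longrightarrow> b' \<noteq> 0 \<Longrightarrow> cmod a < \<delta>' \<Longrightarrow> cmod b' < \<delta>' \<Longrightarrow>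
        cmod (\<Phi> (\<alpha> + a) (\<beta> + b + b') - \<Phi> \<alpha> (\<beta> + b)) \<le> C' * cmod a"
        using bound[of \<alpha> "\<beta> + b"] by blast
      (* a further increment t b, small enough to stay in both neighbourhoods and a multiple of b so that
         b + t b does not vanish *)
      define t where "t = min ((\<delta> - cmod b) / (2 * cmod b)) (\<delta>' / (2 * cmod b))"
      have t: "t > 0" using False b \<delta>'(1) by (simp add: t_def)
      have tb: "t * cmod b < \<delta> - cmod b" "t * cmod b < \<delta>'"
      proof -
        have "t * cmod b \<le> (\<delta> - cmod b) / (2 * cmod b) * cmod b" "t * cmod b \<le> \<delta>' / (2 * cmod b) * cmod b"
          by (intro mult_right_mono; simp add: t_def)+
        then show "t * cmod b < \<delta> - cmod b" "t * cmod b < \<delta>'" using False b \<delta>'(1) by auto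
      qed
      let ?b' = "of_real t * b"
      have b': "?b' \<noteq> 0" "cmod ?b' < \<delta>'" using t tb False by (simp_all add: norm_mult)
      have "b + ?b' = of_real (1 + t) * b" by (simp add: algebra_simps)
      then have "cmod (b + ?b') = (1 + t) * cmod b" "b + ?b' \<noteq> 0"
        using t False by (simp_all only: norm_mult norm_of_real mult_eq_0_iff of_real_eq_0_iff) auto
      then have bb: "b + ?b' \<noteq> 0" "cmod (b + ?b') < \<delta>" using tb by (auto simp: algebra_simps)
      define K where "K = \<bar>C\<bar> + \<bar>C'\<bar> + 1"
      have small: "cmod (\<Phi> \<alpha> (\<beta> + b) - \<Phi> \<alpha> \<beta>) \<le> K * e" if e: "0 < e" "e < \<delta>" "e < \<delta>'" for e
      proof -
        let ?a = "complex_of_real e"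
        let ?X = "\<Phi> (\<alpha> + ?a) (\<beta> + (b + ?b'))"
        have 1: "cmod (?X - \<Phi> \<alpha> \<beta>) \<le> C * e"
          using \<delta>(2)[of ?a "b + ?b'"] e bb by simp
        have 2: "cmod (?X - \<Phi> \<alpha> (\<beta> + b)) \<le> C' * e"
          using \<delta>'(2)[of ?a ?b'] e b' by (simp add: add.assoc)
        have "cmod (\<Phi> \<alpha> (\<beta> + b) - \<Phi> \<alpha> \<beta>) \<le> cmod (?X - \<Phi> \<alpha> \<beta>) + cmod (?X - \<Phi> \<alpha> (\<beta> + b))"
          using norm_triangle_ineq4[of "?X - \<Phi> \<alpha> \<beta>" "?X - \<Phi> \<alpha> (\<beta> + b)"] by simp
        also have "\<dots> \<le> C * e + C' * e" using 1 2 by linarith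
        also have "\<dots> \<le> K * e"
          unfolding K_def distrib_right[symmetric] using e(1) by (intro mult_right_mono) auto
        finally show ?thesis .
      qed
      have "cmod (\<Phi> \<alpha> (\<beta> + b) - \<Phi> \<alpha> \<beta>) \<le> 0"
      proof (rule field_le_epsilon)
        fix \<epsilon> :: real assume \<epsilon>: "\<epsilon> > 0"
        have K: "K > 0" by (simp add: K_def)
        define e where "e = min (min (\<delta> / 2) (\<delta>' / 2)) (\<epsilon> / K)"
        have e: "0 < e" "e < \<delta>" "e < \<delta>'" "e \<le> \<epsilon> / K"
          using \<delta>(1) \<delta>'(1) \<epsilon> K by (auto simp: e_def)
        have "K * e \<le> \<epsilon>" using e(4) K by (simp add: field_simps)
        then show "cmod (\<Phi> \<alpha> (\<beta> + b) - \<Phi> \<alpha> \<beta>) \<le> 0 + \<epsilon>" using small[OF e(1-3)] by simp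
      qed
      then show ?thesis by simp
    qed simp
    then show ?thesis using \<delta>(1) by blast
  qed
  have const: "\<Phi> \<alpha> \<beta> = \<Phi> \<alpha> 0" for \<alpha> \<beta>
  proof (rule connected_local_const[of UNIV \<beta> 0 "\<Phi> \<alpha>"])
    show "\<forall>\<beta>\<in>UNIV. \<forall>\<^sub>F w in at \<beta> within UNIV. \<Phi> \<alpha> \<beta> = \<Phi> \<alpha> w"
    proof
      fix \<beta>
      obtain \<delta> where \<delta>: "\<delta> > 0" "\<And>b. cmod b < \<delta> \<Longrightarrow> \<Phi> \<alpha> (\<beta> + b) = \<Phi> \<alpha> \<beta>"
        using loc by blast
      have "\<Phi> \<alpha> \<beta> = \<Phi> \<alpha> w" if "dist w \<beta> < \<delta>" for w
        using \<delta>(2)[of "w - \<beta>"] that by (simp add: dist_norm)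
      then show "\<forall>\<^sub>F w in at \<beta>. \<Phi> \<alpha> \<beta> = \<Phi> \<alpha> w"
        using \<delta>(1) by (auto simp: eventually_at)
    qed
  qed auto
  have "\<exists>l. ((\<lambda>\<alpha>. \<Phi> \<alpha> 0) has_field_derivative l) (at \<alpha>)" for \<alpha>
  proof -
    obtain l where l: "\<And>\<epsilon>. \<epsilon> > 0 \<Longrightarrow> \<exists>\<delta>>0. \<forall>a b. a \<noteq> 0 \<and> b \<noteq> 0 \<and> cmod a < \<delta> \<and> cmod b < \<delta> \<longrightarrow>
      cmod ((\<Phi> (\<alpha> + a) (0 + b) - \<Phi> \<alpha> 0) / a - l) < \<epsilon>"
      using lim[of \<alpha> 0] by blast
    have "((\<lambda>a. (\<Phi> (\<alpha> + a) 0 - \<Phi> \<alpha> 0) / a) \<longlongrightarrow> l) (at 0)"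
      unfolding LIM_def
    proof (intro allI impI)
      fix \<epsilon> :: real assume "\<epsilon> > 0"
      then obtain \<delta> where \<delta>: "\<delta> > 0" "\<And>a b. a \<noteq> 0 \<Longrightarrow> b \<noteq> 0 \<Longrightarrow> cmod a < \<delta> \<Longrightarrow> cmod b < \<delta> \<Longrightarrow>
        cmod ((\<Phi> (\<alpha> + a) (0 + b) - \<Phi> \<alpha> 0) / a - l) < \<epsilon>"
        using l by metis
      have "dist ((\<Phi> (\<alpha> + a) 0 - \<Phi> \<alpha> 0) / a) l < \<epsilon>" if "a \<noteq> 0" "dist a 0 < \<delta>" for a
        using \<delta>(2)[of a "of_real (\<delta> / 2)"] that \<delta>(1) const[of "\<alpha> + a" "of_real (\<delta> / 2)"]
        by (simp add: dist_norm)
      then show "\<exists>\<delta>>0. \<forall>a. a \<noteq> 0 \<and> dist a 0 < \<delta> \<longrightarrow> dist ((\<Phi> (\<alpha> + a) 0 - \<Phi> \<alpha> 0) / a) l < \<epsilon>"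
        using \<delta>(1) by blast
    qed
    then show ?thesis by (auto simp: DERIV_def)
  qed
  then have "(\<lambda>\<alpha>. \<Phi> \<alpha> 0) holomorphic_on UNIV"
    by (simp add: holomorphic_on_def field_differentiable_def)
  then show ?thesis using that const by blast
qed

lemma idem_linear [simp]:
  "idem_plus (Z + W) = idem_plus Z + idem_plus W" "idem_minus (Z + W) = idem_minus Z + idem_minus W"
  "idem_plus (Z - W) = idem_plus Z - idem_plus W" "idem_minus (Z - W) = idem_minus Z - idem_minus W"
  "idem_plus (r *\<^sub>R Z) = of_real r * idem_plus Z" "idem_minus (r *\<^sub>R Z) = of_real r * idem_minus Z"
  "idem_plus 0 = 0" "idem_minus 0 = 0"
  by (simp_all add: idem_plus_def idem_minus_def algebra_simps scaleR_conv_of_real)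

lemma idem_bc [simp]:
  "idem_plus (bc_of_real r) = of_real r" "idem_minus (bc_of_real r) = of_real r"
  "idem_plus (bc_star Z) = cnj (idem_plus Z)" "idem_minus (bc_star Z) = cnj (idem_minus Z)"
  "idem_plus (bc_exp Z) = exp (idem_plus Z)" "idem_minus (bc_exp Z) = exp (idem_minus Z)"
  "idem_plus (bc_inverse Z) = inverse (idem_plus Z)" "idem_minus (bc_inverse Z) = inverse (idem_minus Z)"
  by (simp_all add: bc_star_def bc_exp_def bc_inverse_def)
     (simp_all add: bc_of_real_def bc_of_complex_def idem_plus_def idem_minus_def)

lemma bicomplex_eqI: "idem_plus Z = idem_plus W \<Longrightarrow> idem_minus Z = idem_minus W \<Longrightarrow> Z = W"
  by (metis of_idem_idem)

lemma of_idem_eq: "of_idem \<alpha> \<beta> = ((\<alpha> + \<beta>) / 2, \<i> * (\<alpha> - \<beta>) / 2)"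
  by (simp add: of_idem_def bc_of_complex_def bc_times_def e_plus_def e_minus_def field_simps)

lemma bounded_linear_idem: "bounded_linear idem_plus" "bounded_linear idem_minus"
proof -
  have "bounded_linear (\<lambda>Z. fst Z - \<i> * snd Z)" "bounded_linear (\<lambda>Z. fst Z + \<i> * snd Z)"
    by (intro bounded_linear_sub bounded_linear_add bounded_linear_fst bounded_linear_snd
        bounded_linear_compose[OF bounded_linear_mult_right])+
  then show "bounded_linear idem_plus" "bounded_linear idem_minus"
    by (simp_all add: idem_plus_def[abs_def] idem_minus_def[abs_def])
qed

lemma bounded_linear_of_idem: "bounded_linear (\<lambda>a. of_idem a 0)" "bounded_linear (\<lambda>b. of_idem 0 b)"
  unfolding of_idem_eq
  by (intro bounded_linear_Pair bounded_linear_compose[OF bounded_linear_divide]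
      bounded_linear_compose[OF bounded_linear_mult_right]; simp add: bounded_linear_minus bounded_linear_ident)+

lemma of_idem_split: "of_idem a b = of_idem a 0 + of_idem 0 b"
  by (rule bicomplex_eqI) simp_all

lemma integrable_idem_iff:
  "integrable M f \<longleftrightarrow> integrable M (\<lambda>x. idem_plus (f x)) \<and> integrable M (\<lambda>x. idem_minus (f x))"
proof
  assume "integrable M f"
  then show "integrable M (\<lambda>x. idem_plus (f x)) \<and> integrable M (\<lambda>x. idem_minus (f x))"
    by (auto intro: integrable_bounded_linear bounded_linear_idem)
next
  assume "integrable M (\<lambda>x. idem_plus (f x)) \<and> integrable M (\<lambda>x. idem_minus (f x))"
  then have "integrable M (\<lambda>x. of_idem (idem_plus (f x)) 0 + of_idem 0 (idem_minus (f x)))"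
    by (intro Bochner_Integration.integrable_add; elim conjE)
       (rule integrable_bounded_linear[OF bounded_linear_of_idem(1)] integrable_bounded_linear[OF bounded_linear_of_idem(2)], assumption)+
  then show "integrable M f" by (simp add: of_idem_split[symmetric])
qed

lemma idem_integral:
  assumes "integrable M f"
  shows "idem_plus (integral\<^sup>L M f) = (LINT x|M. idem_plus (f x))"
    "idem_minus (integral\<^sup>L M f) = (LINT x|M. idem_minus (f x))"
  using assms by (simp_all add: integral_bounded_linear[OF bounded_linear_idem(1)]
      integral_bounded_linear[OF bounded_linear_idem(2)])

lemma measurable_idem [measurable]:
  "idem_plus \<in> borel_measurable borel" "idem_minus \<in> borel_measurable borel"
  by (intro borel_measurable_continuous_onI linear_continuous_on bounded_linear_idem)+

lemma borel_measurable_idem_iff: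
  "f \<in> borel_measurable M \<longleftrightarrow>
    (\<lambda>x. idem_plus (f x)) \<in> borel_measurable M \<and> (\<lambda>x. idem_minus (f x)) \<in> borel_measurable M"
proof
  assume "f \<in> borel_measurable M"
  then show "(\<lambda>x. idem_plus (f x)) \<in> borel_measurable M \<and> (\<lambda>x. idem_minus (f x)) \<in> borel_measurable M"
    by auto
next
  assume *: "(\<lambda>x. idem_plus (f x)) \<in> borel_measurable M \<and> (\<lambda>x. idem_minus (f x)) \<in> borel_measurable M"
  have m: "(\<lambda>a. of_idem a 0) \<in> borel_measurable borel" "(\<lambda>b. of_idem 0 b) \<in> borel_measurable borel"
    by (intro borel_measurable_continuous_onI linear_continuous_on bounded_linear_of_idem)+
  have "(\<lambda>x. of_idem (idem_plus (f x)) 0 + of_idem 0 (idem_minus (f x))) \<in> borel_measurable M"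
  proof (rule borel_measurable_add)
    show "(\<lambda>x. of_idem (idem_plus (f x)) 0) \<in> borel_measurable M"
      by (rule measurable_compose[OF conjunct1[OF *] m(1)])
    show "(\<lambda>x. of_idem 0 (idem_minus (f x))) \<in> borel_measurable M"
      by (rule measurable_compose[OF conjunct2[OF *] m(2)])
  qed
  then show "f \<in> borel_measurable M" by (simp add: of_idem_split[symmetric])
qed

text \<open>In idempotent coordinates the difference quotient is taken componentwise, and \<open>H\<close> lies outside the null
  cone exactly if both components of \<open>H\<close> are nonzero.\<close>

lemma bc_holomorphic_iff:
  "bc_holomorphic f \<longleftrightarrow> (\<exists>F G. F holomorphic_on UNIV \<and> G holomorphic_on UNIV \<and>
     f = (\<lambda>Z. of_idem (F (idem_plus Z)) (G (idem_minus Z))))"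
proof
  assume f: "bc_holomorphic f"
  let ?S = "{h :: complex \<times> complex. fst h \<noteq> 0 \<and> snd h \<noteq> 0}"
  have fl: "filterlim (\<lambda>h. of_idem (fst h) (snd h)) (at 0 within - null_cone) (at 0 within ?S)"
    "filterlim (\<lambda>h. of_idem (snd h) (fst h)) (at 0 within - null_cone) (at 0 within ?S)"
  proof -
    have "isCont (\<lambda>h. of_idem (fst h) (snd h)) 0" "isCont (\<lambda>h. of_idem (snd h) (fst h)) 0"
      unfolding of_idem_eq by (intro continuous_intros; simp)+
    then have t: "((\<lambda>h. of_idem (fst h) (snd h)) \<longlongrightarrow> 0) (at 0 within ?S)"
      "((\<lambda>h. of_idem (snd h) (fst h)) \<longlongrightarrow> 0) (at 0 within ?S)"
      unfolding isCont_def by (auto simp: of_idem_eq zero_prod_def intro: tendsto_within_subset)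
    have z: "of_idem a b \<in> - null_cone" "of_idem a b \<noteq> 0" if "a \<noteq> 0" "b \<noteq> 0" for a b
    proof -
      show nc: "of_idem a b \<in> - null_cone" using that by (simp add: null_cone_def)
      show "of_idem a b \<noteq> 0"
      proof
        assume "of_idem a b = 0"
        then have "idem_plus (of_idem a b) = idem_plus 0" by (rule arg_cong)
        then show False using that by simp
      qed
    qed
    show "filterlim (\<lambda>h. of_idem (fst h) (snd h)) (at 0 within - null_cone) (at 0 within ?S)"
      "filterlim (\<lambda>h. of_idem (snd h) (fst h)) (at 0 within - null_cone) (at 0 within ?S)"
      unfolding filterlim_at eventually_at_filter using t z by (auto intro!: always_eventually)
  qed
  have quot: "of_idem \<alpha> \<beta> + of_idem a b = of_idem (\<alpha> + a) (\<beta> + b)" for \<alpha> \<beta> a b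
    by (rule bicomplex_eqI) simp_all
  have lim: "\<exists>L. ((\<lambda>H. (f (of_idem \<alpha> \<beta> + H) - f (of_idem \<alpha> \<beta>)) *\<^sub>T bc_inverse H) \<longlongrightarrow> L) (at 0 within - null_cone)" for \<alpha> \<beta>
    using f unfolding bc_holomorphic_def by blast
  obtain F where F: "F holomorphic_on UNIV" "\<And>\<alpha> \<beta>. idem_plus (f (of_idem \<alpha> \<beta>)) = F \<alpha>"
  proof (rule entire_of_partial_quotient[of "\<lambda>\<alpha> \<beta>. idem_plus (f (of_idem \<alpha> \<beta>))"])
    fix \<alpha> \<beta>
    obtain L where L: "((\<lambda>H. (f (of_idem \<alpha> \<beta> + H) - f (of_idem \<alpha> \<beta>)) *\<^sub>T bc_inverse H) \<longlongrightarrow> L) (at 0 within - null_cone)"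
      using lim by blast
    from bounded_linear.tendsto[OF bounded_linear_idem(1) filterlim_compose[OF L fl(1)]]
    show "\<exists>l. ((\<lambda>h. (idem_plus (f (of_idem (\<alpha> + fst h) (\<beta> + snd h))) - idem_plus (f (of_idem \<alpha> \<beta>))) / fst h) \<longlongrightarrow> l) (at 0 within ?S)"
      by (intro exI[of _ "idem_plus L"]) (simp add: quot divide_inverse)
  qed blast
  obtain G where G: "G holomorphic_on UNIV" "\<And>\<beta> \<alpha>. idem_minus (f (of_idem \<alpha> \<beta>)) = G \<beta>"
  proof (rule entire_of_partial_quotient[of "\<lambda>\<beta> \<alpha>. idem_minus (f (of_idem \<alpha> \<beta>))"])
    fix \<beta> \<alpha>
    obtain L where L: "((\<lambda>H. (f (of_idem \<alpha> \<beta> + H) - f (of_idem \<alpha> \<beta>)) *\<^sub>T bc_inverse H) \<longlongrightarrow> L) (at 0 within - null_cone)"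
      using lim by blast
    from bounded_linear.tendsto[OF bounded_linear_idem(2) filterlim_compose[OF L fl(2)]]
    show "\<exists>l. ((\<lambda>h. (idem_minus (f (of_idem (\<alpha> + snd h) (\<beta> + fst h))) - idem_minus (f (of_idem \<alpha> \<beta>))) / fst h) \<longlongrightarrow> l) (at 0 within ?S)"
      by (intro exI[of _ "idem_minus L"]) (simp add: quot divide_inverse)
  qed blast
  have "f Z = of_idem (F (idem_plus Z)) (G (idem_minus Z))" for Z
    using F(2)[of "idem_plus Z" "idem_minus Z"] G(2)[of "idem_plus Z" "idem_minus Z"]
    by (intro bicomplex_eqI) simp_all
  then show "\<exists>F G. F holomorphic_on UNIV \<and> G holomorphic_on UNIV \<and>
     f = (\<lambda>Z. of_idem (F (idem_plus Z)) (G (idem_minus Z)))"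
    using F(1) G(1) by blast
next
  assume "\<exists>F G. F holomorphic_on UNIV \<and> G holomorphic_on UNIV \<and>
     f = (\<lambda>Z. of_idem (F (idem_plus Z)) (G (idem_minus Z)))"
  then obtain F G where F: "F holomorphic_on UNIV" and G: "G holomorphic_on UNIV"
    and f: "f = (\<lambda>Z. of_idem (F (idem_plus Z)) (G (idem_minus Z)))" by blast
  have q: "\<exists>l. ((\<lambda>H. (F' (p Z + p H) - F' (p Z)) / p H) \<longlongrightarrow> l) (at 0 within - null_cone)"
    if F': "F' holomorphic_on UNIV" and p: "p = idem_plus \<or> p = idem_minus" for F' p and Z :: bicomplex
  proof -
    obtain l where l: "((\<lambda>h. (F' (p Z + h) - F' (p Z)) / h) \<longlongrightarrow> l) (at 0)"
      using F' by (auto simp: holomorphic_on_def field_differentiable_def DERIV_def)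
    have "bounded_linear p" using p bounded_linear_idem by metis
    then have "(p \<longlongrightarrow> p 0) (at 0 within - null_cone)"
      by (rule bounded_linear.tendsto[OF _ tendsto_ident_at])
    moreover have "\<forall>\<^sub>F H in at 0 within - null_cone. p H \<noteq> 0"
      using p by (auto simp: eventually_at_filter null_cone_def)
    ultimately have "filterlim p (at 0) (at 0 within - null_cone)"
      using p by (auto simp: filterlim_at)
    from filterlim_compose[OF l this] show ?thesis by blast
  qed
  show "bc_holomorphic f"
    unfolding bc_holomorphic_def
  proof
    fix Z
    obtain l m where l: "((\<lambda>H. (F (idem_plus Z + idem_plus H) - F (idem_plus Z)) / idem_plus H) \<longlongrightarrow> l) (at 0 within - null_cone)"
      and m: "((\<lambda>H. (G (idem_minus Z + idem_minus H) - G (idem_minus Z)) / idem_minus H) \<longlongrightarrow> m) (at 0 within - null_cone)"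
      using q[OF F, of idem_plus Z] q[OF G, of idem_minus Z] by blast
    have eq: "(f (Z + H) - f Z) *\<^sub>T bc_inverse H =
        of_idem ((F (idem_plus Z + idem_plus H) - F (idem_plus Z)) / idem_plus H) 0 +
        of_idem 0 ((G (idem_minus Z + idem_minus H) - G (idem_minus Z)) / idem_minus H)" for H
      unfolding of_idem_split[symmetric] by (rule bicomplex_eqI) (simp_all add: f divide_inverse)
    show "\<exists>L. ((\<lambda>H. (f (Z + H) - f Z) *\<^sub>T bc_inverse H) \<longlongrightarrow> L) (at 0 within - null_cone)"
      unfolding eq
      by (rule exI, rule tendsto_add[OF bounded_linear.tendsto[OF bounded_linear_of_idem(1) l]
            bounded_linear.tendsto[OF bounded_linear_of_idem(2) m]])
  qed
qed

section \<open>Assembling the components\<close>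

lemma bargmann_component_idem:
  assumes "\<sigma> > 0" "\<nu> > 0"
  shows "bargmann_component idem_plus \<nu> \<sigma>" "bargmann_component idem_minus \<nu> \<sigma>"
  using assms by unfold_locales auto

abbreviation plus_part :: "('a \<Rightarrow> bicomplex) \<Rightarrow> 'a \<Rightarrow> complex" where "plus_part f \<equiv> \<lambda>x. idem_plus (f x)"
abbreviation minus_part :: "('a \<Rightarrow> bicomplex) \<Rightarrow> 'a \<Rightarrow> complex" where "minus_part f \<equiv> \<lambda>x. idem_minus (f x)"

lemma L2_gauss_iff:
  assumes c: "c > 0"
  shows "f \<in> L2 (gauss c) \<longleftrightarrow> f \<in> borel_measurable borel \<and>
    integrable lborel (\<lambda>x. (cmod (f x))\<^sup>2 * exp (- c * (norm x)\<^sup>2))"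
proof (cases "f \<in> borel_measurable borel")
  case True
  then have [measurable]: "f \<in> borel_measurable borel" .
  show ?thesis
    using True by (simp add: L2_def integrable_gauss_iff[OF c] mult.commute)
qed (auto simp: L2_def)

lemma L2T_iff:
  assumes "\<sigma> > 0"
  shows "\<phi> \<in> L2T \<sigma> \<longleftrightarrow> plus_part \<phi> \<in> L2 (gauss \<sigma>) \<and> minus_part \<phi> \<in> L2 (gauss \<sigma>)"
  unfolding L2T_def L2_gauss_iff[OF assms] using borel_measurable_idem_iff[of \<phi> borel] by auto

lemma integrable_gauss_inner_iff:
  fixes f :: "'a::euclidean_space \<Rightarrow> bicomplex"
  assumes c: "c > 0" and f: "f \<in> borel_measurable borel"
  shows "integrable lborel (\<lambda>x. exp (- c * (norm x)\<^sup>2) *\<^sub>R (f x *\<^sub>T bc_star (f x))) \<longleftrightarrow>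
    plus_part f \<in> L2 (gauss c) \<and> minus_part f \<in> L2 (gauss c)"
proof -
  have *: "integrable lborel (\<lambda>x. complex_of_real (exp (- c * (norm x)\<^sup>2)) * (g x * cnj (g x))) \<longleftrightarrow>
      g \<in> L2 (gauss c)" if "g \<in> borel_measurable borel" for g :: "'a \<Rightarrow> complex"
  proof -
    have "complex_of_real (exp (- c * (norm x)\<^sup>2)) * (g x * cnj (g x)) =
        complex_of_real ((cmod (g x))\<^sup>2 * exp (- c * (norm x)\<^sup>2))" for x
      unfolding of_real_mult complex_norm_square[symmetric] of_real_power by (rule mult.commute)
    then show ?thesis
      using that by (simp only: L2_gauss_iff[OF c] complex_of_real_integrable_eq) simp
  qed
  have "plus_part f \<in> borel_measurable borel" "minus_part f \<in> borel_measurable borel"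
    using f borel_measurable_idem_iff[of f borel] by auto
  then show ?thesis
    by (subst integrable_idem_iff) (simp only: idem_linear idem_times idem_bc *)
qed

lemma gauss_inner_idem:
  fixes f g :: "'a::euclidean_space \<Rightarrow> bicomplex"
  assumes c: "c > 0"
    and f: "plus_part f \<in> L2 (gauss c)" "minus_part f \<in> L2 (gauss c)"
    and g: "plus_part g \<in> L2 (gauss c)" "minus_part g \<in> L2 (gauss c)"
  shows "sqrt (c / pi) ^ DIM('a) *\<^sub>R (LINT x|lborel. exp (- c * (norm x)\<^sup>2) *\<^sub>R (f x *\<^sub>T bc_star (g x))) =
    of_idem (ip (gauss c) (plus_part f) (plus_part g)) (ip (gauss c) (minus_part f) (minus_part g))"
proof -
  let ?h = "\<lambda>x. f x *\<^sub>T bc_star (g x)"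
  have i: "integrable (gauss c) ?h"
    unfolding integrable_idem_iff[of _ ?h] by (simp add: ip_integrable f g)
  then have m: "?h \<in> borel_measurable borel"
    using borel_measurable_integrable[OF i] by simp
  have "idem_plus (integral\<^sup>L (gauss c) ?h) = ip (gauss c) (plus_part f) (plus_part g)"
    "idem_minus (integral\<^sup>L (gauss c) ?h) = ip (gauss c) (minus_part f) (minus_part g)"
    by (simp_all add: idem_integral[OF i] ip_def)
  then show ?thesis
    unfolding integral_gauss[OF c m, symmetric] by (intro bicomplex_eqI) simp_all
qed

lemma L2T_inner_idem:
  assumes "\<sigma> > 0" "\<phi> \<in> L2T \<sigma>" "\<psi> \<in> L2T \<sigma>"
  shows "L2T_inner \<sigma> \<phi> \<psi> =
    of_idem (ip (gauss \<sigma>) (plus_part \<phi>) (plus_part \<psi>)) (ip (gauss \<sigma>) (minus_part \<phi>) (minus_part \<psi>))"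
  using gauss_inner_idem[OF assms(1), of \<phi> \<psi>] assms(2,3) unfolding L2T_iff[OF assms(1)] L2T_inner_def by simp

lemma L2T_norm_idem:
  assumes "\<sigma> > 0" "\<phi> \<in> L2T \<sigma>"
  shows "L2T_norm \<sigma> \<phi> = sqrt ((sqnorm (gauss \<sigma>) (plus_part \<phi>) + sqnorm (gauss \<sigma>) (minus_part \<phi>)) / 2)"
  unfolding L2T_norm_def bc_induced_norm_def L2T_inner_idem[OF assms assms(2)] by (simp add: ip_self)

lemma H2T_iff:
  assumes "\<nu> > 0"
  shows "f \<in> H2T \<nu> \<longleftrightarrow> plus_part f \<in> L2 (gauss \<nu>) \<and> minus_part f \<in> L2 (gauss \<nu>)"
proof (cases "f \<in> borel_measurable borel")
  case True
  then show ?thesis by (simp only: H2T_def integrable_gauss_inner_iff[OF assms True] mem_Collect_eq) simp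
next
  case False
  then show ?thesis
    using borel_measurable_idem_iff[of f borel] by (auto simp: H2T_def L2_gauss_iff[OF assms])
qed

lemma gauss_bicomplex_factor:
  assumes \<nu>: "\<nu> > 0"
  shows "sqrt (\<nu> / pi) ^ DIM(bicomplex) = (\<nu> / pi)\<^sup>2"
proof -
  have "sqrt (\<nu> / pi) ^ DIM(bicomplex) = ((sqrt (\<nu> / pi))\<^sup>2)\<^sup>2"
    by (simp add: power2_eq_square power4_eq_xxxx mult.assoc)
  also have "\<dots> = (\<nu> / pi)\<^sup>2" using \<nu> by simp
  finally show ?thesis .
qed

lemma H2T_inner_idem:
  assumes \<nu>: "\<nu> > 0" and "f \<in> H2T \<nu>" "g \<in> H2T \<nu>"
  shows "H2T_inner \<nu> f g =
    of_idem (ip (gauss \<nu>) (plus_part f) (plus_part g)) (ip (gauss \<nu>) (minus_part f) (minus_part g))"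
  using gauss_inner_idem[OF \<nu>, of f g] assms
  unfolding H2T_iff[OF \<nu>] H2T_inner_def gauss_bicomplex_factor[OF \<nu>] by simp

lemma SB_idem:
  assumes \<sigma>: "\<sigma> > 0" and \<nu>: "\<nu> > 0" and \<phi>: "\<phi> \<in> L2T \<sigma>"
  shows "SB \<sigma> \<nu> \<phi> Z =
    of_idem (bargmann \<sigma> \<nu> (plus_part \<phi>) (idem_plus Z)) (bargmann \<sigma> \<nu> (minus_part \<phi>) (idem_minus Z))"
proof -
  interpret P: bargmann_component idem_plus \<nu> \<sigma> by (rule bargmann_component_idem[OF \<sigma> \<nu>])
  define s where "s = sqrt (\<nu> / (4 * \<sigma>))"
  define h where "h x = of_idem (sb_kernel \<sigma> \<nu> (idem_plus Z) x * idem_plus (\<phi> x))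
      (sb_kernel \<sigma> \<nu> (idem_minus Z) x * idem_minus (\<phi> x))" for x
  have s: "s\<^sup>2 = \<nu> / (4 * \<sigma>)" "2 * \<sigma> * s = sqrt (\<sigma> * \<nu>)"
  proof -
    show s2: "s\<^sup>2 = \<nu> / (4 * \<sigma>)" using \<sigma> \<nu> by (simp add: s_def)
    have "(2 * \<sigma> * s)\<^sup>2 = \<sigma> * \<nu>"
      unfolding power_mult_distrib s2 using \<sigma> by (simp add: power2_eq_square)
    then show "2 * \<sigma> * s = sqrt (\<sigma> * \<nu>)" using \<sigma> \<nu> by (intro real_sqrt_unique[symmetric]) (auto simp: s_def)
  qed
  have ker: "exp (- of_real \<sigma> * ((of_real x - of_real s * z) * (of_real x - of_real s * z))) =
      of_real (exp (- \<sigma> * (norm x)\<^sup>2)) * sb_kernel \<sigma> \<nu> z x" for z x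
  proof -
    have e1: "complex_of_real (sqrt (\<sigma> * \<nu>)) = 2 * of_real \<sigma> * of_real s"
      unfolding s(2)[symmetric] by simp
    have "complex_of_real (\<nu> / 4) = of_real (\<sigma> * s\<^sup>2)" unfolding s(1) using \<sigma> by simp
    then have e2: "complex_of_real (\<nu> / 4) = of_real \<sigma> * (of_real s)\<^sup>2" by simp
    have "- of_real \<sigma> * ((of_real x - of_real s * z) * (of_real x - of_real s * z)) =
      complex_of_real (- \<sigma> * (norm x)\<^sup>2) + (of_real (sqrt (\<sigma> * \<nu>) * x) * z - of_real (\<nu> / 4) * z\<^sup>2)"
      unfolding e2 of_real_mult e1 by (simp add: power2_eq_square algebra_simps flip: of_real_mult)
    then show ?thesis unfolding sb_kernel_def exp_of_real[symmetric] exp_add[symmetric] by (rule arg_cong)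
  qed
  have eq: "(let W = bc_of_real x - s *\<^sub>R Z in bc_exp (- \<sigma> *\<^sub>R (W *\<^sub>T W)) *\<^sub>T \<phi> x) =
      exp (- \<sigma> * (norm x)\<^sup>2) *\<^sub>R h x" for x
    by (rule bicomplex_eqI; simp only: Let_def h_def idem_times idem_bc idem_linear idem_of_idem of_real_minus ker mult.assoc)
  have i: "integrable (gauss \<sigma>) h"
    unfolding integrable_idem_iff[of _ h] using \<phi>
    by (simp add: h_def L2T_iff[OF \<sigma>] L2_mult_integrable P.kernel_L2)
  then have m: "h \<in> borel_measurable borel" using borel_measurable_integrable[OF i] by simp
  have "SB \<sigma> \<nu> \<phi> Z = integral\<^sup>L (gauss \<sigma>) h"
    unfolding SB_def s_def[symmetric] eq integral_gauss[OF \<sigma> m] by simp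
  also have "\<dots> = of_idem (bargmann \<sigma> \<nu> (plus_part \<phi>) (idem_plus Z)) (bargmann \<sigma> \<nu> (minus_part \<phi>) (idem_minus Z))"
    by (rule bicomplex_eqI) (simp_all add: idem_integral[OF i] h_def bargmann_def)
  finally show ?thesis .
qed

lemma F2T_iff:
  assumes \<nu>: "\<nu> > 0"
  shows "f \<in> F2T \<nu> \<longleftrightarrow> (\<exists>F G. F holomorphic_on UNIV \<and> G holomorphic_on UNIV \<and>
     (\<lambda>Z. F (idem_plus Z)) \<in> L2 (gauss \<nu>) \<and> (\<lambda>Z. G (idem_minus Z)) \<in> L2 (gauss \<nu>) \<and>
     f = (\<lambda>Z. of_idem (F (idem_plus Z)) (G (idem_minus Z))))"
  (is "_ \<longleftrightarrow> ?R")
proof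
  assume "f \<in> F2T \<nu>"
  then obtain F G where FG: "F holomorphic_on UNIV" "G holomorphic_on UNIV"
    and f: "f = (\<lambda>Z. of_idem (F (idem_plus Z)) (G (idem_minus Z)))" and "f \<in> H2T \<nu>"
    unfolding F2T_def bc_holomorphic_iff by blast
  then have "(\<lambda>Z. F (idem_plus Z)) \<in> L2 (gauss \<nu>)" "(\<lambda>Z. G (idem_minus Z)) \<in> L2 (gauss \<nu>)"
    by (simp_all add: H2T_iff[OF \<nu>])
  with FG f show ?R by blast
next
  assume ?R
  then obtain F G where FG: "F holomorphic_on UNIV" "G holomorphic_on UNIV"
    "(\<lambda>Z. F (idem_plus Z)) \<in> L2 (gauss \<nu>)" "(\<lambda>Z. G (idem_minus Z)) \<in> L2 (gauss \<nu>)"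
    and f: "f = (\<lambda>Z. of_idem (F (idem_plus Z)) (G (idem_minus Z)))" by blast
  then have "f \<in> H2T \<nu>" by (simp add: H2T_iff[OF \<nu>])
  with FG f show "f \<in> F2T \<nu>" unfolding F2T_def bc_holomorphic_iff by blast
qed

lemma SB_image:
  assumes \<sigma>: "\<sigma> > 0" and \<nu>: "\<nu> > 0"
  shows "SB \<sigma> \<nu> ` L2T \<sigma> = F2T \<nu>"
proof -
  interpret P: bargmann_component idem_plus \<nu> \<sigma> by (rule bargmann_component_idem[OF \<sigma> \<nu>])
  interpret M: bargmann_component idem_minus \<nu> \<sigma> by (rule bargmann_component_idem[OF \<sigma> \<nu>])
  show ?thesis
  proof (intro equalityI subsetI)
    fix f assume "f \<in> SB \<sigma> \<nu> ` L2T \<sigma>"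
    then obtain \<phi> where \<phi>: "\<phi> \<in> L2T \<sigma>" and f: "f = SB \<sigma> \<nu> \<phi>" by blast
    then have L: "plus_part \<phi> \<in> L2 (gauss \<sigma>)" "minus_part \<phi> \<in> L2 (gauss \<sigma>)" by (simp_all add: L2T_iff[OF \<sigma>])
    have "f = (\<lambda>Z. of_idem (bargmann \<sigma> \<nu> (plus_part \<phi>) (idem_plus Z)) (bargmann \<sigma> \<nu> (minus_part \<phi>) (idem_minus Z)))"
      unfolding f by (rule ext) (rule SB_idem[OF \<sigma> \<nu> \<phi>])
    then show "f \<in> F2T \<nu>"
      unfolding F2T_iff[OF \<nu>]
      using P.bargmann_entire[OF L(1)] M.bargmann_entire[OF L(2)] P.bargmann_L2[OF L(1)] M.bargmann_L2[OF L(2)]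
      by blast
  next
    fix f assume "f \<in> F2T \<nu>"
    then obtain F G where FG: "F holomorphic_on UNIV" "G holomorphic_on UNIV"
      "(\<lambda>Z. F (idem_plus Z)) \<in> L2 (gauss \<nu>)" "(\<lambda>Z. G (idem_minus Z)) \<in> L2 (gauss \<nu>)"
      and f: "f = (\<lambda>Z. of_idem (F (idem_plus Z)) (G (idem_minus Z)))"
      unfolding F2T_iff[OF \<nu>] by blast
    obtain \<phi> where \<phi>: "\<phi> \<in> L2 (gauss \<sigma>)" "bargmann \<sigma> \<nu> \<phi> = F" by (rule P.bargmann_surjective[OF FG(1,3)])
    obtain \<psi> where \<psi>: "\<psi> \<in> L2 (gauss \<sigma>)" "bargmann \<sigma> \<nu> \<psi> = G" by (rule M.bargmann_surjective[OF FG(2,4)])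
    define \<theta> where "\<theta> x = of_idem (\<phi> x) (\<psi> x)" for x
    have \<theta>: "\<theta> \<in> L2T \<sigma>" by (simp add: L2T_iff[OF \<sigma>] \<theta>_def \<phi> \<psi>)
    have "SB \<sigma> \<nu> \<theta> = f"
      unfolding f by (rule ext) (simp add: SB_idem[OF \<sigma> \<nu> \<theta>] \<theta>_def \<phi> \<psi>)
    then show "f \<in> SB \<sigma> \<nu> ` L2T \<sigma>" using \<theta> by blast
  qed
qed

lemma SB_inner:
  assumes \<sigma>: "\<sigma> > 0" and \<nu>: "\<nu> > 0" and \<phi>: "\<phi> \<in> L2T \<sigma>" and \<psi>: "\<psi> \<in> L2T \<sigma>"
  shows "H2T_inner \<nu> (SB \<sigma> \<nu> \<phi>) (SB \<sigma> \<nu> \<psi>) = L2T_inner \<sigma> \<phi> \<psi>"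
proof -
  interpret P: bargmann_component idem_plus \<nu> \<sigma> by (rule bargmann_component_idem[OF \<sigma> \<nu>])
  interpret M: bargmann_component idem_minus \<nu> \<sigma> by (rule bargmann_component_idem[OF \<sigma> \<nu>])
  have "SB \<sigma> \<nu> \<phi> \<in> H2T \<nu>" "SB \<sigma> \<nu> \<psi> \<in> H2T \<nu>"
    using SB_image[OF \<sigma> \<nu>] \<phi> \<psi> by (auto simp: F2T_def)
  then show ?thesis
    using \<phi> \<psi> unfolding L2T_iff[OF \<sigma>]
    by (simp add: H2T_inner_idem[OF \<nu>] L2T_inner_idem[OF \<sigma> \<phi> \<psi>] SB_idem[OF \<sigma> \<nu> \<phi>] SB_idem[OF \<sigma> \<nu> \<psi>]
        P.bargmann_isometry M.bargmann_isometry)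
qed

text \<open>The exponent of the inversion formula is the Gaussian weight times the conjugate of the transform's
  kernel.\<close>

lemma SB_inv_integrand_idem:
  "SB_inv_integrand \<sigma> \<nu> f x Z = exp (- \<nu> * (norm Z)\<^sup>2) *\<^sub>R
    of_idem (cnj (sb_kernel \<sigma> \<nu> (idem_plus Z) x) * idem_plus (f Z))
      (cnj (sb_kernel \<sigma> \<nu> (idem_minus Z) x) * idem_minus (f Z))"
proof -
  have ker: "exp (of_real (- \<nu> * (norm Z)\<^sup>2) - of_real (\<nu> / 4) * (cnj z * cnj z) + of_real (sqrt (\<sigma> * \<nu>) * x) * cnj z) =
      of_real (exp (- \<nu> * (norm Z)\<^sup>2)) * cnj (sb_kernel \<sigma> \<nu> z x)" for z
    unfolding sb_kernel_def exp_cnj exp_of_real[symmetric] exp_add[symmetric]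
    by (rule arg_cong[where f = exp]) (simp add: power2_eq_square)
  show ?thesis
    unfolding SB_inv_integrand_def
    by (rule bicomplex_eqI; simp only: idem_times idem_bc idem_linear idem_of_idem ker mult.assoc)
qed

lemma AE_gauss_iff:
  assumes "c > 0"
  shows "(AE x in gauss c. P x) \<longleftrightarrow> (AE x in lborel. P x)"
  unfolding gauss_def using assms by (subst AE_density) (auto simp: ennreal_eq_0_iff)

theorem theorem5p6:
  fixes \<sigma> \<nu> :: real
  assumes "\<sigma> > 0" and "\<nu> > 0"
  shows "SB \<sigma> \<nu> ` L2T \<sigma> = F2T \<nu> \<and>
    (\<forall>\<phi>\<in>L2T \<sigma>. \<forall>\<psi>\<in>L2T \<sigma>. H2T_inner \<nu> (SB \<sigma> \<nu> \<phi>) (SB \<sigma> \<nu> \<psi>) = L2T_inner \<sigma> \<phi> \<psi>) \<and>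
    (\<forall>f\<in>F2T \<nu>.
      (\<forall>x R. set_integrable lborel (cball 0 R) (SB_inv_integrand \<sigma> \<nu> f x)) \<and>
      (\<forall>R. (\<lambda>x. (\<nu> / pi)\<^sup>2 *\<^sub>R (LINT Z:cball 0 R|lborel. SB_inv_integrand \<sigma> \<nu> f x Z)) \<in> L2T \<sigma>) \<and>
      ((\<lambda>R. L2T_norm \<sigma> (\<lambda>x. SB_inv \<sigma> \<nu> f x -
          (\<nu> / pi)\<^sup>2 *\<^sub>R (LINT Z:cball 0 R|lborel. SB_inv_integrand \<sigma> \<nu> f x Z))) \<longlongrightarrow> 0) at_top \<and>
      (AE x in lborel. integrable lborel (SB_inv_integrand \<sigma> \<nu> f x) \<longrightarrow>
          SB_inv \<sigma> \<nu> f x = (\<nu> / pi)\<^sup>2 *\<^sub>R (LINT Z|lborel. SB_inv_integrand \<sigma> \<nu> f x Z)))"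
proof (intro conjI ballI)
  note \<sigma> = assms(1) and \<nu> = assms(2)
  interpret P: bargmann_component idem_plus \<nu> \<sigma> by (rule bargmann_component_idem[OF \<sigma> \<nu>])
  interpret M: bargmann_component idem_minus \<nu> \<sigma> by (rule bargmann_component_idem[OF \<sigma> \<nu>])
  show "SB \<sigma> \<nu> ` L2T \<sigma> = F2T \<nu>" by (rule SB_image[OF \<sigma> \<nu>])
  show "H2T_inner \<nu> (SB \<sigma> \<nu> \<phi>) (SB \<sigma> \<nu> \<psi>) = L2T_inner \<sigma> \<phi> \<psi>"
    if "\<phi> \<in> L2T \<sigma>" "\<psi> \<in> L2T \<sigma>" for \<phi> \<psi>
    by (rule SB_inner[OF \<sigma> \<nu> that])
  fix f assume f: "f \<in> F2T \<nu>"
  define \<phi> where "\<phi> = SB_inv \<sigma> \<nu> f"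
  have \<phi>: "\<phi> \<in> L2T \<sigma>" and f_eq: "f = SB \<sigma> \<nu> \<phi>"
    using f unfolding \<phi>_def SB_inv_def SB_image[OF \<sigma> \<nu>, symmetric]
    by (simp_all add: inv_into_into f_inv_into_f)
  have L: "plus_part \<phi> \<in> L2 (gauss \<sigma>)" "minus_part \<phi> \<in> L2 (gauss \<sigma>)"
    using \<phi> by (simp_all add: L2T_iff[OF \<sigma>])
  let ?F = "bargmann \<sigma> \<nu> (plus_part \<phi>)" and ?G = "bargmann \<sigma> \<nu> (minus_part \<phi>)"
  have f_comp: "idem_plus (f Z) = ?F (idem_plus Z)" "idem_minus (f Z) = ?G (idem_minus Z)" for Z
    by (simp_all add: f_eq SB_idem[OF \<sigma> \<nu> \<phi>])
  note P_entire = P.bargmann_entire[OF L(1)] and M_entire = M.bargmann_entire[OF L(2)]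
  (* the integrand of the inversion formula without its Gaussian weight *)
  define h where "h x Z = of_idem (cnj (sb_kernel \<sigma> \<nu> (idem_plus Z) x) * ?F (idem_plus Z))
      (cnj (sb_kernel \<sigma> \<nu> (idem_minus Z) x) * ?G (idem_minus Z))" for x Z
  have integrand: "SB_inv_integrand \<sigma> \<nu> f x Z = exp (- \<nu> * (norm Z)\<^sup>2) *\<^sub>R h x Z" for x Z
    unfolding SB_inv_integrand_idem h_def f_comp ..
  let ?c = "\<lambda>R. cutoff R (\<lambda>Z. ?F (idem_plus Z))" and ?d = "\<lambda>R. cutoff R (\<lambda>Z. ?G (idem_minus Z))"
  have bc: "bounded_support (?c R)" "bounded_support (?d R)" for R
    by (intro bounded_support_cutoff P.continuous_on_p M.continuous_on_p P_entire M_entire)+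
  have [measurable]: "?F \<in> borel_measurable borel" "?G \<in> borel_measurable borel"
    by (intro P.entire_measurable P_entire M_entire)+
  have hm [measurable]: "h x \<in> borel_measurable borel" for x
    by (subst borel_measurable_idem_iff) (simp add: h_def)
  have hcm: "(\<lambda>Z. indicat_real (cball 0 R) Z *\<^sub>R h x Z) \<in> borel_measurable borel" for R x
    by (intro borel_measurable_scaleR borel_measurable_indicator hm) auto
  have idem_cut: "idem_plus (indicat_real (cball 0 R) Z *\<^sub>R h x Z) = cnj (sb_kernel \<sigma> \<nu> (idem_plus Z) x) * ?c R Z"
     "idem_minus (indicat_real (cball 0 R) Z *\<^sub>R h x Z) = cnj (sb_kernel \<sigma> \<nu> (idem_minus Z) x) * ?d R Z" for R x Z
    by (simp_all add: h_def cutoff_def indicator_def)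
  have cut_int: "integrable (gauss \<nu>) (\<lambda>Z. indicat_real (cball 0 R) Z *\<^sub>R h x Z)" for R x
    by (subst integrable_idem_iff) (simp only: idem_cut P.Bstar_integrable M.Bstar_integrable bc simp_thms)
  have cut_eq: "indicat_real (cball 0 R) Z *\<^sub>R SB_inv_integrand \<sigma> \<nu> f x Z =
      exp (- \<nu> * (norm Z)\<^sup>2) *\<^sub>R (indicat_real (cball 0 R) Z *\<^sub>R h x Z)" for R x Z
    unfolding integrand by (rule scaleR_left_commute)
  show "\<forall>x R. set_integrable lborel (cball 0 R) (SB_inv_integrand \<sigma> \<nu> f x)"
    using cut_int unfolding integrable_gauss_iff[OF \<nu> hcm] set_integrable_def cut_eq by blast
  define S where "S R x = (\<nu> / pi)\<^sup>2 *\<^sub>R (LINT Z:cball 0 R|lborel. SB_inv_integrand \<sigma> \<nu> f x Z)" for R x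
  have norm4: "sqrt (\<nu> / pi) ^ DIM(bicomplex) = (\<nu> / pi)\<^sup>2" by (rule gauss_bicomplex_factor[OF \<nu>])
  have S_eq: "S R x = (LINT Z|gauss \<nu>. indicat_real (cball 0 R) Z *\<^sub>R h x Z)" for R x
    unfolding S_def set_lebesgue_integral_def cut_eq integral_gauss[OF \<nu> hcm] norm4 ..
  have S_idem: "idem_plus (S R x) = P.Bstar (?c R) x" "idem_minus (S R x) = M.Bstar (?d R) x" for R x
    unfolding S_eq idem_integral[OF cut_int] idem_cut P.Bstar_def M.Bstar_def by (rule refl)+
  have S_L2T: "S R \<in> L2T \<sigma>" for R
    unfolding L2T_iff[OF \<sigma>] S_idem using P.Bstar_L2[OF bc(1)] M.Bstar_L2[OF bc(2)] by blast
  then show "\<forall>R. (\<lambda>x. (\<nu> / pi)\<^sup>2 *\<^sub>R (LINT Z:cball 0 R|lborel. SB_inv_integrand \<sigma> \<nu> f x Z)) \<in> L2T \<sigma>"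
    unfolding S_def[abs_def] by blast
  have "(\<lambda>x. \<phi> x - S R x) \<in> L2T \<sigma>" for R
    using S_L2T[of R] L unfolding L2T_iff[OF \<sigma>] by (simp add: L2_diff)
  then have err: "L2T_norm \<sigma> (\<lambda>x. \<phi> x - S R x) =
      sqrt ((sqnorm (gauss \<sigma>) (\<lambda>x. plus_part \<phi> x - P.Bstar (?c R) x) + sqnorm (gauss \<sigma>) (\<lambda>x. minus_part \<phi> x - M.Bstar (?d R) x)) / 2)" for R
    by (simp add: L2T_norm_idem[OF \<sigma>] S_idem)
  have "((\<lambda>R. sqnorm (gauss \<sigma>) (\<lambda>x. plus_part \<phi> x - P.Bstar (?c R) x)) \<longlongrightarrow> 0) at_top"
    by (rule tendsto_sandwich[OF always_eventually always_eventually tendsto_const sqnorm_cutoff_tendsto[OF P.bargmann_L2[OF L(1)]]])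
       (simp_all add: P.inversion_error[OF L(1)])
  moreover have "((\<lambda>R. sqnorm (gauss \<sigma>) (\<lambda>x. minus_part \<phi> x - M.Bstar (?d R) x)) \<longlongrightarrow> 0) at_top"
    by (rule tendsto_sandwich[OF always_eventually always_eventually tendsto_const sqnorm_cutoff_tendsto[OF M.bargmann_L2[OF L(2)]]])
       (simp_all add: M.inversion_error[OF L(2)])
  ultimately have "((\<lambda>R. sqrt ((sqnorm (gauss \<sigma>) (\<lambda>x. plus_part \<phi> x - P.Bstar (?c R) x) + sqnorm (gauss \<sigma>) (\<lambda>x. minus_part \<phi> x - M.Bstar (?d R) x)) / 2))
      \<longlongrightarrow> sqrt ((0 + 0) / 2)) at_top"
    by (intro tendsto_real_sqrt tendsto_divide tendsto_add tendsto_const) auto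
  then have "((\<lambda>R. L2T_norm \<sigma> (\<lambda>x. \<phi> x - S R x)) \<longlongrightarrow> 0) at_top"
    unfolding err by simp
  then show "((\<lambda>R. L2T_norm \<sigma> (\<lambda>x. SB_inv \<sigma> \<nu> f x -
      (\<nu> / pi)\<^sup>2 *\<^sub>R (LINT Z:cball 0 R|lborel. SB_inv_integrand \<sigma> \<nu> f x Z))) \<longlongrightarrow> 0) at_top"
    unfolding S_def \<phi>_def .
  from P.pointwise_inversion[OF L(1)] M.pointwise_inversion[OF L(2)]
  have "AE x in gauss \<sigma>. integrable lborel (SB_inv_integrand \<sigma> \<nu> f x) \<longrightarrow>
      \<phi> x = (\<nu> / pi)\<^sup>2 *\<^sub>R (LINT Z|lborel. SB_inv_integrand \<sigma> \<nu> f x Z)"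
  proof eventually_elim
    case (elim x)
    show ?case
    proof
      assume "integrable lborel (SB_inv_integrand \<sigma> \<nu> f x)"
      then have i: "integrable (gauss \<nu>) (h x)"
        unfolding integrable_gauss_iff[OF \<nu> hm] integrand[abs_def] .
      then have "integrable (gauss \<nu>) (\<lambda>Z. idem_plus (h x Z))" "integrable (gauss \<nu>) (\<lambda>Z. idem_minus (h x Z))"
        unfolding integrable_idem_iff[of _ "h x"] by blast+
      then have "idem_plus (\<phi> x) = P.Bstar (\<lambda>Z. ?F (idem_plus Z)) x" "idem_minus (\<phi> x) = M.Bstar (\<lambda>Z. ?G (idem_minus Z)) x"
        using elim by (simp_all add: h_def)
      then have "\<phi> x = integral\<^sup>L (gauss \<nu>) (h x)"
        by (intro bicomplex_eqI) (simp_all add: idem_integral[OF i] P.Bstar_def M.Bstar_def h_def)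
      then show "\<phi> x = (\<nu> / pi)\<^sup>2 *\<^sub>R (LINT Z|lborel. SB_inv_integrand \<sigma> \<nu> f x Z)"
        unfolding integral_gauss[OF \<nu> hm] norm4 integrand .
    qed
  qed
  then show "AE x in lborel. integrable lborel (SB_inv_integrand \<sigma> \<nu> f x) \<longrightarrow>
      SB_inv \<sigma> \<nu> f x = (\<nu> / pi)\<^sup>2 *\<^sub>R (LINT Z|lborel. SB_inv_integrand \<sigma> \<nu> f x Z)"
    unfolding AE_gauss_iff[OF \<sigma>] \<phi>_def .
qed

end
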